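(* Let $M$ be an oriented matroid on a linearly ordered finite set $E$, and let $\alpha_M:2^E\to2^E$ be the mapping $$\alpha_M(A)=\bigl(\alpha(-_AM)\setminus(A\cap O^*(-_AM))\bigr)\cup\bigl(A\cap O(-_AM)\bigr).$$ 1. The mapping $A\mapsto\alpha_M(A)$ is a bijection from $2^E$ to $2^E$. It yields a bijection between reorientations $-_AM$ of $M$ and subsets of $E$, which maps activity classes of reorientations of $M$ onto intervals of bases of $M$ (and these restrictions are boolean lattice isomorphisms). 2. For all $A\subseteq E$, with $B=\alpha(-_AM)$, $P=A\cap O^*(-_AM)$, $Q=A\cap O(-_AM)$ (so that $\alpha_M(A)=(B\setminus P)\cup Q$), we have $$\mathrm{Int}_M(\alpha_M(A))=\mathrm{Int}_M(B)\setminus P=O^*(-_AM)\setminus P=\Theta^*_M(A),\qquad P_M(\alpha_M(A))=P=\bar\Theta^*_M(A),$$ $$\mathrm{Ext}_M(\alpha_M(A))=\mathrm{Ext}_M(B)\setminus Q=O(-_AM)\setminus Q=\Theta_M(A),\qquad Q_M(\alpha_M(A))=Q=\bar\Theta_M(A).$$ 3. In particular, $\alpha_M(A)=\alpha(-_AM)$ if and only if $-_AM$ is active-fixed and dual-active-fixed with respect to $M$. Similarly, restrictions of $\alpha_M$ yield bijections between the following sets (with cardinality given by the indicated Tutte polynomial evaluation): all reorientations and all subsets of $E$, $t(M;2,2)$; acyclic reorientations and subsets of internal bases (no-broken-circuit subsets), $t(M;2,0)$; totally cyclic reorientations and supersets of external bases, $t(M;0,2)$; dual-active-fixed acyclic reorientations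 and internal bases, $t(M;1,0)$; active-fixed totally cyclic reorientations and external bases, $t(M;0,1)$; active-fixed reorientations and subsets of bases (independents), $t(M;2,1)$; dual-active-fixed reorientations and supersets of bases (spanning subsets), $t(M;1,2)$; active-fixed and dual-active-fixed reorientations and bases, $t(M;1,1)$.
   Context: General conventions. $\subset$ is strict inclusion. $M(F)$ is the restriction to $F$, $M/F$ the contraction of $F$, $M^*$ the dual; all inherit the order of $E$. For $A\subseteq E$, $-_AM$ is the oriented matroid obtained by reorienting $A$; reorientations of $M$ are indexed by subsets $A\subseteq E$. Signed circuits and cocircuits come in opposite pairs; one is positive if all its signs are positive. $M$ is acyclic if it has no positive circuit, totally cyclic if it has no positive cocircuit. $M$ is bounded w.r.t. $p$ if it is acyclic and every positive cocircuit contains $p$; dual-bounded w.r.t. $p$ if it is totally cyclic and every positive circuit contains $p$. $t(M;x,y)$ is the Tutte polynomial. Orientation activities of an ordered oriented matroid $N$: $O^*(N)=\{a_1<\dots<a_\iota\}$ is the set of smallest elements of positive cocircuits, $O(N)=\{a'_1<\dots<a'_\varepsilon\}$ the set of smallest elements of positive circuits. The active filtration of $N$ is $\emptyset=F'_\varepsilon\subset\cdots\subset F'_0=F_c=F_0\subset\cdots\subset F_\iota=E$ where $F_c$ is the union of all positive circuits; $F'_k$ is the union of all positive circuits $C$ with $\min C\ge a'_{k+1}$ ($0\le k\le\varepsilon-1$); $F_k$ is the complement of the union of all positive cocircuits $D$ with $\min D\ge a_{k+1}$ ($0\le k\le\iota-1$). The active partition of $N$ consists of the parts $F'_{k-1}\setminus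 F'_k$ (smallest element $a'_k$) and $F_k\setminus F_{k-1}$ (smallest element $a_k$). Basis activities. For a basis $B$, $C^*(B;b)$ ($b\in B$) and $C(B;e)$ ($e\notin B$) are the fundamental cocircuits and circuits, signed with $b$, resp. $e$, positive. $\mathrm{Int}_M(B)=\{b\in B: b=\min C^*(B;b)\}$, $\mathrm{Ext}_M(B)=\{e\in E\setminus B: e=\min C(B;e)\}$. $B$ is internal if $\mathrm{Ext}_M(B)=\emptyset$, external if $\mathrm{Int}_M(B)=\emptyset$. The interval of $B$ is $[B\setminus\mathrm{Int}_M(B),\,B\cup\mathrm{Ext}_M(B)]$; the intervals of all bases partition $2^E$ (known). For $X$ in the interval of $B$: $\mathrm{Int}_M(X)=\mathrm{Int}_M(B)\cap X$, $P_M(X)=\mathrm{Int}_M(B)\setminus X$, $\mathrm{Ext}_M(X)=\mathrm{Ext}_M(B)\setminus X$, $Q_M(X)=\mathrm{Ext}_M(B)\cap X$. Active basis $\alpha(N)$ of an ordered oriented matroid $N$ on $E$. If $N$ is bounded w.r.t. $p=\min(E)$, $\alpha(N)$ is the unique (it is known that exactly one exists) basis $B$ such that for all $b\in B\setminus\{p\}$ the signs of $b$ and $\min C^*(B;b)$ are opposite in $C^*(B;b)$, and for all $e\in E\setminus B$ the signs of $e$ and $\min C(B;e)$ are opposite in $C(B;e)$. If $N$ is dual-bounded w.r.t. $p$, $\alpha(N)=E\setminus\alpha(N^* )$. In general, with the active filtration of $N$ (whose minors below are respectively bounded and dual-bounded w.r.t. their smallest elements), $\alpha(N)=\biguplus_{1\le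 k\le\iota}\alpha(N(F_k)/F_{k-1})\uplus\biguplus_{1\le k\le\varepsilon}\alpha(N(F'_{k-1})/F'_k)$. Refined orientation activities w.r.t. $M$: $\Theta_M(A)=O(-_AM)\setminus A$, $\bar\Theta_M(A)=O(-_AM)\cap A$, $\Theta^*_M(A)=O^*(-_AM)\setminus A$, $\bar\Theta^*_M(A)=O^*(-_AM)\cap A$. The reorientation $-_AM$ is active-fixed w.r.t. $M$ if $O(-_AM)\cap A=\emptyset$, dual-active-fixed if $O^*(-_AM)\cap A=\emptyset$. Activity class of $-_AM$: the set of the reorientations $-_{A'}M$ with $A'=A\triangle\bigcup_{a\in P\cup Q}A_a$, for $P\subseteq O^*(-_AM)$, $Q\subseteq O(-_AM)$, where $A_a$ is the part with smallest element $a$ of the active partition of $-_AM$. Activity classes partition the set of reorientations, and each contains exactly one representative which is active-fixed and dual-active-fixed. The boolean lattice structure on a class is by inclusion of $P\cup Q$ when $-_AM$ is this representative; that on the interval of $B$ is by inclusion of $P\cup Q$ when its elements are written $B\triangle(P\cup Q)$, $P\subseteq\mathrm{Int}_M(B)$, $Q\subseteq\mathrm{Ext}_M(B)$. *)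

theory Defs
  imports Main
begin

section \<open>Oriented matroids\<close>

text \<open>A signed set is the pair of its positive and its negative part.\<close>

type_synonym 'a sset = "'a set \<times> 'a set"

definition supp :: "'a sset \<Rightarrow> 'a set" where
  "supp X = fst X \<union> snd X"

definition opp :: "'a sset \<Rightarrow> 'a sset" where
  "opp X = (snd X, fst X)"

definition orthogonal :: "'a sset \<Rightarrow> 'a sset \<Rightarrow> bool" where
  "orthogonal X Y \<longleftrightarrow>
     ((fst X \<inter> fst Y) \<union> (snd X \<inter> snd Y) \<noteq> {} \<longleftrightarrow> (fst X \<inter> snd Y) \<union> (snd X \<inter> fst Y) \<noteq> {})"

definition opposite_signs :: "'a sset \<Rightarrow> 'a \<Rightarrow> 'a \<Rightarrow> bool" where
  "opposite_signs X e f \<longleftrightarrow> (e \<in> fst X \<and> f \<in> snd X) \<or> (e \<in> snd X \<and> f \<in> fst X)"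

record 'a omatroid =
  ground :: "'a set"
  circuits :: "'a sset set"

text \<open>The signed circuit axioms.\<close>

definition oriented_matroid :: "'a omatroid \<Rightarrow> bool" where
  "oriented_matroid M \<longleftrightarrow>
     finite (ground M) \<and>
     (\<forall>X\<in>circuits M. supp X \<subseteq> ground M \<and> fst X \<inter> snd X = {} \<and> supp X \<noteq> {}) \<and>
     (\<forall>X\<in>circuits M. opp X \<in> circuits M) \<and>
     (\<forall>X\<in>circuits M. \<forall>Y\<in>circuits M. supp X \<subseteq> supp Y \<longrightarrow> X = Y \<or> X = opp Y) \<and>
     (\<forall>X\<in>circuits M. \<forall>Y\<in>circuits M. \<forall>e. X \<noteq> opp Y \<and> e \<in> fst X \<inter> snd Y \<longrightarrow>
        (\<exists>Z\<in>circuits M. fst Z \<subseteq> (fst X \<union> fst Y) - {e} \<and> snd Z \<subseteq> (snd X \<union> snd Y) - {e}))"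

text \<open>The underlying matroid.\<close>

definition indep :: "'a omatroid \<Rightarrow> 'a set \<Rightarrow> bool" where
  "indep M I \<longleftrightarrow> I \<subseteq> ground M \<and> (\<forall>X\<in>circuits M. \<not> supp X \<subseteq> I)"

definition basis :: "'a omatroid \<Rightarrow> 'a set \<Rightarrow> bool" where
  "basis M B \<longleftrightarrow> indep M B \<and> (\<forall>I. indep M I \<and> B \<subseteq> I \<longrightarrow> I = B)"

definition rank :: "'a omatroid \<Rightarrow> 'a set \<Rightarrow> nat" where
  "rank M A = Max (card ` {I. I \<subseteq> A \<and> indep M I})"

definition spanning :: "'a omatroid \<Rightarrow> 'a set \<Rightarrow> bool" where
  "spanning M X \<longleftrightarrow> X \<subseteq> ground M \<and> rank M X = rank M (ground M)"

definition tutte :: "'a omatroid \<Rightarrow> 'b::comm_ring_1 \<Rightarrow> 'b \<Rightarrow> 'b" where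
  "tutte M x y = (\<Sum>A\<in>Pow (ground M).
     (x - 1) ^ (rank M (ground M) - rank M A) * (y - 1) ^ (card A - rank M A))"

definition meets_all_bases :: "'a omatroid \<Rightarrow> 'a set \<Rightarrow> bool" where
  "meets_all_bases M D \<longleftrightarrow> D \<subseteq> ground M \<and> (\<forall>B. basis M B \<longrightarrow> D \<inter> B \<noteq> {})"

text \<open>The signed cocircuits form the unique signature of the cocircuits of the underlying matroid
  (the minimal sets meeting every basis) which is orthogonal to all signed circuits.\<close>

definition cocircuits :: "'a omatroid \<Rightarrow> 'a sset set" where
  "cocircuits M = {Y. fst Y \<inter> snd Y = {} \<and> meets_all_bases M (supp Y) \<and>
     (\<forall>D. meets_all_bases M D \<and> D \<subseteq> supp Y \<longrightarrow> D = supp Y) \<and>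
     (\<forall>X\<in>circuits M. orthogonal X Y)}"

definition dual :: "'a omatroid \<Rightarrow> 'a omatroid" where
  "dual M = \<lparr>ground = ground M, circuits = cocircuits M\<rparr>"

definition restriction :: "'a omatroid \<Rightarrow> 'a set \<Rightarrow> 'a omatroid" where
  "restriction M F = \<lparr>ground = F, circuits = {X \<in> circuits M. supp X \<subseteq> F}\<rparr>"

definition contraction :: "'a omatroid \<Rightarrow> 'a set \<Rightarrow> 'a omatroid" where
  "contraction M F = \<lparr>ground = ground M - F,
     circuits = {(fst X - F, snd X - F) | X. X \<in> circuits M \<and> supp X - F \<noteq> {} \<and>
       (\<forall>Y\<in>circuits M. supp Y - F \<noteq> {} \<and> supp Y - F \<subseteq> supp X - F \<longrightarrow>
          supp Y - F = supp X - F)}\<rparr>"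

definition reorient :: "'a omatroid \<Rightarrow> 'a set \<Rightarrow> 'a omatroid" where
  "reorient M A = \<lparr>ground = ground M,
     circuits = (\<lambda>X. ((fst X - A) \<union> (snd X \<inter> A), (snd X - A) \<union> (fst X \<inter> A))) ` circuits M\<rparr>"

definition positive :: "'a sset \<Rightarrow> bool" where
  "positive X \<longleftrightarrow> snd X = {}"

definition acyclic_om :: "'a omatroid \<Rightarrow> bool" where
  "acyclic_om M \<longleftrightarrow> (\<forall>X\<in>circuits M. \<not> positive X)"

definition totally_cyclic :: "'a omatroid \<Rightarrow> bool" where
  "totally_cyclic M \<longleftrightarrow> (\<forall>Y\<in>cocircuits M. \<not> positive Y)"

section \<open>Activities of bases and of subsets\<close>

text \<open>The linear order on the ground set is that of the ambient type.\<close>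

definition fund_circuit :: "'a omatroid \<Rightarrow> 'a set \<Rightarrow> 'a \<Rightarrow> 'a sset" where
  "fund_circuit M B e = (THE X. X \<in> circuits M \<and> supp X \<subseteq> insert e B \<and> e \<in> fst X)"

definition fund_cocircuit :: "'a omatroid \<Rightarrow> 'a set \<Rightarrow> 'a \<Rightarrow> 'a sset" where
  "fund_cocircuit M B b =
     (THE Y. Y \<in> cocircuits M \<and> supp Y \<subseteq> insert b (ground M - B) \<and> b \<in> fst Y)"

definition int_basis :: "'a::linorder omatroid \<Rightarrow> 'a set \<Rightarrow> 'a set" where
  "int_basis M B = {b \<in> B. b = Min (supp (fund_cocircuit M B b))}"

definition ext_basis :: "'a::linorder omatroid \<Rightarrow> 'a set \<Rightarrow> 'a set" where
  "ext_basis M B = {e \<in> ground M - B. e = Min (supp (fund_circuit M B e))}"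

definition internal_basis :: "'a::linorder omatroid \<Rightarrow> 'a set \<Rightarrow> bool" where
  "internal_basis M B \<longleftrightarrow> basis M B \<and> ext_basis M B = {}"

definition external_basis :: "'a::linorder omatroid \<Rightarrow> 'a set \<Rightarrow> bool" where
  "external_basis M B \<longleftrightarrow> basis M B \<and> int_basis M B = {}"

definition no_broken_circuit :: "'a::linorder omatroid \<Rightarrow> 'a set \<Rightarrow> bool" where
  "no_broken_circuit M X \<longleftrightarrow>
     X \<subseteq> ground M \<and> (\<forall>C\<in>circuits M. \<not> supp C - {Min (supp C)} \<subseteq> X)"

definition interval :: "'a::linorder omatroid \<Rightarrow> 'a set \<Rightarrow> 'a set set" where
  "interval M B = {X. B - int_basis M B \<subseteq> X \<and> X \<subseteq> B \<union> ext_basis M B}"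

text \<open>The intervals of the bases partition the subsets of the ground set, so that the basis below
  is uniquely determined.\<close>

definition basis_of :: "'a::linorder omatroid \<Rightarrow> 'a set \<Rightarrow> 'a set" where
  "basis_of M X = (THE B. basis M B \<and> X \<in> interval M B)"

definition Int_set :: "'a::linorder omatroid \<Rightarrow> 'a set \<Rightarrow> 'a set" where
  "Int_set M X = int_basis M (basis_of M X) \<inter> X"

definition P_set :: "'a::linorder omatroid \<Rightarrow> 'a set \<Rightarrow> 'a set" where
  "P_set M X = int_basis M (basis_of M X) - X"

definition Ext_set :: "'a::linorder omatroid \<Rightarrow> 'a set \<Rightarrow> 'a set" where
  "Ext_set M X = ext_basis M (basis_of M X) - X"

definition Q_set :: "'a::linorder omatroid \<Rightarrow> 'a set \<Rightarrow> 'a set" where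
  "Q_set M X = ext_basis M (basis_of M X) \<inter> X"

section \<open>Orientation activities and the active filtration\<close>

definition O_act :: "'a::linorder omatroid \<Rightarrow> 'a set" where
  "O_act N = {Min (supp X) | X. X \<in> circuits N \<and> positive X}"

definition O_star :: "'a::linorder omatroid \<Rightarrow> 'a set" where
  "O_star N = {Min (supp Y) | Y. Y \<in> cocircuits N \<and> positive Y}"

text \<open>\<open>filt N k\<close> and \<open>filt_cyc N k\<close> are the sets $F_k$ and $F'_k$. Lists are indexed from $0$, so
  entry \<open>k\<close> of a sorted list is the element with index $k+1$.\<close>

definition filt :: "'a::linorder omatroid \<Rightarrow> nat \<Rightarrow> 'a set" where
  "filt N k = (if k < card (O_star N)
     then ground N - \<Union>{supp Y | Y. Y \<in> cocircuits N \<and> positive Y \<and>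
            sorted_list_of_set (O_star N) ! k \<le> Min (supp Y)}
     else ground N)"

definition filt_cyc :: "'a::linorder omatroid \<Rightarrow> nat \<Rightarrow> 'a set" where
  "filt_cyc N k = (if k < card (O_act N)
     then \<Union>{supp X | X. X \<in> circuits N \<and> positive X \<and>
            sorted_list_of_set (O_act N) ! k \<le> Min (supp X)}
     else {})"

definition active_partition :: "'a::linorder omatroid \<Rightarrow> 'a set set" where
  "active_partition N =
     (\<lambda>k. filt N k - filt N (k - 1)) ` {1..card (O_star N)} \<union>
     (\<lambda>k. filt_cyc N (k - 1) - filt_cyc N k) ` {1..card (O_act N)}"

definition active_part :: "'a::linorder omatroid \<Rightarrow> 'a \<Rightarrow> 'a set" where
  "active_part N a = (THE S. S \<in> active_partition N \<and> Min S = a)"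

section \<open>The active basis\<close>

text \<open>\<open>alpha_bounded\<close> and \<open>alpha_dual_bounded\<close> are meaningful for oriented matroids which are bounded,
  respectively dual-bounded, with respect to the smallest element \<open>p\<close>. In these two cases the active
  filtration only consists of the empty set and the ground set, and \<open>alpha\<close> agrees with the
  respective function, so that no case distinction is needed in \<open>alpha\<close>.\<close>

definition alpha_bounded :: "'a::linorder omatroid \<Rightarrow> 'a set" where
  "alpha_bounded N = (let p = Min (ground N) in THE B. basis N B \<and>
     (\<forall>b\<in>B - {p}. opposite_signs (fund_cocircuit N B b) b (Min (supp (fund_cocircuit N B b)))) \<and>
     (\<forall>e\<in>ground N - B. opposite_signs (fund_circuit N B e) e (Min (supp (fund_circuit N B e)))))"

definition alpha_dual_bounded :: "'a::linorder omatroid \<Rightarrow> 'a set" where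
  "alpha_dual_bounded N = ground N - alpha_bounded (dual N)"

definition alpha :: "'a::linorder omatroid \<Rightarrow> 'a set" where
  "alpha N =
     (\<Union>k\<in>{1..card (O_star N)}.
        alpha_bounded (contraction (restriction N (filt N k)) (filt N (k - 1)))) \<union>
     (\<Union>k\<in>{1..card (O_act N)}.
        alpha_dual_bounded (contraction (restriction N (filt_cyc N (k - 1))) (filt_cyc N k)))"

definition alpha_map :: "'a::linorder omatroid \<Rightarrow> 'a set \<Rightarrow> 'a set" where
  "alpha_map M A =
     (alpha (reorient M A) - (A \<inter> O_star (reorient M A))) \<union> (A \<inter> O_act (reorient M A))"

section \<open>Refined activities and activity classes\<close>

text \<open>The reorientations of \<open>M\<close> are represented by the subsets \<open>A\<close> of its ground set: different
  subsets count as different reorientations even if the resulting signed circuits coincide.\<close>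

definition Theta :: "'a::linorder omatroid \<Rightarrow> 'a set \<Rightarrow> 'a set" where
  "Theta M A = O_act (reorient M A) - A"

definition Theta_bar :: "'a::linorder omatroid \<Rightarrow> 'a set \<Rightarrow> 'a set" where
  "Theta_bar M A = O_act (reorient M A) \<inter> A"

definition Theta_star :: "'a::linorder omatroid \<Rightarrow> 'a set \<Rightarrow> 'a set" where
  "Theta_star M A = O_star (reorient M A) - A"

definition Theta_star_bar :: "'a::linorder omatroid \<Rightarrow> 'a set \<Rightarrow> 'a set" where
  "Theta_star_bar M A = O_star (reorient M A) \<inter> A"

definition active_fixed :: "'a::linorder omatroid \<Rightarrow> 'a set \<Rightarrow> bool" where
  "active_fixed M A \<longleftrightarrow> O_act (reorient M A) \<inter> A = {}"

definition dual_active_fixed :: "'a::linorder omatroid \<Rightarrow> 'a set \<Rightarrow> bool" where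
  "dual_active_fixed M A \<longleftrightarrow> O_star (reorient M A) \<inter> A = {}"

definition flip_parts :: "'a::linorder omatroid \<Rightarrow> 'a set \<Rightarrow> 'a set \<Rightarrow> 'a set" where
  "flip_parts M A S = sym_diff A (\<Union>a\<in>S. active_part (reorient M A) a)"

definition activity_class :: "'a::linorder omatroid \<Rightarrow> 'a set \<Rightarrow> 'a set set" where
  "activity_class M A =
     {flip_parts M A (P \<union> Q) | P Q. P \<subseteq> O_star (reorient M A) \<and> Q \<subseteq> O_act (reorient M A)}"

definition activity_classes :: "'a::linorder omatroid \<Rightarrow> 'a set set set" where
  "activity_classes M = activity_class M ` Pow (ground M)"

definition class_rep :: "'a::linorder omatroid \<Rightarrow> 'a set set \<Rightarrow> 'a set" where
  "class_rep M K = (THE A. A \<in> K \<and> active_fixed M A \<and> dual_active_fixed M A)"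

text \<open>The orders of the boolean lattice structures of an activity class \<open>K\<close> and of the interval of
  a basis \<open>B\<close>. The latter is not the order by inclusion: its least element is \<open>B\<close>. An order
  isomorphism between them is the same as a boolean lattice isomorphism.\<close>

definition class_le :: "'a::linorder omatroid \<Rightarrow> 'a set set \<Rightarrow> 'a set \<Rightarrow> 'a set \<Rightarrow> bool" where
  "class_le M K X Y \<longleftrightarrow> (let A = class_rep M K; N = reorient M A in
     \<exists>P Q P' Q'. P \<subseteq> O_star N \<and> Q \<subseteq> O_act N \<and> P' \<subseteq> O_star N \<and> Q' \<subseteq> O_act N \<and>
       X = flip_parts M A (P \<union> Q) \<and> Y = flip_parts M A (P' \<union> Q') \<and> P \<union> Q \<subseteq> P' \<union> Q')"

definition interval_le :: "'a::linorder omatroid \<Rightarrow> 'a set \<Rightarrow> 'a set \<Rightarrow> 'a set \<Rightarrow> bool" where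
  "interval_le M B X Y \<longleftrightarrow>
     (\<exists>P Q P' Q'. P \<subseteq> int_basis M B \<and> Q \<subseteq> ext_basis M B \<and>
       P' \<subseteq> int_basis M B \<and> Q' \<subseteq> ext_basis M B \<and>
       X = sym_diff B (P \<union> Q) \<and> Y = sym_diff B (P' \<union> Q') \<and> P \<union> Q \<subseteq> P' \<union> Q')"

definition order_isomorphism ::
  "('b \<Rightarrow> 'c) \<Rightarrow> 'b set \<Rightarrow> ('b \<Rightarrow> 'b \<Rightarrow> bool) \<Rightarrow> 'c set \<Rightarrow> ('c \<Rightarrow> 'c \<Rightarrow> bool) \<Rightarrow> bool" where
  "order_isomorphism f K le_K L le_L \<longleftrightarrow>
     bij_betw f K L \<and> (\<forall>x\<in>K. \<forall>y\<in>K. le_K x y \<longleftrightarrow> le_L (f x) (f y))"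

end

theory Submission
  imports Defs
begin

text \<open>A basis \<open>B\<close> determines the active partition and the inactive part of any reorientation with active
  basis \<open>B\<close>: the parts are given by a level function, which is computed from the fundamental circuits
  and cocircuits by recursion along the order, and the membership of an inactive element \<open>x\<close> in \<open>A\<close> is
  determined by that of the smallest element of the same level in its fundamental circuit or cocircuit.
  So every triple of a basis \<open>B\<close>, a subset \<open>P\<close> of its internally active and a subset \<open>Q\<close> of its
  externally active elements gives a reorientation \<open>A\<close>. By orthogonality and the painting lemma, the
  level sets are the active partition of \<open>-\<^sub>A M\<close>, and \<open>B\<close> is its active basis, since a fully optimal
  basis is unique. Hence triples are mapped injectively to subsets. Since the intervals of the bases
  partition the subsets, there are as many triples as subsets, and every reorientation arises in this
  way. The existence of fully optimal bases is obtained from this count.\<close>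

section \<open>From circuits to the painting property\<close>

text \<open>The count replaces the hard direction: fully optimal bases are not produced by an
  algorithm or a geometric argument, and only their uniqueness is proved directly. The construction
  is uniform because levels depend on supports alone: one level function of \<open>B\<close> in
  \<open>M\<close> serves every reorientation built from \<open>B\<close>, and signs enter only when
  the inactive elements are distributed. Levels are signed integers, so duality is negation and half
  of the statements follow from the other half. Two obstacles shape the beginning. Cocircuits are
  defined through supports and orthogonality to all circuits, so their existence must be derived
  from weak elimination; this is done by contracting to rank one, with conformal covering in place
  of strong elimination. Moreover, the active filtration needs minors, and traces of circuits on a
  minor need not be minimal. Hence the work is done in dual pairs, a class closed under duality,
  reorientation and minors, where orthogonality and painting replace incomparability of
  supports.\<close>

lemma finite_maximal_superset:
  assumes "finite E" "P U" "\<And>V. P V \<Longrightarrow> V \<subseteq> E"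
  obtains V where "P V" "U \<subseteq> V" "\<And>W. P W \<Longrightarrow> V \<subseteq> W \<Longrightarrow> W = V"
proof -
  have "finite {V. P V}"
    by (rule finite_subset[of _ "Pow E"]) (use assms in auto)
  then have "\<exists>V\<in>{V. P V}. U \<subseteq> V \<and> (\<forall>W\<in>{V. P V}. V \<subseteq> W \<longrightarrow> V = W)"
    by (rule finite_has_maximal2) (use assms(2) in simp)
  then obtain V where "P V" "U \<subseteq> V" and max: "\<forall>W. P W \<longrightarrow> V \<subseteq> W \<longrightarrow> V = W" by auto
  show thesis by (rule that[of V]) (use \<open>P V\<close> \<open>U \<subseteq> V\<close> max in auto)
qed

definition sdiff :: "'a sset \<Rightarrow> 'a set \<Rightarrow> 'a sset" where
  "sdiff X U = (fst X - U, snd X - U)"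

definition conformal :: "'a sset \<Rightarrow> 'a sset \<Rightarrow> bool" where
  "conformal Z X \<longleftrightarrow> fst Z \<subseteq> fst X \<and> snd Z \<subseteq> snd X"

lemma supp_opp [simp]: "supp (opp X) = supp X"
  by (auto simp: supp_def opp_def)

lemma opp_opp [simp]: "opp (opp X) = X"
  by (simp add: opp_def)

lemma fst_opp [simp]: "fst (opp X) = snd X" and snd_opp [simp]: "snd (opp X) = fst X"
  by (simp_all add: opp_def)

lemma opp_eq_iff: "X = opp Y \<longleftrightarrow> Y = opp X"
  by (auto simp: opp_def)

lemma fst_sdiff [simp]: "fst (sdiff X U) = fst X - U" and snd_sdiff [simp]: "snd (sdiff X U) = snd X - U"
  by (simp_all add: sdiff_def)

lemma supp_sdiff [simp]: "supp (sdiff X U) = supp X - U"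
  by (auto simp: supp_def)

lemma sdiff_sdiff: "sdiff (sdiff X U) V = sdiff X (U \<union> V)"
  by (auto simp: sdiff_def)

lemma sdiff_opp: "sdiff (opp X) U = opp (sdiff X U)"
  by (simp add: sdiff_def opp_def)

lemma in_supp_iff: "e \<in> supp X \<longleftrightarrow> e \<in> fst X \<or> e \<in> snd X"
  by (simp add: supp_def)

lemma conformal_supp: "conformal Z X \<Longrightarrow> supp Z \<subseteq> supp X"
  by (auto simp: conformal_def supp_def)

lemma conformal_sdiff: "conformal Z X \<Longrightarrow> conformal (sdiff Z U) (sdiff X U)"
  by (auto simp: conformal_def)

lemma conformal_trans: "conformal X Y \<Longrightarrow> conformal Y Z \<Longrightarrow> conformal X Z"
  by (auto simp: conformal_def)

text \<open>A single common element would realize just one of the two sign patterns that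
  \<open>orthogonal\<close> couples. Most contradictions about the underlying matroid are reached
  this way.\<close>

lemma orthogonal_single:
  assumes orth: "orthogonal X Y" and disj: "fst X \<inter> snd X = {}" "fst Y \<inter> snd Y = {}"
  shows "supp X \<inter> supp Y \<noteq> {e}"
proof
  assume eq: "supp X \<inter> supp Y = {e}"
  have "x = e" if "x \<in> (fst X \<union> snd X) \<inter> (fst Y \<union> snd Y)" for x
    using that eq by (auto simp: supp_def)
  moreover have "e \<in> fst X \<union> snd X" "e \<in> fst Y \<union> snd Y" using eq by (auto simp: supp_def)
  ultimately show False using orth disj unfolding orthogonal_def by blast
qed

locale signed_circuits =
  fixes C :: "'a sset set"
  assumes finite_supp: "X \<in> C \<Longrightarrow> finite (supp X)"
    and disjoint: "X \<in> C \<Longrightarrow> fst X \<inter> snd X = {}"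
    and nonempty: "X \<in> C \<Longrightarrow> supp X \<noteq> {}"
    and opp_mem: "X \<in> C \<Longrightarrow> opp X \<in> C"
    and antichain: "X \<in> C \<Longrightarrow> Y \<in> C \<Longrightarrow> supp X \<subseteq> supp Y \<Longrightarrow> X = Y \<or> X = opp Y"
    and elimination: "X \<in> C \<Longrightarrow> Y \<in> C \<Longrightarrow> X \<noteq> opp Y \<Longrightarrow> e \<in> fst X \<inter> snd Y \<Longrightarrow>
      \<exists>Z\<in>C. fst Z \<subseteq> (fst X \<union> fst Y) - {e} \<and> snd Z \<subseteq> (snd X \<union> snd Y) - {e}"
begin

lemma supp_antichain: "X \<in> C \<Longrightarrow> Y \<in> C \<Longrightarrow> supp X \<subseteq> supp Y \<Longrightarrow> supp X = supp Y"
  using antichain by fastforce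

lemma sign_choose: "X \<in> C \<Longrightarrow> e \<in> supp X \<Longrightarrow> \<exists>X'\<in>C. supp X' = supp X \<and> e \<in> fst X'"
  using opp_mem[of X] by (cases "e \<in> fst X") (auto simp: in_supp_iff intro: bexI[of _ "opp X"])

lemma elimination_sym:
  assumes "X \<in> C" "Y \<in> C" "X \<noteq> opp Y" "e \<in> (fst X \<inter> snd Y) \<union> (snd X \<inter> fst Y)"
  shows "\<exists>Z\<in>C. fst Z \<subseteq> (fst X \<union> fst Y) - {e} \<and> snd Z \<subseteq> (snd X \<union> snd Y) - {e}"
proof (cases "e \<in> fst X \<inter> snd Y")
  case True
  then show ?thesis using elimination assms(1-3) by blast
next
  case False
  then have "e \<in> fst Y \<inter> snd X" "Y \<noteq> opp X" using assms(3,4) opp_eq_iff by auto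
  from elimination[OF assms(2,1) this(2,1)] show ?thesis by (simp add: Un_commute)
qed

text \<open>Among the circuits through \<open>g\<close> with a prescribed sign of \<open>g\<close>, one with the fewest sign
  conflicts with \<open>X\<close> has none, since eliminating a conflict against \<open>X\<close> would remove it.\<close>

lemma conformal_through:
  assumes X: "X \<in> C" and W: "W \<in> C" "g \<in> fst W" "supp W - {g} \<subset> supp X" and g: "g \<notin> supp X"
  shows "\<exists>Z\<in>C. g \<in> fst Z \<and> conformal (sdiff Z {g}) X"
proof -
  define conf where "conf Z = (fst Z \<inter> snd X) \<union> (snd Z \<inter> fst X)" for Z :: "'a sset"
  define ok where "ok Z \<longleftrightarrow> Z \<in> C \<and> g \<in> fst Z \<and> supp Z - {g} \<subset> supp X" for Z
  have finX: "finite (conf Z)" for Z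
    using finite_supp[OF X] by (auto simp: conf_def supp_def)
  have "ok W" using W by (simp add: ok_def)
  then obtain Z where Z: "ok Z" and min: "\<And>Z'. ok Z' \<Longrightarrow> card (conf Z) \<le> card (conf Z')"
    using ex_has_least_nat[of ok W "\<lambda>Z. card (conf Z)"] by blast
  have ZC: "Z \<in> C" "g \<in> fst Z" "supp Z - {g} \<subset> supp X" using Z by (auto simp: ok_def)
  have "conf Z = {}"
  proof (rule ccontr)
    assume "conf Z \<noteq> {}"
    then obtain h where h: "h \<in> conf Z" by blast
    then have hh: "h \<in> (fst Z \<inter> snd X) \<union> (snd Z \<inter> fst X)" by (simp add: conf_def)
    have "Z \<noteq> opp X" using ZC g by (auto simp: in_supp_iff)
    from elimination_sym[OF ZC(1) X this hh] obtain Z' where Z': "Z' \<in> C"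
      "fst Z' \<subseteq> (fst Z \<union> fst X) - {h}" "snd Z' \<subseteq> (snd Z \<union> snd X) - {h}" by blast
    have sub: "supp Z' - {g} \<subseteq> supp X - {h}" using Z' ZC by (auto simp: supp_def)
    have hX: "h \<in> supp X" using hh by (auto simp: supp_def)
    have "g \<in> supp Z'"
    proof (rule ccontr)
      assume "g \<notin> supp Z'"
      then have "supp Z' \<subseteq> supp X - {h}" using sub by auto
      then show False using supp_antichain[OF Z'(1) X] hX by auto
    qed
    moreover have "g \<notin> snd Z'"
      using Z'(3) ZC(2) disjoint[OF ZC(1)] g by (auto simp: in_supp_iff)
    ultimately have "ok Z'" using Z'(1) sub hX by (auto simp: ok_def in_supp_iff)
    moreover have "conf Z' \<subseteq> conf Z - {h}"
      using Z'(2,3) disjoint[OF X] by (auto simp: conf_def)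
    then have "card (conf Z') < card (conf Z)"
      using h finX by (meson Diff_subset card_Diff1_less card_mono finite_Diff le_less_trans)
    ultimately show False using min by fastforce
  qed
  then have "conformal (sdiff Z {g}) X"
    using ZC(3) by (auto simp: conf_def conformal_def supp_def)
  then show ?thesis using ZC by blast
qed

section \<open>Contraction of one element\<close>

definition contr :: "'a \<Rightarrow> 'a sset set" where
  "contr g = {sdiff X {g} | X. X \<in> C \<and> supp X - {g} \<noteq> {} \<and>
     (\<forall>Y\<in>C. supp Y - {g} \<noteq> {} \<and> supp Y - {g} \<subseteq> supp X - {g} \<longrightarrow> supp Y - {g} = supp X - {g})}"

text \<open>As \<open>g\<close> lies in \<open>X\<close>, a support that is no larger off
  \<open>g\<close> is contained in that of \<open>X\<close>, so the antichain property already gives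
  minimality.\<close>

lemma contr_through:
  assumes "X \<in> C" "g \<in> supp X" "supp X \<noteq> {g}"
  shows "sdiff X {g} \<in> contr g"
proof -
  have "supp Y - {g} = supp X - {g}"
    if "Y \<in> C" "supp Y - {g} \<subseteq> supp X - {g}" for Y
    using supp_antichain[of Y X] that assms by blast
  then show ?thesis using assms unfolding contr_def by blast
qed

text \<open>This takes the place of strong elimination. If \<open>X\<close> is not minimal off
  \<open>g\<close>, some \<open>W\<close> through \<open>g\<close> is smaller off \<open>g\<close>.
  It yields conformal circuits through \<open>g\<close> with either sign at \<open>g\<close>.
  Eliminating \<open>g\<close> between them gives back the support of \<open>X\<close>, so one of
  the two contains \<open>h\<close>.\<close>

lemma contr_cover:
  assumes X: "X \<in> C" and h: "h \<in> supp X - {g}"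
  shows "\<exists>Z\<in>contr g. h \<in> supp Z \<and> conformal Z (sdiff X {g})"
proof (cases "sdiff X {g} \<in> contr g")
  case True
  then show ?thesis using h by (intro bexI[OF _ True]) (auto simp: conformal_def)
next
  case False
  then obtain W where W: "W \<in> C" "supp W - {g} \<noteq> {}" "supp W - {g} \<subset> supp X - {g}"
    using X h unfolding contr_def by blast
  have g: "g \<notin> supp X" using contr_through[OF X] False h by blast
  have gW: "g \<in> supp W" using supp_antichain[OF W(1) X] W(3) by blast
  have W': "supp W - {g} \<subset> supp X" using W(3) g by blast
  obtain W1 where W1: "W1 \<in> C" "g \<in> fst W1" "supp W1 = supp W"
    using sign_choose[OF W(1) gW] by blast
  have nl: "supp Z \<noteq> {g}" if Z: "Z \<in> C" for Z
  proof
    assume eq: "supp Z = {g}"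
    then have "supp W = {g}" using supp_antichain[OF Z W(1)] gW by simp
    then show False using W(2) by simp
  qed
  obtain Z1 where Z1: "Z1 \<in> C" "g \<in> fst Z1" "conformal (sdiff Z1 {g}) X"
    using conformal_through[OF X W1(1,2)] W1(3) W' g by auto
  \<comment> \<open>Working with \<open>opp X\<close> and negating afterwards supplies the negative
    sign at \<open>g\<close>.\<close>
  obtain Z2 where Z2: "Z2 \<in> C" "g \<in> fst Z2" "conformal (sdiff Z2 {g}) (opp X)"
    using conformal_through[OF opp_mem[OF X] W1(1,2)] W1(3) W' g by auto
  define Z3 where "Z3 = opp Z2"
  have Z3: "Z3 \<in> C" "g \<in> snd Z3" "conformal (sdiff Z3 {g}) X"
    using Z2 opp_mem by (auto simp: Z3_def conformal_def)
  have "Z1 \<noteq> opp Z3"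
  proof
    assume eq: "Z1 = opp Z3"
    have "supp Z1 - {g} = {}"
      using Z1(3) Z3(3) disjoint[OF X] unfolding eq by (auto simp: conformal_def supp_def)
    then show False using nl[OF Z1(1)] Z1(2) by (auto simp: supp_def)
  qed
  from elimination[OF Z1(1) Z3(1) this, of g] Z1(2) Z3(2) obtain V where V: "V \<in> C"
    "fst V \<subseteq> (fst Z1 \<union> fst Z3) - {g}" "snd V \<subseteq> (snd Z1 \<union> snd Z3) - {g}" by blast
  have "supp V \<subseteq> supp X" using V Z1(3) Z3(3) by (auto simp: conformal_def supp_def)
  then have "supp V = supp X" using supp_antichain V(1) X by blast
  then have "h \<in> supp Z1 \<or> h \<in> supp Z3" using V(2,3) h by (auto simp: supp_def)
  then obtain Z where Z: "Z \<in> C" "g \<in> supp Z" "conformal (sdiff Z {g}) X" "h \<in> supp Z"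
    using Z1 Z3 unfolding supp_def by blast
  have "sdiff Z {g} \<in> contr g" using contr_through Z nl by blast
  moreover have "sdiff X {g} = X" using g by (cases X) (auto simp: sdiff_def supp_def)
  ultimately show ?thesis using Z h by (metis Diff_iff supp_sdiff)
qed

text \<open>Elimination in \<open>C\<close> may leave a signed set that is not minimal off
  \<open>g\<close>; by \<open>contr_cover\<close> it contains a conformal member of
  \<open>contr g\<close>, and conformality keeps the sign bounds.\<close>

lemma signed_circuits_contr: "signed_circuits (contr g)"
proof
  fix X assume "X \<in> contr g"
  then obtain X' where X': "X = sdiff X' {g}" "X' \<in> C" "supp X' - {g} \<noteq> {}"
    and min: "\<And>Y. Y \<in> C \<Longrightarrow> supp Y - {g} \<noteq> {} \<Longrightarrow> supp Y - {g} \<subseteq> supp X' - {g} \<Longrightarrow>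
      supp Y - {g} = supp X' - {g}"
    unfolding contr_def by blast
  show "finite (supp X)" "fst X \<inter> snd X = {}" "supp X \<noteq> {}"
    using X'(3) finite_supp[OF X'(2)] disjoint[OF X'(2)] by (auto simp: X'(1))
  show "opp X \<in> contr g"
    unfolding contr_def mem_Collect_eq X'(1)
    by (rule exI[of _ "opp X'"]) (use X'(3) opp_mem[OF X'(2)] min in \<open>auto simp: sdiff_opp\<close>)
  fix Y assume "Y \<in> contr g"
  then obtain Y' where Y': "Y = sdiff Y' {g}" "Y' \<in> C" "supp Y' - {g} \<noteq> {}"
    and min': "\<And>Z. Z \<in> C \<Longrightarrow> supp Z - {g} \<noteq> {} \<Longrightarrow> supp Z - {g} \<subseteq> supp Y' - {g} \<Longrightarrow>
      supp Z - {g} = supp Y' - {g}"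
    unfolding contr_def by blast
  { assume "supp X \<subseteq> supp Y"
    then have "supp X' - {g} = supp Y' - {g}" using X' Y' min' by simp
    then have "supp X' \<subseteq> supp Y' \<or> supp Y' \<subseteq> supp X'" by blast
    then show "X = Y \<or> X = opp Y"
      using antichain[OF X'(2) Y'(2)] antichain[OF Y'(2) X'(2)] X'(1) Y'(1)
      by (auto simp: sdiff_opp) }
  fix e assume ne: "X \<noteq> opp Y" and e: "e \<in> fst X \<inter> snd Y"
  have "X' \<noteq> opp Y'" using ne X'(1) Y'(1) by (auto simp: sdiff_opp)
  with elimination[OF X'(2) Y'(2) this, of e] e X' Y'
  obtain Z where Z: "Z \<in> C" "fst Z \<subseteq> (fst X' \<union> fst Y') - {e}" "snd Z \<subseteq> (snd X' \<union> snd Y') - {e}"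
    by auto
  \<comment> \<open>Otherwise \<open>g\<close> would be a loop contained in \<open>X'\<close> or
    \<open>Y'\<close>, and the antichain property would leave nothing of that circuit off
    \<open>g\<close>.\<close>
  have "supp Z - {g} \<noteq> {}"
  proof
    assume "supp Z - {g} = {}"
    then have Zg: "supp Z = {g}" using nonempty[OF Z(1)] by auto
    have "g \<in> supp X' \<or> g \<in> supp Y'" using Zg Z(2,3) by (auto simp: supp_def)
    then show False
      using supp_antichain[OF Z(1) X'(2)] supp_antichain[OF Z(1) Y'(2)] Zg X'(3) Y'(3) by auto
  qed
  then obtain h where "h \<in> supp Z - {g}" by blast
  from contr_cover[OF Z(1) this] obtain V where V: "V \<in> contr g" "conformal V (sdiff Z {g})" by blast
  then show "\<exists>Z\<in>contr g. fst Z \<subseteq> (fst X \<union> fst Y) - {e} \<and> snd Z \<subseteq> (snd X \<union> snd Y) - {e}"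
    using Z(2,3) X'(1) Y'(1) by (auto simp: conformal_def intro!: bexI[OF _ V(1)])
qed

end

text \<open>The contracted system is not described explicitly: lifting and conformal covering
  suffice to transfer orthogonality back to \<open>C\<close>.\<close>

lemma contraction_exists:
  assumes "finite U" "signed_circuits C"
  shows "\<exists>C'. signed_circuits C' \<and> (\<forall>Z\<in>C'. \<exists>X\<in>C. Z = sdiff X U) \<and>
    (\<forall>X\<in>C. \<forall>h\<in>supp X - U. \<exists>Z\<in>C'. h \<in> supp Z \<and> conformal Z (sdiff X U))"
  using assms
proof (induction U rule: finite_induct)
  case empty
  then show ?case by (intro exI[of _ C]) (auto simp: sdiff_def conformal_def)
next
  case (insert g U)
  then obtain C' where C': "signed_circuits C'" "\<And>Z. Z \<in> C' \<Longrightarrow> \<exists>X\<in>C. Z = sdiff X U"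
    "\<And>X h. X \<in> C \<Longrightarrow> h \<in> supp X - U \<Longrightarrow> \<exists>Z\<in>C'. h \<in> supp Z \<and> conformal Z (sdiff X U)"
    by blast
  interpret signed_circuits C' by fact
  show ?case
  proof (intro exI conjI ballI)
    show "signed_circuits (contr g)" by (rule signed_circuits_contr)
    show "\<exists>X\<in>C. Z = sdiff X (insert g U)" if "Z \<in> contr g" for Z
      using that C'(2) unfolding contr_def by (fastforce simp: sdiff_sdiff)
    fix X h assume X: "X \<in> C" and h: "h \<in> supp X - insert g U"
    then obtain Z where Z: "Z \<in> C'" "h \<in> supp Z" "conformal Z (sdiff X U)" using C'(3) by blast
    with h obtain V where V: "V \<in> contr g" "h \<in> supp V" "conformal V (sdiff Z {g})"
      using contr_cover[of Z h g] by blast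
    have "conformal V (sdiff X (insert g U))"
      using conformal_trans[OF V(3) conformal_sdiff[OF Z(3)]] by (simp add: sdiff_sdiff)
    then show "\<exists>Z\<in>contr g. h \<in> supp Z \<and> conformal Z (sdiff X (insert g U))" using V by blast
  qed
qed

text \<open>A cocircuit signature: contract a maximal set \<open>U\<close> which does not span \<open>e\<close>. In the resulting
  rank one oriented matroid all circuits have two elements.\<close>

lemma (in signed_circuits) orthogonal_vector:
  assumes fin: "finite E" and e: "e \<in> E" and U: "U \<subseteq> E - {e}"
    and no: "\<And>X. X \<in> C \<Longrightarrow> e \<in> supp X \<Longrightarrow> \<not> supp X \<subseteq> insert e U"
  shows "\<exists>Y. fst Y \<inter> snd Y = {} \<and> supp Y \<subseteq> E - U \<and> e \<in> supp Y \<and>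
    (\<forall>X\<in>C. supp X \<subseteq> E \<longrightarrow> orthogonal X Y) \<and>
    (\<forall>Z. fst Z \<inter> snd Z = {} \<and> supp Z \<noteq> {} \<and> (\<forall>X\<in>C. supp X \<subseteq> E \<longrightarrow> orthogonal X Z) \<and>
      supp Z \<subseteq> supp Y \<longrightarrow> supp Z = supp Y)"
proof -
  define free where "free V \<longleftrightarrow> U \<subseteq> V \<and> V \<subseteq> E - {e} \<and> (\<forall>X\<in>C. e \<in> supp X \<longrightarrow> \<not> supp X \<subseteq> insert e V)" for V
  have "free U" using U no by (auto simp: free_def)
  then obtain V where V: "free V" and "U \<subseteq> V" and max: "\<And>W. free W \<Longrightarrow> V \<subseteq> W \<Longrightarrow> W = V"
    by (rule finite_maximal_superset[OF fin]) (auto simp: free_def)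
  have "finite V" using V fin by (meson Diff_subset finite_subset free_def)
  from contraction_exists[OF this signed_circuits_axioms]
  obtain C' where C': "signed_circuits C'" and lift: "\<And>Z. Z \<in> C' \<Longrightarrow> \<exists>X\<in>C. Z = sdiff X V"
    and cover: "\<And>X h. X \<in> C \<Longrightarrow> h \<in> supp X - V \<Longrightarrow> \<exists>Z\<in>C'. h \<in> supp Z \<and> conformal Z (sdiff X V)"
    by blast
  interpret C': signed_circuits C' by fact
  have eloop: "supp Z \<noteq> {e}" if Z: "Z \<in> C'" for Z
  proof
    assume "supp Z = {e}"
    moreover obtain X where "X \<in> C" "Z = sdiff X V" using lift[OF Z] by blast
    ultimately have "e \<in> supp X" "supp X \<subseteq> insert e V" by auto
    then show False using V \<open>X \<in> C\<close> by (auto simp: free_def)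
  qed
  have pair: "\<exists>Z\<in>C'. supp Z = {e, f} \<and> e \<in> fst Z" if f: "f \<in> E - V" "f \<noteq> e" for f
  proof -
    have "\<not> free (insert f V)" using max[of "insert f V"] f by auto
    then obtain X where X: "X \<in> C" "e \<in> supp X" "supp X \<subseteq> insert e (insert f V)"
      using V f by (auto simp: free_def)
    have "e \<in> supp X - V" using X V by (auto simp: free_def)
    from cover[OF X(1) this] obtain Z where Z: "Z \<in> C'" "e \<in> supp Z" "conformal Z (sdiff X V)" by blast
    have "supp Z \<subseteq> {e, f}" using conformal_supp[OF Z(3)] X(3) by auto
    then have "supp Z = {e, f}" using Z(2) eloop[OF Z(1)] by auto
    then show ?thesis using C'.sign_choose[OF Z(1,2)] by auto
  qed
  \<comment> \<open>With \<open>e\<close> positive, orthogonality to the circuit on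
    \<open>{e, f}\<close> dictates the sign of \<open>f\<close>: positive if the circuit has
    opposite signs on \<open>e\<close> and \<open>f\<close>, negative otherwise.\<close>
  define Y where "Y = (insert e {f \<in> E - V. \<exists>Z\<in>C'. supp Z = {e, f} \<and> e \<in> fst Z \<and> f \<in> snd Z},
    {f \<in> E - V. f \<noteq> e \<and> (\<exists>Z\<in>C'. supp Z = {e, f} \<and> e \<in> fst Z \<and> f \<in> fst Z)})"
  have uniq: "Z = Z'" if "Z \<in> C'" "Z' \<in> C'" "supp Z = supp Z'" "x \<in> fst Z" "x \<in> fst Z'" for Z Z' x
    using C'.antichain[OF that(1,2)] C'.disjoint[OF that(2)] that(3-5) by auto
  have Yd: "fst Y \<inter> snd Y = {}"
  proof (rule ccontr)
    assume "fst Y \<inter> snd Y \<noteq> {}"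
    then obtain f where "f \<in> fst Y" "f \<in> snd Y" by blast
    then obtain Z Z' where "Z \<in> C'" "supp Z = {e, f}" "e \<in> fst Z" "f \<in> snd Z"
      "Z' \<in> C'" "supp Z' = {e, f}" "e \<in> fst Z'" "f \<in> fst Z'"
      unfolding Y_def by auto
    then show False using uniq[of Z Z' e] C'.disjoint[of Z] by auto
  qed
  have Ys: "supp Y = E - V"
  proof
    show "supp Y \<subseteq> E - V" using e V by (auto simp: Y_def supp_def free_def)
    show "E - V \<subseteq> supp Y"
    proof
      fix f assume f: "f \<in> E - V"
      show "f \<in> supp Y"
      proof (cases "f = e")
        case False
        then obtain Z where "Z \<in> C'" "supp Z = {e, f}" "e \<in> fst Z" using pair f by blast
        then show ?thesis using f False unfolding Y_def supp_def by auto
      qed (simp add: Y_def supp_def)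
    qed
  qed
  have Ye: "e \<in> fst Y" by (simp add: Y_def)
  have orth': "orthogonal Z Y \<and> Z \<noteq> ({},{})" if Z: "Z \<in> C'" "supp Z \<subseteq> E" for Z
  proof -
    have ZV: "supp Z \<subseteq> E - V" using lift[OF Z(1)] Z(2) by auto
    have ex: "\<exists>f\<in>supp Z. f \<noteq> e" using eloop[OF Z(1)] C'.nonempty[OF Z(1)] by auto
    have two: "\<exists>W\<in>C'. supp W \<subseteq> supp Z \<and> orthogonal W Y"
    proof (cases "e \<in> supp Z")
      case True
      obtain f where f: "f \<in> supp Z" "f \<noteq> e" using ex by blast
      then obtain W where W: "W \<in> C'" "supp W = {e, f}" "e \<in> fst W" using pair ZV by blast
      have "orthogonal W Y"
      proof (cases "f \<in> fst W")
        case True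
        then have "f \<in> snd Y" using W f ZV by (auto simp: Y_def)
        then show ?thesis using W True Ye C'.disjoint[OF W(1)] Yd unfolding orthogonal_def by blast
      next
        case False
        then have fs: "f \<in> snd W" using W(2) by (auto simp: supp_def)
        then have "f \<in> fst Y" using W f ZV by (auto simp: Y_def)
        then show ?thesis using W fs Ye C'.disjoint[OF W(1)] Yd unfolding orthogonal_def by blast
      qed
      then show ?thesis using W f True by auto
    next
      case False
      \<comment> \<open>When \<open>Z\<close> avoids \<open>e\<close>, eliminating \<open>e\<close>
        between the circuits on \<open>{e, f}\<close> and \<open>{e, f'}\<close> gives a circuit on
        \<open>{f, f'}\<close> whose signs are inherited from them.\<close>
      obtain f where f: "f \<in> supp Z" using ex by blast
      then obtain W where W: "W \<in> C'" "supp W = {e, f}" "e \<in> fst W" using pair ZV False by blast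
      have "supp Z \<noteq> {f}"
      proof
        assume "supp Z = {f}"
        then show False using C'.supp_antichain[OF Z(1) W(1)] W(2) False by auto
      qed
      then obtain f' where f': "f' \<in> supp Z" "f' \<noteq> f" using f by blast
      then obtain W' where W': "W' \<in> C'" "supp W' = {e, f'}" "e \<in> fst W'" using pair ZV False by blast
      have "W \<noteq> opp (opp W')" using W(2) W'(2) f'(2) False f f' by auto
      then obtain T where T: "T \<in> C'" "fst T \<subseteq> (fst W \<union> snd W') - {e}" "snd T \<subseteq> (snd W \<union> fst W') - {e}"
        using C'.elimination[OF W(1) C'.opp_mem[OF W'(1)], of e] W(3) W'(3) by auto
      have Ts: "supp T \<subseteq> {f, f'}" using T(2,3) W(2) W'(2) by (auto simp: supp_def)
      have "supp T \<noteq> {f}" using C'.supp_antichain[OF T(1) W(1)] W(2) False f by auto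
      moreover have "supp T \<noteq> {f'}" using C'.supp_antichain[OF T(1) W'(1)] W'(2) False f' by auto
      ultimately have Ts: "supp T = {f, f'}" using Ts C'.nonempty[OF T(1)] by blast
      have fE: "f \<in> E - V" "f' \<in> E - V" "f \<noteq> e" "f' \<noteq> e" using f f' ZV False by auto
      have 1: "f \<in> fst T \<and> f \<in> fst W \<and> f \<in> snd Y \<or> f \<in> snd T \<and> f \<in> snd W \<and> f \<in> fst Y"
      proof -
        have "f \<in> fst W \<Longrightarrow> f \<in> snd Y" "f \<in> snd W \<Longrightarrow> f \<in> fst Y" using W fE by (auto simp: Y_def)
        moreover have "f \<notin> supp W'" using W'(2) f'(2) False f by auto
        ultimately show ?thesis using T(2,3) Ts by (auto simp: supp_def)
      qed
      have 2: "f' \<in> fst T \<and> f' \<in> snd W' \<and> f' \<in> fst Y \<or> f' \<in> snd T \<and> f' \<in> fst W' \<and> f' \<in> snd Y"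
      proof -
        have "f' \<in> fst W' \<Longrightarrow> f' \<in> snd Y" "f' \<in> snd W' \<Longrightarrow> f' \<in> fst Y" using W' fE by (auto simp: Y_def)
        moreover have "f' \<notin> supp W" using W(2) f'(2) False f' by auto
        ultimately show ?thesis using T(2,3) Ts by (auto simp: supp_def)
      qed
      have "orthogonal T Y" using 1 2 unfolding orthogonal_def by blast
      then show ?thesis using T(1) Ts f f' by auto
    qed
    then obtain W where W: "W \<in> C'" "supp W \<subseteq> supp Z" "orthogonal W Y" by blast
    then have "Z = W \<or> Z = opp W" using C'.antichain[OF W(1) Z(1)] opp_eq_iff by metis
    then have "orthogonal Z Y" using W(3) unfolding orthogonal_def by auto
    then show ?thesis using C'.nonempty[OF Z(1)] by (auto simp: supp_def)
  qed
  have orthY: "orthogonal X Y" if X: "X \<in> C" "supp X \<subseteq> E" for X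
  proof -
    \<comment> \<open>A conformal circuit of the contraction through the common element
      \<open>h\<close> already has both an agreement and a conflict with \<open>Y\<close>, and
      \<open>X\<close> has the same signs there.\<close>
    have "(fst X \<inter> fst Y \<union> snd X \<inter> snd Y \<noteq> {}) \<and> (fst X \<inter> snd Y \<union> snd X \<inter> fst Y \<noteq> {})"
      if h: "h \<in> supp X" "h \<in> supp Y" for h
    proof -
      have "h \<in> supp X - V" using h Ys by auto
      from cover[OF X(1) this] obtain Z where Z: "Z \<in> C'" "h \<in> supp Z" "conformal Z (sdiff X V)" by blast
      have "supp Z \<subseteq> E" using conformal_supp[OF Z(3)] X(2) by auto
      then have "orthogonal Z Y" using orth' Z(1) by blast
      then have "(fst Z \<inter> fst Y \<union> snd Z \<inter> snd Y \<noteq> {}) \<and> (fst Z \<inter> snd Y \<union> snd Z \<inter> fst Y \<noteq> {})"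
        using Z(2) h(2) unfolding orthogonal_def supp_def by blast
      then show ?thesis using Z(3) by (auto simp: conformal_def)
    qed
    then show ?thesis unfolding orthogonal_def supp_def by blast
  qed
  have minY: "supp Z = supp Y"
    if Z: "fst Z \<inter> snd Z = {}" "supp Z \<noteq> {}" "\<forall>X\<in>C. supp X \<subseteq> E \<longrightarrow> orthogonal X Z" "supp Z \<subseteq> supp Y" for Z
  proof -
    \<comment> \<open>The circuit on \<open>{e, f}\<close> ties the two elements together: an
      orthogonal signed set cannot contain exactly one of them.\<close>
    have "e \<in> supp Z \<longleftrightarrow> f \<in> supp Z" if f: "f \<in> E - V" for f
    proof (cases "f = e")
      case False
      obtain W where W: "W \<in> C'" "supp W = {e, f}" using pair[OF f False] by blast
      obtain X where X: "X \<in> C" "W = sdiff X V" using lift[OF W(1)] by blast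
      have XV: "supp X - V = {e, f}" using W(2) X(2) by simp
      then have "supp X \<subseteq> E" using V e f by (auto simp: free_def)
      then have "orthogonal X Z" using Z(3) X(1) by blast
      then have "supp X \<inter> supp Z \<noteq> {x}" for x
        using orthogonal_single[OF _ disjoint[OF X(1)] Z(1)] by simp
      moreover have "supp X \<inter> supp Z = {e, f} \<inter> supp Z" using XV Z(4) Ys by blast
      ultimately show ?thesis using False by auto
    qed simp
    then show ?thesis using Z(2,4) Ys by blast
  qed
  have "supp Y \<subseteq> E - U" "e \<in> supp Y" using V Ys Ye by (auto simp: free_def in_supp_iff)
  then show ?thesis using Yd orthY minY by (intro exI[of _ Y] conjI) blast+
qed



section \<open>Dual pairs\<close>

text \<open>Stated for any signature, so that the fundamental cocircuit of \<open>b\<close> is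
  \<open>fund D (E - B) b\<close>.\<close>

definition fund :: "'a sset set \<Rightarrow> 'a set \<Rightarrow> 'a \<Rightarrow> 'a sset" where
  "fund C B e = (THE X. X \<in> C \<and> supp X \<subseteq> insert e B \<and> e \<in> fst X)"

text \<open>This form of the basis property is self-dual: exchanging \<open>C\<close> with
  \<open>D\<close> and complementing \<open>B\<close> swaps its last two conditions.\<close>

definition pair_basis :: "'a set \<Rightarrow> 'a sset set \<Rightarrow> 'a sset set \<Rightarrow> 'a set \<Rightarrow> bool" where
  "pair_basis E C D B \<longleftrightarrow> B \<subseteq> E \<and> (\<forall>X\<in>C. \<not> supp X \<subseteq> B) \<and> (\<forall>Y\<in>D. supp Y \<inter> B \<noteq> {})"

definition minsupp :: "'a sset set \<Rightarrow> 'a sset set" where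
  "minsupp C = {X \<in> C. \<forall>Z\<in>C. supp Z \<subseteq> supp X \<longrightarrow> supp Z = supp X}"

lemma orthogonal_sym: "orthogonal X Y \<longleftrightarrow> orthogonal Y X"
  unfolding orthogonal_def by (auto simp: Int_commute)

lemma orthogonal_opp [simp]: "orthogonal (opp X) Y \<longleftrightarrow> orthogonal X Y"
  unfolding orthogonal_def by auto

lemma not_orthogonal_agree:
  assumes "h \<in> supp X" "h \<in> supp Y"
    and "\<And>x. x \<in> supp X \<Longrightarrow> x \<in> supp Y \<Longrightarrow> x \<notin> fst X \<inter> snd Y \<union> snd X \<inter> fst Y"
  shows "\<not> orthogonal X Y"
  using assms unfolding orthogonal_def supp_def by blast

text \<open>A dual pair of sets of signed sets. Supports need not be minimal: the circuits and cocircuits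
  are the members with minimal support, but the class of all pairs is closed under minors.\<close>

locale om_pair =
  fixes E :: "'a set" and C D :: "'a sset set"
  assumes fin: "finite E"
    and C_sub: "X \<in> C \<Longrightarrow> supp X \<subseteq> E" and D_sub: "Y \<in> D \<Longrightarrow> supp Y \<subseteq> E"
    and C_disj: "X \<in> C \<Longrightarrow> fst X \<inter> snd X = {}" and D_disj: "Y \<in> D \<Longrightarrow> fst Y \<inter> snd Y = {}"
    and C_ne: "X \<in> C \<Longrightarrow> supp X \<noteq> {}" and D_ne: "Y \<in> D \<Longrightarrow> supp Y \<noteq> {}"
    and C_opp: "X \<in> C \<Longrightarrow> opp X \<in> C" and D_opp: "Y \<in> D \<Longrightarrow> opp Y \<in> D"
    and orth: "X \<in> C \<Longrightarrow> Y \<in> D \<Longrightarrow> orthogonal X Y"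
    and unsigned_painting: "e \<in> E \<Longrightarrow> U \<subseteq> E - {e} \<Longrightarrow>
      (\<exists>X\<in>C. e \<in> supp X \<and> supp X \<subseteq> insert e U) \<or> (\<exists>Y\<in>D. e \<in> supp Y \<and> supp Y \<inter> U = {})"
begin

text \<open>The painting axiom is turned over by using \<open>E - {e} - U\<close> in place of
  \<open>U\<close>.\<close>

lemma dual_pair: "om_pair E D C"
proof
  fix e U assume e: "e \<in> E" and U: "U \<subseteq> E - {e}"
  have "(\<exists>X\<in>C. e \<in> supp X \<and> supp X \<subseteq> insert e (E - {e} - U)) \<or>
    (\<exists>Y\<in>D. e \<in> supp Y \<and> supp Y \<inter> (E - {e} - U) = {})"
    using unsigned_painting[OF e, of "E - {e} - U"] by blast
  then show "(\<exists>X\<in>D. e \<in> supp X \<and> supp X \<subseteq> insert e U) \<or> (\<exists>Y\<in>C. e \<in> supp Y \<and> supp Y \<inter> U = {})"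
  proof (elim disjE bexE conjE)
    fix X assume "X \<in> C" "e \<in> supp X" "supp X \<subseteq> insert e (E - {e} - U)"
    then show ?thesis using U by (intro disjI2 bexI[of _ X]) auto
  next
    fix Y assume "Y \<in> D" "e \<in> supp Y" "supp Y \<inter> (E - {e} - U) = {}"
    then show ?thesis using D_sub[of Y] by (intro disjI1 bexI[of _ Y]) auto
  qed
qed (rule fin C_sub D_sub C_disj D_disj C_ne D_ne C_opp D_opp orthogonal_sym[THEN iffD1, OF orth]; assumption)+

lemma single: "X \<in> C \<Longrightarrow> Y \<in> D \<Longrightarrow> supp X \<inter> supp Y \<noteq> {e}"
  using orthogonal_single[OF orth C_disj D_disj] .

lemma C_finite: "X \<in> C \<Longrightarrow> finite (supp X)"
  using C_sub fin finite_subset by blast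

lemma C_sign: "X \<in> C \<Longrightarrow> e \<in> supp X \<Longrightarrow> \<exists>X'\<in>C. supp X' = supp X \<and> e \<in> fst X'"
  using C_opp by (metis fst_opp in_supp_iff supp_opp)

text \<open>Induction on the number of signed elements: moving \<open>g\<close> to \<open>U\<close> yields at worst a circuit with the
  wrong sign at \<open>g\<close>, and removing \<open>g\<close> at worst a cocircuit with the wrong sign at \<open>g\<close>. Both cannot
  happen at once by orthogonality.\<close>

lemma signed_painting:
  assumes "e \<in> Pp \<union> Pm" "Pp \<inter> Pm = {}" "(Pp \<union> Pm) \<inter> U = {}" "Pp \<union> Pm \<union> U \<subseteq> E"
  shows "(\<exists>X\<in>C. e \<in> supp X \<and> supp X \<subseteq> Pp \<union> Pm \<union> U \<and> fst X \<inter> Pm = {} \<and> snd X \<inter> Pp = {}) \<or>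
    (\<exists>Y\<in>D. e \<in> supp Y \<and> supp Y \<inter> U = {} \<and> fst Y \<inter> Pm = {} \<and> snd Y \<inter> Pp = {})"
  using assms
proof (induction "card (Pp \<union> Pm)" arbitrary: Pp Pm U rule: less_induct)
  case less
  have finP: "finite (Pp \<union> Pm)" using less.prems(4) fin finite_subset by blast
  show ?case
  proof (cases "Pp \<union> Pm = {e}")
    case True
    have *: "(\<exists>X\<in>C. e \<in> supp X \<and> supp X \<subseteq> insert e U) \<or> (\<exists>Y\<in>D. e \<in> supp Y \<and> supp Y \<inter> U = {})"
    proof (rule unsigned_painting)
      show "e \<in> E" using less.prems(1,4) by blast
      show "U \<subseteq> E - {e}" using less.prems(1,3,4) by (auto simp: disjoint_iff)
    qed
    have "Pp \<subseteq> {e}" "Pm \<subseteq> {e}" using True by auto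
    then have "(Pp = {} \<or> Pp = {e}) \<and> (Pm = {} \<or> Pm = {e})" by (simp add: subset_singleton_iff)
    then have P: "Pp = {e} \<and> Pm = {} \<or> Pp = {} \<and> Pm = {e}" using True less.prems(2) by auto
    from * show ?thesis
    proof (elim disjE bexE conjE)
      fix X assume X: "X \<in> C" "e \<in> supp X" "supp X \<subseteq> insert e U"
      obtain X' where X': "X' \<in> C" "supp X' = supp X" "e \<in> fst X'" using C_sign X by blast
      have "e \<notin> snd X'" using C_disj X' by blast
      then show ?thesis using P X X' C_opp[OF X'(1)]
        by (intro disjI1) (elim disjE, intro bexI[of _ X'], simp_all, intro bexI[of _ "opp X'"], simp_all)
    next
      fix Y assume Y: "Y \<in> D" "e \<in> supp Y" "supp Y \<inter> U = {}"
      obtain Y' where Y': "Y' \<in> D" "supp Y' = supp Y" "e \<in> fst Y'"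
        using om_pair.C_sign[OF dual_pair] Y by blast
      have "e \<notin> snd Y'" using D_disj Y' by blast
      then show ?thesis using P Y Y' D_opp[OF Y'(1)]
        by (intro disjI2) (elim disjE, intro bexI[of _ Y'], simp_all, intro bexI[of _ "opp Y'"], simp_all)
    qed
  next
    case False
    then obtain g where g: "g \<in> Pp \<union> Pm" "g \<noteq> e" using less.prems(1) by blast
    have card: "card ((Pp - {g}) \<union> (Pm - {g})) < card (Pp \<union> Pm)"
      using g finP by (intro psubset_card_mono) auto
    show ?thesis
    proof (rule ccontr)
      assume no: "\<not> ?thesis"
      have "(\<exists>X\<in>C. e \<in> supp X \<and> supp X \<subseteq> (Pp - {g}) \<union> (Pm - {g}) \<union> insert g U \<and>
          fst X \<inter> (Pm - {g}) = {} \<and> snd X \<inter> (Pp - {g}) = {}) \<or>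
        (\<exists>Y\<in>D. e \<in> supp Y \<and> supp Y \<inter> insert g U = {} \<and> fst Y \<inter> (Pm - {g}) = {} \<and> snd Y \<inter> (Pp - {g}) = {})"
        by (rule less.hyps[OF card]) (use less.prems g in auto)
      moreover have "\<not> (\<exists>Y\<in>D. e \<in> supp Y \<and> supp Y \<inter> insert g U = {} \<and>
          fst Y \<inter> (Pm - {g}) = {} \<and> snd Y \<inter> (Pp - {g}) = {})"
      proof
        assume "\<exists>Y\<in>D. e \<in> supp Y \<and> supp Y \<inter> insert g U = {} \<and>
          fst Y \<inter> (Pm - {g}) = {} \<and> snd Y \<inter> (Pp - {g}) = {}"
        then obtain Y where "Y \<in> D" "e \<in> supp Y" "supp Y \<inter> insert g U = {}"
          "fst Y \<inter> (Pm - {g}) = {}" "snd Y \<inter> (Pp - {g}) = {}" by blast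
        then show False using no unfolding supp_def by blast
      qed
      ultimately obtain X where X: "X \<in> C" "e \<in> supp X" "supp X \<subseteq> Pp \<union> Pm \<union> U"
        "fst X \<inter> (Pm - {g}) = {}" "snd X \<inter> (Pp - {g}) = {}" using g by auto
      have "(\<exists>X\<in>C. e \<in> supp X \<and> supp X \<subseteq> (Pp - {g}) \<union> (Pm - {g}) \<union> U \<and>
          fst X \<inter> (Pm - {g}) = {} \<and> snd X \<inter> (Pp - {g}) = {}) \<or>
        (\<exists>Y\<in>D. e \<in> supp Y \<and> supp Y \<inter> U = {} \<and> fst Y \<inter> (Pm - {g}) = {} \<and> snd Y \<inter> (Pp - {g}) = {})"
        by (rule less.hyps[OF card]) (use less.prems g in auto)
      moreover have "\<not> (\<exists>X\<in>C. e \<in> supp X \<and> supp X \<subseteq> (Pp - {g}) \<union> (Pm - {g}) \<union> U \<and>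
          fst X \<inter> (Pm - {g}) = {} \<and> snd X \<inter> (Pp - {g}) = {})"
      proof
        assume "\<exists>X\<in>C. e \<in> supp X \<and> supp X \<subseteq> (Pp - {g}) \<union> (Pm - {g}) \<union> U \<and>
          fst X \<inter> (Pm - {g}) = {} \<and> snd X \<inter> (Pp - {g}) = {}"
        then obtain X where "X \<in> C" "e \<in> supp X" "supp X \<subseteq> (Pp - {g}) \<union> (Pm - {g}) \<union> U"
          "fst X \<inter> (Pm - {g}) = {}" "snd X \<inter> (Pp - {g}) = {}" by blast
        moreover have "g \<notin> supp X" using calculation(3) g less.prems(3) by blast
        ultimately show False using no unfolding supp_def by blast
      qed
      ultimately obtain Y where Y: "Y \<in> D" "e \<in> supp Y" "supp Y \<inter> U = {}"
        "fst Y \<inter> (Pm - {g}) = {}" "snd Y \<inter> (Pp - {g}) = {}" by blast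
      have Xg: "g \<in> Pp \<Longrightarrow> g \<notin> fst X" "g \<in> Pm \<Longrightarrow> g \<notin> snd X"
        using no X g C_disj[OF X(1)] less.prems(2) by blast+
      have Yg: "g \<in> Pp \<Longrightarrow> g \<notin> fst Y" "g \<in> Pm \<Longrightarrow> g \<notin> snd Y"
        using no Y g D_disj[OF Y(1)] less.prems(2) by blast+
      \<comment> \<open>On painted elements other than \<open>g\<close> both have the painted sign,
        and at \<open>g\<close> both have the other one, so there is no conflict.\<close>
      have "\<not> orthogonal X Y"
      proof (rule not_orthogonal_agree[OF X(2) Y(2)])
        fix x assume x: "x \<in> supp X" "x \<in> supp Y"
        then have "x \<in> Pp \<union> Pm" using X(3) Y(3) by blast
        then show "x \<notin> fst X \<inter> snd Y \<union> snd X \<inter> fst Y"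
          using X(4,5) Y(4,5) Xg Yg C_disj[OF X(1)] D_disj[OF Y(1)] by (cases "x = g") auto
      qed
      then show False using orth X(1) Y(1) by blast
    qed
  qed
qed

section \<open>Bases and fundamental circuits of a dual pair\<close>

lemma pair_basis_dual: "pair_basis E D C (E - B)" if "pair_basis E C D B"
  using that C_sub D_sub unfolding pair_basis_def by blast

lemma fund_exists:
  assumes B: "pair_basis E C D B" and e: "e \<in> E - B"
  shows "\<exists>X\<in>C. supp X \<subseteq> insert e B \<and> e \<in> fst X"
proof -
  have "\<not> (\<exists>Y\<in>D. e \<in> supp Y \<and> supp Y \<inter> B = {})" using B by (auto simp: pair_basis_def)
  then obtain X where "X \<in> C" "e \<in> supp X" "supp X \<subseteq> insert e B"
    using unsigned_painting[of e B] e B unfolding pair_basis_def by blast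
  then show ?thesis using C_sign[of X e] by metis
qed

text \<open>\<open>X\<close> and \<open>Y\<close> can meet only in \<open>e\<close> and
  \<open>f\<close>, so orthogonality couples the two remaining signs.\<close>

lemma fund_sign_iff:
  assumes X: "X \<in> C" "supp X \<subseteq> insert e B" "e \<in> fst X" and e: "e \<notin> B"
    and Y: "Y \<in> D" "supp Y \<inter> B = {f}" "f \<in> fst Y"
  shows "f \<in> fst X \<longleftrightarrow> e \<in> snd Y" "f \<in> snd X \<longleftrightarrow> e \<in> fst Y"
proof -
  have "orthogonal X Y" "fst X \<inter> snd X = {}" "fst Y \<inter> snd Y = {}" "f \<noteq> e"
    using orth C_disj D_disj X Y e by auto
  moreover have "supp X \<inter> supp Y \<subseteq> {e, f}" using X Y by blast
  ultimately show "f \<in> fst X \<longleftrightarrow> e \<in> snd Y" "f \<in> snd X \<longleftrightarrow> e \<in> fst Y"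
    using X(3) Y(3) unfolding orthogonal_def supp_def by blast+
qed

lemma cofund_exists:
  assumes B: "pair_basis E C D B" and f: "f \<in> B"
  shows "\<exists>Y\<in>D. supp Y \<inter> B = {f} \<and> f \<in> fst Y"
proof -
  interpret dual: om_pair E D C by (rule dual_pair)
  have "f \<in> E - (E - B)" using f B by (auto simp: pair_basis_def)
  then obtain Y where "Y \<in> D" "supp Y \<subseteq> insert f (E - B)" "f \<in> fst Y"
    using dual.fund_exists[OF pair_basis_dual[OF B]] by blast
  then show ?thesis using f by (intro bexI[of _ Y]) (auto simp: supp_def)
qed

text \<open>Supports in \<open>C\<close> may be comparable, so uniqueness cannot come from
  minimality. Instead, each sign of \<open>X\<close> on \<open>B\<close> is dictated by a member of
  \<open>D\<close> that meets \<open>B\<close> in one element.\<close>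

lemma fund_unique:
  assumes B: "pair_basis E C D B" and e: "e \<notin> B"
    and X: "X \<in> C" "supp X \<subseteq> insert e B" "e \<in> fst X"
    and X': "X' \<in> C" "supp X' \<subseteq> insert e B" "e \<in> fst X'"
  shows "X = X'"
proof -
  have "(f \<in> fst X \<longleftrightarrow> f \<in> fst X') \<and> (f \<in> snd X \<longleftrightarrow> f \<in> snd X')" for f
  proof (cases "f \<in> B")
    case True
    then show ?thesis
      using cofund_exists[OF B] fund_sign_iff[OF X e] fund_sign_iff[OF X' e] by metis
  next
    case False
    then show ?thesis using X X' C_disj[OF X(1)] C_disj[OF X'(1)] unfolding supp_def by blast
  qed
  then show ?thesis by (auto intro!: prod_eqI)
qed

lemma fund_eqI:
  assumes "pair_basis E C D B" "e \<notin> B" "X \<in> C" "supp X \<subseteq> insert e B" "e \<in> fst X"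
  shows "fund C B e = X"
  unfolding fund_def using assms fund_unique[OF assms(1,2)] by (intro the_equality) auto

lemma fund_props:
  assumes "pair_basis E C D B" "e \<in> E - B"
  shows "fund C B e \<in> C" "supp (fund C B e) \<subseteq> insert e B" "e \<in> fst (fund C B e)"
proof -
  obtain X where "X \<in> C" "supp X \<subseteq> insert e B" "e \<in> fst X" using fund_exists[OF assms] by blast
  then show "fund C B e \<in> C" "supp (fund C B e) \<subseteq> insert e B" "e \<in> fst (fund C B e)"
    using fund_eqI[OF assms(1)] assms(2) by auto
qed

lemma cofund_props:
  assumes B: "pair_basis E C D B" "b \<in> B"
  shows "fund D (E - B) b \<in> D" "supp (fund D (E - B) b) \<subseteq> insert b (E - B)"
    "b \<in> fst (fund D (E - B) b)" "supp (fund D (E - B) b) \<inter> B = {b}"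
proof -
  interpret dual: om_pair E D C by (rule dual_pair)
  have b: "b \<in> E - (E - B)" using B by (auto simp: pair_basis_def)
  note * = dual.fund_props[OF pair_basis_dual[OF B(1)] b]
  show "fund D (E - B) b \<in> D" "supp (fund D (E - B) b) \<subseteq> insert b (E - B)"
    "b \<in> fst (fund D (E - B) b)" using * by auto
  then show "supp (fund D (E - B) b) \<inter> B = {b}" using B(2) by (auto simp: supp_def)
qed

lemma fund_cofund:
  assumes "pair_basis E C D B" "e \<in> E - B" "b \<in> B"
  shows "b \<in> fst (fund C B e) \<longleftrightarrow> e \<in> snd (fund D (E - B) b)"
    "b \<in> snd (fund C B e) \<longleftrightarrow> e \<in> fst (fund D (E - B) b)"
    "b \<in> supp (fund C B e) \<longleftrightarrow> e \<in> supp (fund D (E - B) b)"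
proof -
  note * = fund_sign_iff[OF fund_props[OF assms(1,2)] _ cofund_props(1)[OF assms(1,3)]
    cofund_props(4)[OF assms(1,3)] cofund_props(3)[OF assms(1,3)]]
  show "b \<in> fst (fund C B e) \<longleftrightarrow> e \<in> snd (fund D (E - B) b)"
    "b \<in> snd (fund C B e) \<longleftrightarrow> e \<in> fst (fund D (E - B) b)" using * assms(2) by auto
  then show "b \<in> supp (fund C B e) \<longleftrightarrow> e \<in> supp (fund D (E - B) b)" by (auto simp: in_supp_iff)
qed

lemma minsupp_below:
  assumes "X \<in> C" shows "\<exists>Z\<in>minsupp C. supp Z \<subseteq> supp X"
proof -
  obtain Z where Z: "Z \<in> C \<and> supp Z \<subseteq> supp X"
    and min: "\<And>Z'. Z' \<in> C \<and> supp Z' \<subseteq> supp X \<Longrightarrow> card (supp Z) \<le> card (supp Z')"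
    using ex_has_least_nat[of "\<lambda>Z. Z \<in> C \<and> supp Z \<subseteq> supp X" X "\<lambda>Z. card (supp Z)"] assms by blast
  have "supp Z' = supp Z" if "Z' \<in> C" "supp Z' \<subseteq> supp Z" for Z'
    using card_seteq[OF C_finite that(2)] min[of Z'] Z that by auto
  then show ?thesis using Z unfolding minsupp_def by blast
qed

text \<open>Any member of \<open>C\<close> inside it must contain \<open>e\<close>, since
  \<open>B\<close> is independent, and then equals it up to sign by uniqueness.\<close>

lemma fund_minsupp:
  assumes B: "pair_basis E C D B" and e: "e \<in> E - B"
  shows "fund C B e \<in> minsupp C"
proof -
  note F = fund_props[OF B e]
  have "supp Z = supp (fund C B e)" if Z: "Z \<in> C" "supp Z \<subseteq> supp (fund C B e)" for Z
  proof -
    have "\<not> supp Z \<subseteq> B" using B Z by (auto simp: pair_basis_def)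
    then have "e \<in> supp Z" using Z F by blast
    then obtain Z' where Z': "Z' \<in> C" "supp Z' = supp Z" "e \<in> fst Z'" using C_sign Z by blast
    then have "fund C B e = Z'" using Z F by (intro fund_eqI[OF B]) (use e in auto)
    then show ?thesis using Z' by simp
  qed
  then show ?thesis using F by (auto simp: minsupp_def)
qed

text \<open>A maximal independent set between \<open>I\<close> and \<open>S\<close> works: if some
  \<open>Y\<close> missed it, adding an element of \<open>Y\<close> from \<open>S\<close> would
  close a circuit meeting \<open>Y\<close> in that element alone.\<close>

lemma extend_basis:
  assumes I: "I \<subseteq> S" "S \<subseteq> E" "\<And>X. X \<in> C \<Longrightarrow> \<not> supp X \<subseteq> I"
    and S: "\<And>Y. Y \<in> D \<Longrightarrow> supp Y \<inter> S \<noteq> {}"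
  shows "\<exists>B. pair_basis E C D B \<and> I \<subseteq> B \<and> B \<subseteq> S"
proof -
  define ind where "ind J \<longleftrightarrow> I \<subseteq> J \<and> J \<subseteq> S \<and> (\<forall>X\<in>C. \<not> supp X \<subseteq> J)" for J
  have "ind I" using I by (auto simp: ind_def)
  then obtain J where J: "ind J" and "I \<subseteq> J" and max: "\<And>K. ind K \<Longrightarrow> J \<subseteq> K \<Longrightarrow> K = J"
    by (rule finite_maximal_superset[OF fin]) (use I in \<open>auto simp: ind_def\<close>)
  have "supp Y \<inter> J \<noteq> {}" if Y: "Y \<in> D" for Y
  proof
    assume 0: "supp Y \<inter> J = {}"
    obtain s where s: "s \<in> supp Y" "s \<in> S" using S[OF Y] by blast
    then have "\<not> ind (insert s J)" using max[of "insert s J"] 0 by auto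
    then obtain X where X: "X \<in> C" "supp X \<subseteq> insert s J" using J s by (auto simp: ind_def)
    then have "s \<in> supp X" using J by (auto simp: ind_def)
    then have "supp X \<inter> supp Y = {s}" using X s 0 by blast
    then show False using single X Y by blast
  qed
  then show ?thesis using J I by (intro exI[of _ J]) (auto simp: ind_def pair_basis_def)
qed

lemma independent_extends:
  assumes "I \<subseteq> E" "\<And>X. X \<in> C \<Longrightarrow> \<not> supp X \<subseteq> I"
  shows "\<exists>B. pair_basis E C D B \<and> I \<subseteq> B"
proof -
  have "\<And>Y. Y \<in> D \<Longrightarrow> supp Y \<inter> E \<noteq> {}" using D_ne D_sub by blast
  then show ?thesis using extend_basis[of I E] assms by blast
qed

text \<open>The set \<open>I\<close> is a basis of the hyperplane complementary to
  \<open>Y\<close>.\<close>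

lemma cocircuit_basis:
  assumes Y: "Y \<in> minsupp D"
  shows "\<exists>I. I \<inter> supp Y = {} \<and> (\<forall>e\<in>supp Y. pair_basis E C D (insert e I))"
proof -
  have YD: "Y \<in> D" using Y by (simp add: minsupp_def)
  obtain e0 where e0: "e0 \<in> supp Y" using D_ne YD by blast
  define S where "S = insert e0 (E - supp Y)"
  have e0ind: "\<not> supp X \<subseteq> {e0}" if "X \<in> C" for X
    using single[OF that YD, of e0] C_ne[OF that] e0 by blast
  have S: "supp Z \<inter> S \<noteq> {}" if Z: "Z \<in> D" for Z
  proof
    assume "supp Z \<inter> S = {}"
    then have "supp Z \<subseteq> supp Y" "e0 \<notin> supp Z" using D_sub[OF Z] by (auto simp: S_def)
    then show False using Y Z e0 by (auto simp: minsupp_def)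
  qed
  have "\<exists>B. pair_basis E C D B \<and> {e0} \<subseteq> B \<and> B \<subseteq> S"
    by (rule extend_basis) (use e0ind S D_sub[OF YD] e0 in \<open>auto simp: S_def\<close>)
  then obtain B where B: "pair_basis E C D B" "e0 \<in> B" "B \<subseteq> S" by blast
  define I where "I = B - {e0}"
  have IY: "I \<inter> supp Y = {}" using B by (auto simp: I_def S_def)
  have "pair_basis E C D (insert e I)" if e: "e \<in> supp Y" for e
  proof -
    have ind: "\<not> supp X \<subseteq> insert e I" if "X \<in> C" for X
    proof
      assume sub: "supp X \<subseteq> insert e I"
      have "e \<in> supp X" using sub B(1) that by (auto simp: I_def pair_basis_def)
      then have "supp X \<inter> supp Y = {e}" using sub IY e by blast
      then show False using single[OF that YD] by blast
    qed
    have "supp Z \<inter> insert e I \<noteq> {}" if Z: "Z \<in> D" for Z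
    proof
      assume 0: "supp Z \<inter> insert e I = {}"
      \<comment> \<open>For \<open>f\<close> in \<open>Z\<close> outside \<open>Y\<close>, the
        fundamental circuit of \<open>f\<close> cannot contain \<open>e0\<close>, as it would meet
        \<open>Y\<close> only there. So it would meet \<open>Z\<close> only in
        \<open>f\<close>.\<close>
      have "supp Z \<subseteq> supp Y"
      proof
        fix f assume f: "f \<in> supp Z"
        show "f \<in> supp Y"
        proof (rule ccontr)
          assume fY: "f \<notin> supp Y"
          then have fB: "f \<in> E - B" using f 0 D_sub[OF Z] e0 by (auto simp: I_def)
          note F = fund_props[OF B(1) fB]
          have "e0 \<notin> supp (fund C B f)"
          proof
            assume "e0 \<in> supp (fund C B f)"
            then have "supp (fund C B f) \<inter> supp Y = {e0}" using F fY e0 IY by (auto simp: I_def)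
            then show False using single F YD by blast
          qed
          then have "supp (fund C B f) \<inter> supp Z = {f}" using F f 0 by (auto simp: I_def in_supp_iff)
          then show False using single F Z by blast
        qed
      qed
      then show False using Y Z e 0 by (auto simp: minsupp_def)
    qed
    then show ?thesis using ind IY e B(1) D_sub[OF YD] by (auto simp: pair_basis_def I_def)
  qed
  then show ?thesis using IY by blast
qed

end


section \<open>Oriented matroids represented by dual pairs\<close>

locale om_rep = om_pair E C D for E :: "'a set" and C D +
  fixes K :: "'a omatroid"
  assumes ground_K: "ground K = E" and circuits_K: "circuits K = minsupp C"
begin

lemma indep_iff: "indep K I \<longleftrightarrow> I \<subseteq> E \<and> (\<forall>X\<in>C. \<not> supp X \<subseteq> I)"
proof -
  have "(\<forall>X\<in>minsupp C. \<not> supp X \<subseteq> I) \<longleftrightarrow> (\<forall>X\<in>C. \<not> supp X \<subseteq> I)"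
  proof (intro iffI ballI notI)
    fix X assume "\<forall>X\<in>minsupp C. \<not> supp X \<subseteq> I" "X \<in> C" "supp X \<subseteq> I"
    then show False using minsupp_below[of X] by blast
  qed (auto simp: minsupp_def)
  then show ?thesis by (simp add: indep_def ground_K circuits_K)
qed

lemma basis_iff: "basis K B \<longleftrightarrow> pair_basis E C D B"
proof
  assume B: "basis K B"
  then have "B \<subseteq> E" "\<And>X. X \<in> C \<Longrightarrow> \<not> supp X \<subseteq> B" by (auto simp: basis_def indep_iff)
  then obtain B' where B': "pair_basis E C D B'" "B \<subseteq> B'" using independent_extends by blast
  then have "indep K B'" by (auto simp: indep_iff pair_basis_def)
  then have "B' = B" using B B'(2) by (auto simp: basis_def)
  then show "pair_basis E C D B" using B' by simp
next
  assume B: "pair_basis E C D B"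
  have "I = B" if I: "indep K I" "B \<subseteq> I" for I
  proof (rule ccontr)
    assume "I \<noteq> B"
    then obtain e where e: "e \<in> I" "e \<notin> B" using I(2) by blast
    then have eE: "e \<in> E - B" using I(1) by (auto simp: indep_iff)
    have "supp (fund C B e) \<subseteq> I" using fund_props(2)[OF B eE] e I(2) by blast
    then show False using I(1) fund_props(1)[OF B eE] by (auto simp: indep_iff)
  qed
  then show "basis K B" using B by (auto simp: basis_def indep_iff pair_basis_def)
qed

text \<open>The hard inclusion is uniqueness of the signature. On a minimal support, fundamental
  circuits meeting it in exactly two elements carry the sign of one element to all others.\<close>

lemma cocircuits_K: "cocircuits K = minsupp D"
proof (intro set_eqI iffI)
  interpret dual: om_pair E D C by (rule dual_pair)
  fix Y assume Y: "Y \<in> minsupp D"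
  then have YD: "Y \<in> D" by (simp add: minsupp_def)
  have "S = supp Y" if S: "meets_all_bases K S" "S \<subseteq> supp Y" for S
  proof (rule ccontr)
    assume "S \<noteq> supp Y"
    then obtain e where e: "e \<in> supp Y" "e \<notin> S" using S by blast
    obtain I where I: "I \<inter> supp Y = {}" "\<And>e. e \<in> supp Y \<Longrightarrow> pair_basis E C D (insert e I)"
      using cocircuit_basis[OF Y] by blast
    have "S \<inter> insert e I \<noteq> {}"
      using S(1) I(2)[OF e(1)] unfolding meets_all_bases_def basis_iff by blast
    then show False using I(1) S(2) e by blast
  qed
  moreover have "meets_all_bases K (supp Y)"
    using D_sub[OF YD] YD by (auto simp: meets_all_bases_def ground_K basis_iff pair_basis_def)
  ultimately show "Y \<in> cocircuits K"
    using D_disj[OF YD] orth[OF _ YD] by (auto simp: cocircuits_def circuits_K minsupp_def)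
next
  interpret dual: om_pair E D C by (rule dual_pair)
  fix Y assume Y: "Y \<in> cocircuits K"
  then have Yd: "fst Y \<inter> snd Y = {}" and Ym: "meets_all_bases K (supp Y)"
    and Ymin: "\<And>S. meets_all_bases K S \<Longrightarrow> S \<subseteq> supp Y \<Longrightarrow> S = supp Y"
    and Yo: "\<And>X. X \<in> minsupp C \<Longrightarrow> orthogonal X Y"
    by (auto simp: cocircuits_def circuits_K)
  \<comment> \<open>Otherwise the complement of \<open>Y\<close> would meet every member of
    \<open>D\<close>, hence contain a basis, which \<open>Y\<close> would miss.\<close>
  have "\<exists>Z\<in>D. supp Z \<inter> (E - supp Y) = {}"
  proof (rule ccontr)
    assume "\<not> ?thesis"
    then have "\<exists>B. pair_basis E C D B \<and> {} \<subseteq> B \<and> B \<subseteq> E - supp Y"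
      by (intro extend_basis) (use C_ne in auto)
    then show False using Ym by (auto simp: meets_all_bases_def basis_iff)
  qed
  then obtain Z where Z: "Z \<in> D" "supp Z \<subseteq> supp Y" using D_sub by blast
  obtain Y1 where Y1: "Y1 \<in> minsupp D" "supp Y1 \<subseteq> supp Z" using dual.minsupp_below[OF Z(1)] by blast
  have "meets_all_bases K (supp Y1)"
    using Y1(1) D_sub by (auto simp: minsupp_def meets_all_bases_def ground_K basis_iff pair_basis_def)
  then have sY1: "supp Y1 = supp Y" using Ymin Y1 Z by blast
  obtain e where e: "e \<in> supp Y1" using D_ne[of Y1] Y1(1) unfolding minsupp_def by blast
  have "opp Y1 \<in> minsupp D" using Y1(1) D_opp by (auto simp: minsupp_def)
  then obtain Y0 where Y0: "Y0 \<in> minsupp D" "supp Y0 = supp Y" "e \<in> fst Y0 \<longleftrightarrow> e \<in> fst Y"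
  proof (cases "e \<in> fst Y1 \<longleftrightarrow> e \<in> fst Y")
    case True
    then show ?thesis using that[of Y1] Y1(1) sY1 by blast
  next
    case False
    have "e \<in> snd Y1 \<longleftrightarrow> e \<notin> fst Y1"
      using e D_disj[of Y1] Y1(1) by (auto simp: minsupp_def in_supp_iff)
    then show ?thesis using that[of "opp Y1"] \<open>opp Y1 \<in> minsupp D\<close> sY1 False by simp
  qed
  have Y0D: "Y0 \<in> D" using Y0 by (simp add: minsupp_def)
  note Y0d = D_disj[OF Y0D]
  obtain I where I: "I \<inter> supp Y0 = {}" "\<And>e. e \<in> supp Y0 \<Longrightarrow> pair_basis E C D (insert e I)"
    using cocircuit_basis[OF Y0(1)] by blast
  have eY: "e \<in> supp Y0" using e sY1 Y0 by simp
  have "f \<in> fst Y0 \<longleftrightarrow> f \<in> fst Y" if f: "f \<in> supp Y" for f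
  proof (cases "f = e")
    case False
    note B = I(2)[OF eY]
    have fB: "f \<in> E - insert e I" using f False I(1) Y0(2) D_sub[OF Y0D] by auto
    define X where "X = fund C (insert e I) f"
    have X: "X \<in> C" "supp X \<subseteq> insert f (insert e I)" "f \<in> fst X" "X \<in> minsupp C"
      using fund_props[OF B fB] fund_minsupp[OF B fB] by (auto simp: X_def)
    have o: "orthogonal X Y0" "orthogonal X Y" using orth[OF X(1) Y0D] Yo[OF X(4)] by auto
    have cap: "x = e \<or> x = f" if "x \<in> supp X" "x \<in> supp Y" for x using that X(2) I(1) Y0(2) by blast
    have sg: "x \<in> fst Y \<or> x \<in> snd Y \<longleftrightarrow> x \<in> fst Y0 \<or> x \<in> snd Y0" for x
      using Y0(2) by (auto simp: supp_def)
    have eX: "e \<in> supp X"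
    proof (rule ccontr)
      assume "e \<notin> supp X"
      moreover have "f \<in> supp X" using X(3) by (simp add: in_supp_iff)
      ultimately have "supp X \<inter> supp Y0 = {f}" using cap f Y0(2) by blast
      then show False using single[OF X(1) Y0D] by blast
    qed
    \<comment> \<open>Applied to both \<open>Y0\<close> and \<open>Y\<close>, this propagates their
      agreement at \<open>e\<close> to \<open>f\<close>.\<close>
    have "f \<in> fst Y' \<longleftrightarrow> (e \<in> fst X \<longleftrightarrow> e \<in> snd Y')"
      if Y': "orthogonal X Y'" "fst Y' \<inter> snd Y' = {}" "supp Y' = supp Y" for Y'
    proof -
      have "\<And>x. x \<in> fst X \<or> x \<in> snd X \<Longrightarrow> x \<in> fst Y' \<or> x \<in> snd Y' \<Longrightarrow> x = e \<or> x = f"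
        using cap Y'(3) by (auto simp: supp_def)
      moreover have "e \<in> fst Y' \<or> e \<in> snd Y'" "f \<in> fst Y' \<or> f \<in> snd Y'" "e \<in> fst X \<or> e \<in> snd X"
        using eY f Y0(2) Y'(3) eX by (auto simp: supp_def)
      ultimately show ?thesis
        using Y'(1,2) C_disj[OF X(1)] X(3) False unfolding orthogonal_def by blast
    qed
    from this[OF o(1) Y0d Y0(2)] this[OF o(2) Yd refl] show ?thesis
      using Y0(3) eY Y0d Yd sg[of e] by (auto simp: in_supp_iff)
  qed (use Y0 in simp)
  then have "fst Y = fst Y0" using Y0(2) by (auto simp: supp_def)
  moreover from this have "snd Y = snd Y0" using Y0(2) Y0d Yd by (auto simp: supp_def)
  ultimately show "Y \<in> minsupp D" using Y0(1) by (metis prod_eqI)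
qed

lemma dual_rep: "om_rep E D C (dual K)"
proof -
  interpret dual: om_pair E D C by (rule dual_pair)
  show ?thesis by unfold_locales (simp_all add: dual_def ground_K cocircuits_K)
qed

lemma fund_circuit_eq:
  assumes B: "pair_basis E C D B" and e: "e \<in> E - B"
  shows "fund_circuit K B e = fund C B e"
  unfolding fund_circuit_def circuits_K
proof (rule the_equality)
  show "fund C B e \<in> minsupp C \<and> supp (fund C B e) \<subseteq> insert e B \<and> e \<in> fst (fund C B e)"
    using fund_minsupp[OF B e] fund_props[OF B e] by blast
  show "X = fund C B e" if "X \<in> minsupp C \<and> supp X \<subseteq> insert e B \<and> e \<in> fst X" for X
    using that e by (intro fund_eqI[OF B, symmetric]) (auto simp: minsupp_def)
qed

lemma fund_cocircuit_eq:
  assumes B: "pair_basis E C D B" and b: "b \<in> B"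
  shows "fund_cocircuit K B b = fund D (E - B) b"
proof -
  interpret dual: om_rep E D C "dual K" by (rule dual_rep)
  have "b \<in> E - (E - B)" using B b by (auto simp: pair_basis_def)
  then show ?thesis
    using dual.fund_circuit_eq[OF pair_basis_dual[OF B], of b]
    by (simp add: fund_cocircuit_def fund_circuit_def dual_def ground_K)
qed

end

text \<open>\<open>V\<close> consists of the nonempty signed sets orthogonal to all circuits. Its
  minimal members form a dual pair with the circuits by \<open>orthogonal_vector\<close>; only then
  are they identified with the cocircuits.\<close>

lemma oriented_matroid_pair:
  assumes M: "oriented_matroid M"
  shows "om_pair (ground M) (circuits M) (cocircuits M)" "minsupp (circuits M) = circuits M"
    "minsupp (cocircuits M) = cocircuits M"
proof -
  have fin: "finite (ground M)" using M by (simp add: oriented_matroid_def)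
  note conj = M[unfolded oriented_matroid_def, THEN conjunct2]
  have ax: "\<And>X. X \<in> circuits M \<Longrightarrow> supp X \<subseteq> ground M \<and> fst X \<inter> snd X = {} \<and> supp X \<noteq> {}"
    "\<And>X. X \<in> circuits M \<Longrightarrow> opp X \<in> circuits M"
    "\<And>X Y. X \<in> circuits M \<Longrightarrow> Y \<in> circuits M \<Longrightarrow> supp X \<subseteq> supp Y \<Longrightarrow> X = Y \<or> X = opp Y"
    "\<And>X Y e. X \<in> circuits M \<Longrightarrow> Y \<in> circuits M \<Longrightarrow> X \<noteq> opp Y \<Longrightarrow> e \<in> fst X \<inter> snd Y \<Longrightarrow>
      \<exists>Z\<in>circuits M. fst Z \<subseteq> (fst X \<union> fst Y) - {e} \<and> snd Z \<subseteq> (snd X \<union> snd Y) - {e}"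
    using conj[THEN conjunct1] conj[THEN conjunct2, THEN conjunct1]
      conj[THEN conjunct2, THEN conjunct2, THEN conjunct1]
      conj[THEN conjunct2, THEN conjunct2, THEN conjunct2]
    by blast+
  interpret signed_circuits "circuits M"
  proof
    show "finite (supp X)" if "X \<in> circuits M" for X using ax(1)[OF that] fin finite_subset by blast
  qed (use ax in blast)+
  define V where "V = {Y. fst Y \<inter> snd Y = {} \<and> supp Y \<subseteq> ground M \<and> supp Y \<noteq> {} \<and>
    (\<forall>X\<in>circuits M. orthogonal X Y)}"
  have min: "minsupp (circuits M) = circuits M"
    using supp_antichain unfolding minsupp_def by blast
  have pair: "om_pair (ground M) (circuits M) (minsupp V)"
  proof
    fix e U assume e: "e \<in> ground M" and U: "U \<subseteq> ground M - {e}"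
    show "(\<exists>X\<in>circuits M. e \<in> supp X \<and> supp X \<subseteq> insert e U) \<or>
      (\<exists>Y\<in>minsupp V. e \<in> supp Y \<and> supp Y \<inter> U = {})"
    proof (rule disj_imp[THEN iffD2, OF impI])
      assume "\<not> (\<exists>X\<in>circuits M. e \<in> supp X \<and> supp X \<subseteq> insert e U)"
      then have "\<And>X. X \<in> circuits M \<Longrightarrow> e \<in> supp X \<Longrightarrow> \<not> supp X \<subseteq> insert e U" by blast
      from orthogonal_vector[OF fin e U this] obtain Y where Y: "fst Y \<inter> snd Y = {}"
        "supp Y \<subseteq> ground M - U" "e \<in> supp Y" "\<forall>X\<in>circuits M. supp X \<subseteq> ground M \<longrightarrow> orthogonal X Y"
        and Ymin: "\<forall>Z. fst Z \<inter> snd Z = {} \<and> supp Z \<noteq> {} \<and>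
          (\<forall>X\<in>circuits M. supp X \<subseteq> ground M \<longrightarrow> orthogonal X Z) \<and> supp Z \<subseteq> supp Y \<longrightarrow> supp Z = supp Y"
        by blast
      have "Y \<in> V" using Y ax(1) by (auto simp: V_def)
      moreover have "supp Z = supp Y" if "Z \<in> V" "supp Z \<subseteq> supp Y" for Z
        using Ymin[rule_format, of Z] that by (simp add: V_def)
      ultimately have "Y \<in> minsupp V" by (simp add: minsupp_def)
      then show "\<exists>Y\<in>minsupp V. e \<in> supp Y \<and> supp Y \<inter> U = {}" using Y(2,3) by (intro bexI[of _ Y]) auto
    qed
  next
    show "opp Y \<in> minsupp V" if "Y \<in> minsupp V" for Y
      using that orthogonal_sym[of _ "opp Y"] orthogonal_sym[of _ Y] by (auto simp: V_def minsupp_def)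
  qed (use ax(1) fin opp_mem in \<open>simp_all add: V_def minsupp_def\<close>)
  interpret om_rep "ground M" "circuits M" "minsupp V" M
    using pair min by (simp add: om_rep_def om_rep_axioms_def)
  have "minsupp (minsupp V) = minsupp V" by (auto simp: minsupp_def)
  then show "om_pair (ground M) (circuits M) (cocircuits M)" "minsupp (circuits M) = circuits M"
    "minsupp (cocircuits M) = cocircuits M"
    using pair min by (simp_all add: cocircuits_K)
qed

section \<open>Reorientations and minors\<close>

definition reo :: "'a set \<Rightarrow> 'a sset \<Rightarrow> 'a sset" where
  "reo A X = ((fst X - A) \<union> (snd X \<inter> A), (snd X - A) \<union> (fst X \<inter> A))"

lemma supp_reo [simp]: "supp (reo A X) = supp X"
  by (auto simp: supp_def reo_def)

lemma reo_opp: "reo A (opp X) = opp (reo A X)"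
  by (simp add: reo_def opp_def)

lemma orthogonal_reo: "orthogonal (reo A X) (reo A Y) \<longleftrightarrow> orthogonal X Y"
  unfolding orthogonal_def reo_def fst_conv snd_conv by blast

lemma minsupp_reo: "minsupp (reo A ` C) = reo A ` minsupp C"
  by (simp add: minsupp_def Compr_image_eq)

lemma pair_basis_reo: "pair_basis E (reo A ` C) (reo A ` D) B \<longleftrightarrow> pair_basis E C D B"
  by (simp add: pair_basis_def)

lemma disjoint_reo: "fst X \<inter> snd X = {} \<Longrightarrow> fst (reo A X) \<inter> snd (reo A X) = {}"
  by (auto simp: reo_def)

lemma opposite_signs_opp: "opposite_signs (opp X) x y \<longleftrightarrow> opposite_signs X x y"
  by (auto simp: opposite_signs_def)

lemma opposite_signs_reo:
  assumes "fst X \<inter> snd X = {}" "x \<in> supp X" "y \<in> supp X"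
  shows "opposite_signs (reo A X) x y \<longleftrightarrow> (opposite_signs X x y \<longleftrightarrow> (x \<in> A \<longleftrightarrow> y \<in> A))"
  using assms unfolding opposite_signs_def supp_def reo_def by auto

lemma om_pair_reo:
  assumes "om_pair E C D" shows "om_pair E (reo A ` C) (reo A ` D)"
proof -
  interpret om_pair E C D by fact
  show ?thesis
  proof
    fix e U assume "e \<in> E" "U \<subseteq> E - {e}"
    then show "(\<exists>X\<in>reo A ` C. e \<in> supp X \<and> supp X \<subseteq> insert e U) \<or>
      (\<exists>Y\<in>reo A ` D. e \<in> supp Y \<and> supp Y \<inter> U = {})"
      using unsigned_painting by simp
  next
    show "opp X \<in> reo A ` C" if "X \<in> reo A ` C" for X
      using that C_opp by (auto simp: reo_opp[symmetric])
    show "opp X \<in> reo A ` D" if "X \<in> reo A ` D" for X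
      using that D_opp by (auto simp: reo_opp[symmetric])
  qed ((elim imageE)?, simp add: fin C_sub D_sub C_disj D_disj C_ne D_ne orth disjoint_reo orthogonal_reo)+
qed

text \<open>\<open>fund\<close> makes \<open>e\<close> positive, so the reoriented circuit has to be
  negated when \<open>e\<close> itself is flipped.\<close>

lemma (in om_pair) fund_reo:
  assumes B: "pair_basis E C D B" and e: "e \<in> E - B"
  shows "fund (reo A ` C) B e = (if e \<in> A then opp (reo A (fund C B e)) else reo A (fund C B e))"
proof -
  interpret reo: om_pair E "reo A ` C" "reo A ` D" by (rule om_pair_reo[OF om_pair_axioms])
  note F = fund_props[OF B e]
  have "e \<notin> snd (fund C B e)" using F C_disj by blast
  then show ?thesis
    using F e C_opp[OF F(1)] B
    by (intro reo.fund_eqI) (auto simp: pair_basis_reo reo_opp[symmetric], auto simp: reo_def)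
qed

section \<open>Minors of dual pairs\<close>

definition restr :: "'a set \<Rightarrow> 'a sset \<Rightarrow> 'a sset" where
  "restr S X = (fst X \<inter> S, snd X \<inter> S)"

lemma fst_restr [simp]: "fst (restr S X) = fst X \<inter> S"
  and snd_restr [simp]: "snd (restr S X) = snd X \<inter> S"
  by (simp_all add: restr_def)

lemma supp_restr [simp]: "supp (restr S X) = supp X \<inter> S"
  by (auto simp: supp_def)

text \<open>All nonempty traces are kept, without the minimality condition of
  \<open>contraction\<close>; this is why \<open>om_pair\<close> allows comparable supports.\<close>

definition minor_circuits :: "'a sset set \<Rightarrow> 'a set \<Rightarrow> 'a set \<Rightarrow> 'a sset set" where
  "minor_circuits C F S = {restr S X | X. X \<in> C \<and> supp X \<subseteq> F \<and> supp X \<inter> S \<noteq> {}}"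

lemma opp_minor_circuits:
  assumes opp: "\<And>X. X \<in> C \<Longrightarrow> opp X \<in> C" and X: "X \<in> minor_circuits C F S"
  shows "opp X \<in> minor_circuits C F S"
proof -
  obtain X' where X': "X = restr S X'" "X' \<in> C" "supp X' \<subseteq> F" "supp X' \<inter> S \<noteq> {}"
    using X unfolding minor_circuits_def by blast
  have "opp X = restr S (opp X')" by (simp add: X'(1) restr_def opp_def)
  moreover have "opp X' \<in> C" using opp X' by blast
  ultimately show ?thesis using X'(3,4) supp_opp[of X'] unfolding minor_circuits_def by blast
qed

text \<open>In the minor on \<open>S\<close> obtained by restriction to \<open>F\<close> and contraction of \<open>F - S\<close>, the roles of
  \<open>F\<close> and \<open>E - (F - S)\<close> are exchanged by duality.\<close>

lemma om_pair_minor: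
  assumes "om_pair E C D" and S: "S \<subseteq> F" "F \<subseteq> E"
  shows "om_pair S (minor_circuits C F S) (minor_circuits D (E - (F - S)) S)"
proof -
  interpret om_pair E C D by fact
  show ?thesis
  proof
    fix e U assume e: "e \<in> S" and U: "U \<subseteq> S - {e}"
    \<comment> \<open>Adding \<open>F - S\<close> to \<open>U\<close> makes the contracted elements
      available to circuits and forbids them to cocircuits.\<close>
    have "e \<in> E" "U \<union> (F - S) \<subseteq> E - {e}" using e U S by auto
    from unsigned_painting[OF this]
    show "(\<exists>X\<in>minor_circuits C F S. e \<in> supp X \<and> supp X \<subseteq> insert e U) \<or>
      (\<exists>Y\<in>minor_circuits D (E - (F - S)) S. e \<in> supp Y \<and> supp Y \<inter> U = {})"
    proof (elim disjE bexE conjE)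
      fix X assume X: "X \<in> C" "e \<in> supp X" "supp X \<subseteq> insert e (U \<union> (F - S))"
      then have "restr S X \<in> minor_circuits C F S" using e U S unfolding minor_circuits_def by blast
      then show ?thesis using X e U by (intro disjI1 bexI[of _ "restr S X"]) auto
    next
      fix Y assume Y: "Y \<in> D" "e \<in> supp Y" "supp Y \<inter> (U \<union> (F - S)) = {}"
      then have "restr S Y \<in> minor_circuits D (E - (F - S)) S"
        using e D_sub[OF Y(1)] unfolding minor_circuits_def by blast
      then show ?thesis using Y e by (intro disjI2 bexI[of _ "restr S Y"]) auto
    qed
  next
    fix X Y assume "X \<in> minor_circuits C F S" "Y \<in> minor_circuits D (E - (F - S)) S"
    then obtain X' Y' where X': "X = restr S X'" "X' \<in> C" "supp X' \<subseteq> F"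
      and Y': "Y = restr S Y'" "Y' \<in> D" "supp Y' \<subseteq> E - (F - S)"
      unfolding minor_circuits_def by blast
    have "x \<in> S" if "x \<in> supp X'" "x \<in> supp Y'" for x using that X'(3) Y'(3) by blast
    then have "fst X' \<inter> S \<inter> (fst Y' \<inter> S) = fst X' \<inter> fst Y'" "snd X' \<inter> S \<inter> (snd Y' \<inter> S) = snd X' \<inter> snd Y'"
      "fst X' \<inter> S \<inter> (snd Y' \<inter> S) = fst X' \<inter> snd Y'" "snd X' \<inter> S \<inter> (fst Y' \<inter> S) = snd X' \<inter> fst Y'"
      by (auto simp: in_supp_iff)
    then show "orthogonal X Y"
      using orth[OF X'(2) Y'(2)] unfolding X'(1) Y'(1) orthogonal_def fst_restr snd_restr by simp
  next
    show "opp X \<in> minor_circuits C F S" if "X \<in> minor_circuits C F S" for X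
      using opp_minor_circuits[OF C_opp that] .
    show "opp X \<in> minor_circuits D (E - (F - S)) S" if "X \<in> minor_circuits D (E - (F - S)) S" for X
      using opp_minor_circuits[OF D_opp that] .
    show "finite S" using fin S by (meson finite_subset)
    show "fst X \<inter> snd X = {}" if X: "X \<in> minor_circuits C F S" for X
      using X C_disj unfolding minor_circuits_def by fastforce
    show "fst X \<inter> snd X = {}" if X: "X \<in> minor_circuits D (E - (F - S)) S" for X
      using X D_disj unfolding minor_circuits_def by fastforce
  qed (auto simp: minor_circuits_def)
qed

text \<open>The minimality condition in \<open>contraction\<close> is that of \<open>minsupp\<close>
  for the traces.\<close>

lemma om_rep_minor:
  assumes pair: "om_pair E (circuits N) D" and G: "G \<subseteq> F" "F \<subseteq> E"
  shows "om_rep (F - G) (minor_circuits (circuits N) F (F - G)) (minor_circuits D (E - G) (F - G))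
    (contraction (restriction N F) G)"
proof -
  have eq: "F - (F - G) = G" using G by blast
  interpret om_pair "F - G" "minor_circuits (circuits N) F (F - G)" "minor_circuits D (E - G) (F - G)"
    using om_pair_minor[OF pair, of "F - G" F] G unfolding eq by blast
  have r: "(fst X - G, snd X - G) = restr (F - G) X" "supp X \<inter> (F - G) = supp X - G" if "supp X \<subseteq> F" for X
    using that by (auto simp: restr_def supp_def)
  show ?thesis
  proof unfold_locales
    show "ground (contraction (restriction N F) G) = F - G"
      by (simp add: contraction_def restriction_def)
    have mem: "Z \<in> circuits (contraction (restriction N F) G) \<longleftrightarrow>
      (\<exists>X. Z = (fst X - G, snd X - G) \<and> (X \<in> circuits N \<and> supp X \<subseteq> F) \<and> supp X - G \<noteq> {} \<and>
        (\<forall>Y. Y \<in> circuits N \<and> supp Y \<subseteq> F \<longrightarrow> supp Y - G \<noteq> {} \<and> supp Y - G \<subseteq> supp X - G \<longrightarrow>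
          supp Y - G = supp X - G))" for Z
      by (simp add: contraction_def restriction_def Ball_def del: split_paired_Ex split_paired_All)
    show "circuits (contraction (restriction N F) G) = minsupp (minor_circuits (circuits N) F (F - G))"
    proof (intro set_eqI iffI)
      fix Z assume "Z \<in> circuits (contraction (restriction N F) G)"
      then obtain X where X: "Z = (fst X - G, snd X - G)" "X \<in> circuits N" "supp X \<subseteq> F" "supp X - G \<noteq> {}"
        and minX: "\<forall>Y. Y \<in> circuits N \<and> supp Y \<subseteq> F \<longrightarrow> supp Y - G \<noteq> {} \<and> supp Y - G \<subseteq> supp X - G \<longrightarrow>
          supp Y - G = supp X - G"
        unfolding mem by (elim exE conjE) (rule that)
      have Z: "Z = restr (F - G) X" using X(1) r(1)[OF X(3)] by simp
      then have "Z \<in> minor_circuits (circuits N) F (F - G)"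
        using X(2-4) r(2)[OF X(3)] unfolding minor_circuits_def by blast
      moreover have "supp Y = supp Z"
        if Y: "Y \<in> minor_circuits (circuits N) F (F - G)" "supp Y \<subseteq> supp Z" for Y
      proof -
        obtain Y' where Y': "Y = restr (F - G) Y'" "Y' \<in> circuits N" "supp Y' \<subseteq> F" "supp Y' \<inter> (F - G) \<noteq> {}"
          using Y(1) unfolding minor_circuits_def by blast
        then show ?thesis using minX[rule_format, of Y'] Y(2) X(3) r(2) by (simp add: Z)
      qed
      ultimately show "Z \<in> minsupp (minor_circuits (circuits N) F (F - G))"
        unfolding minsupp_def by blast
    next
      fix Z assume Z: "Z \<in> minsupp (minor_circuits (circuits N) F (F - G))"
      then obtain X where X: "Z = restr (F - G) X" "X \<in> circuits N" "supp X \<subseteq> F" "supp X \<inter> (F - G) \<noteq> {}"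
        unfolding minsupp_def minor_circuits_def by blast
      have "supp Y - G = supp X - G"
        if Y: "Y \<in> circuits N" "supp Y \<subseteq> F" "supp Y - G \<noteq> {}" "supp Y - G \<subseteq> supp X - G" for Y
      proof -
        have "restr (F - G) Y \<in> minor_circuits (circuits N) F (F - G)"
          using Y r(2)[OF Y(2)] unfolding minor_circuits_def by blast
        moreover have "supp (restr (F - G) Y) \<subseteq> supp Z" using X(1,3) Y(2,4) r(2) by simp
        ultimately have "supp (restr (F - G) Y) = supp Z" using Z unfolding minsupp_def by blast
        then show ?thesis using X(1,3) Y(2) r(2) by simp
      qed
      then show "Z \<in> circuits (contraction (restriction N F) G)"
        unfolding mem using X r[OF X(3)] by (intro exI[of _ X]) auto
    qed
  qed
qed

lemma reorient_rep:
  assumes M: "oriented_matroid M"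
  shows "ground (reorient M A) = ground M" "circuits (reorient M A) = reo A ` circuits M"
    "cocircuits (reorient M A) = reo A ` cocircuits M"
    "om_rep (ground M) (reo A ` circuits M) (reo A ` cocircuits M) (reorient M A)"
proof -
  show g: "ground (reorient M A) = ground M" and c: "circuits (reorient M A) = reo A ` circuits M"
    by (simp_all add: reorient_def reo_def[abs_def])
  interpret om_pair "ground M" "reo A ` circuits M" "reo A ` cocircuits M"
    by (rule om_pair_reo[OF oriented_matroid_pair(1)[OF M]])
  interpret om_rep "ground M" "reo A ` circuits M" "reo A ` cocircuits M" "reorient M A"
    by unfold_locales (simp_all add: g c minsupp_reo oriented_matroid_pair(2)[OF M])
  show "om_rep (ground M) (reo A ` circuits M) (reo A ` cocircuits M) (reorient M A)" ..
  show "cocircuits (reorient M A) = reo A ` cocircuits M"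
    by (simp add: cocircuits_K minsupp_reo oriented_matroid_pair(3)[OF M])
qed


section \<open>Uniqueness of the fully optimal basis\<close>

definition fully_optimal :: "'a::linorder set \<Rightarrow> 'a sset set \<Rightarrow> 'a sset set \<Rightarrow> 'a set \<Rightarrow> bool" where
  "fully_optimal E C D B \<longleftrightarrow> pair_basis E C D B \<and>
     (\<forall>b\<in>B - {Min E}. opposite_signs (fund D (E - B) b) b (Min (supp (fund D (E - B) b)))) \<and>
     (\<forall>e\<in>E - B. opposite_signs (fund C B e) e (Min (supp (fund C B e))))"

text \<open>Since \<open>e\<close> is positive in its fundamental circuit, \<open>m\<close> is
  negative there. Duality of fundamental signs then makes \<open>e\<close> positive in the
  fundamental cocircuit of \<open>m\<close>.\<close>

lemma (in om_pair) opposite_fund: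
  assumes B: "pair_basis E C D B" and e: "e \<in> E - B" and o: "opposite_signs (fund C B e) e m"
  shows "m \<in> B" "m \<noteq> e" "e \<in> fst (fund D (E - B) m)"
proof -
  note F = fund_props[OF B e]
  have "m \<in> snd (fund C B e)" "m \<noteq> e"
    using o F(3) C_disj[OF F(1)] unfolding opposite_signs_def by blast+
  then show "m \<in> B" "m \<noteq> e" using F(2) by (auto simp: supp_def)
  then show "e \<in> fst (fund D (E - B) m)"
    using fund_cofund(2)[OF B e] \<open>m \<in> snd (fund C B e)\<close> by blast
qed

locale ordered_om_pair = om_pair E C D for E :: "'a::linorder set" and C D
begin

lemma Min_supp: "X \<in> C \<Longrightarrow> Min (supp X) \<in> supp X" "X \<in> C \<Longrightarrow> x \<in> supp X \<Longrightarrow> Min (supp X) \<le> x"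
  using C_finite C_ne by auto

text \<open>Orthogonality to the fundamental cocircuit of \<open>m\<close> in \<open>B\<close>
  forces \<open>m\<close> to be positive in \<open>X\<close>. If \<open>m\<close> is outside
  \<open>B'\<close>, its fundamental circuit there has a minimum below \<open>m\<close>, against
  minimality. If \<open>m\<close> is in \<open>B'\<close>, its fundamental cocircuit there has no
  conflict with \<open>X\<close>.\<close>

lemma no_separating_circuit_at_min:
  assumes B: "pair_basis E C D B" and B': "pair_basis E C D B'"
    and opt: "\<And>f. f \<in> B' - B \<Longrightarrow> opposite_signs (fund C B f) f (Min (supp (fund C B f)))"
    and opt': "\<And>f. f \<in> B - B' \<Longrightarrow> opposite_signs (fund C B' f) f (Min (supp (fund C B' f)))"
    and X: "X \<in> C" "supp X \<subseteq> B \<union> B'" "fst X \<inter> (B' - B) = {}" "snd X \<inter> (B - B') = {}"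
    and f0: "f0 \<in> supp X \<inter> (B' - B)" "m = Min (supp (fund C B f0))"
    and le: "\<And>f. f \<in> supp X \<inter> (B' - B) \<Longrightarrow> m \<le> Min (supp (fund C B f))"
    and le': "\<And>f. f \<in> supp X \<inter> (B - B') \<Longrightarrow> m \<le> Min (supp (fund C B' f))"
  shows False
proof -
  have BE: "B \<subseteq> E" "B' \<subseteq> E" using B B' by (auto simp: pair_basis_def)
  have f0E: "f0 \<in> E - B" using f0 BE by blast
  note m0 = opposite_fund[OF B f0E opt[of f0, folded f0(2)]]
  have mB: "m \<in> B" using m0 f0 by blast
  define Y where "Y = fund D (E - B) m"
  note Y = cofund_props[OF B mB, folded Y_def]
  \<comment> \<open>Such an \<open>f\<close> lies in \<open>B' - B\<close>, and minimality of
    \<open>m\<close> makes \<open>m\<close> the smallest element of its fundamental circuit, so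
    optimality fixes the sign.\<close>
  have neg: "f \<in> snd X \<and> f \<in> fst Y" if f: "f \<in> supp X" "f \<in> supp Y" "f \<noteq> m" for f
  proof -
    have fB: "f \<in> B' - B" using f Y(4) X(2) by blast
    then have fE: "f \<in> E - B" using BE by blast
    have "m \<in> supp (fund C B f)" using fund_cofund(3)[OF B fE mB] f(2) by (simp add: Y_def)
    then have "Min (supp (fund C B f)) \<le> m" using Min_supp fund_props[OF B fE] by blast
    then have "Min (supp (fund C B f)) = m" using le[of f] f fB by auto
    then have "f \<in> fst Y" using opposite_fund(3)[OF B fE] opt[OF fB] by (simp add: Y_def)
    moreover have "f \<in> snd X" using X(3) fB f(1) by (auto simp: supp_def)
    ultimately show ?thesis by blast
  qed
  have f0Y: "f0 \<in> fst Y" using m0(3) f0 unfolding Y_def by blast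
  have "f0 \<noteq> m" using mB f0 by blast
  have mX: "m \<in> fst X"
  proof (rule ccontr)
    assume "m \<notin> fst X"
    have "\<not> orthogonal (opp X) Y"
    proof (rule not_orthogonal_agree)
      show "f0 \<in> supp (opp X)" "f0 \<in> supp Y" using f0 f0Y by (auto simp: in_supp_iff)
      show "x \<notin> fst (opp X) \<inter> snd Y \<union> snd (opp X) \<inter> fst Y" if "x \<in> supp (opp X)" "x \<in> supp Y" for x
        using neg[of x] that \<open>m \<notin> fst X\<close> C_disj[OF X(1)] D_disj[OF Y(1)] Y(3) by (cases "x = m") auto
    qed
    then show False using orth[OF X(1) Y(1)] by simp
  qed
  show False
  proof (cases "m \<in> B'")
    case False
    then have mE: "m \<in> B - B'" "m \<in> E - B'" using mB BE by auto
    note F = fund_props[OF B' mE(2)]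
    have "Min (supp (fund C B' m)) \<le> m" using Min_supp(2)[OF F(1)] F(3) by (simp add: supp_def)
    moreover have "Min (supp (fund C B' m)) \<noteq> m" using opposite_fund(2)[OF B' mE(2) opt'[OF mE(1)]] .
    moreover have "m \<le> Min (supp (fund C B' m))" using le' mE mX by (auto simp: supp_def)
    ultimately show False by simp
  next
    case True
    define Z where "Z = fund D (E - B') m"
    note Z = cofund_props[OF B' True, folded Z_def]
    \<comment> \<open>The same argument with the bases exchanged; now the signs in \<open>X\<close>
      and \<open>Z\<close> coincide.\<close>
    have pos: "f \<in> fst X \<and> f \<in> fst Z" if f: "f \<in> supp X" "f \<in> supp Z" "f \<noteq> m" for f
    proof -
      have fB: "f \<in> B - B'" using f Z(4) X(2) by blast
      then have fE: "f \<in> E - B'" using BE by blast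
      have "m \<in> supp (fund C B' f)" using fund_cofund(3)[OF B' fE True] f(2) by (simp add: Z_def)
      then have "Min (supp (fund C B' f)) \<le> m" using Min_supp fund_props[OF B' fE] by blast
      then have "Min (supp (fund C B' f)) = m" using le'[of f] f fB by auto
      then have "f \<in> fst Z" using opposite_fund(3)[OF B' fE] opt'[OF fB] by (simp add: Z_def)
      moreover have "f \<in> fst X" using X(4) fB f(1) by (auto simp: supp_def)
      ultimately show ?thesis by blast
    qed
    have "\<not> orthogonal X Z"
    proof (rule not_orthogonal_agree)
      show "m \<in> supp X" "m \<in> supp Z" using mX Z(3) by (auto simp: in_supp_iff)
      show "x \<notin> fst X \<inter> snd Z \<union> snd X \<inter> fst Z" if "x \<in> supp X" "x \<in> supp Z" for x
        using pos[of x] that mX C_disj[OF X(1)] D_disj[OF Z(1)] Z(3) by (cases "x = m") auto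
    qed
    then show False using orth[OF X(1) Z(1)] by simp
  qed
qed

text \<open>The least of the minima may be attained on either side; the second case is the first one
  for \<open>opp X\<close> with the bases exchanged.\<close>

lemma no_separating_circuit:
  assumes B: "pair_basis E C D B" and B': "pair_basis E C D B'"
    and opt: "\<And>f. f \<in> B' - B \<Longrightarrow> opposite_signs (fund C B f) f (Min (supp (fund C B f)))"
    and opt': "\<And>f. f \<in> B - B' \<Longrightarrow> opposite_signs (fund C B' f) f (Min (supp (fund C B' f)))"
    and X: "X \<in> C" "supp X \<subseteq> B \<union> B'" "fst X \<inter> (B' - B) = {}" "snd X \<inter> (B - B') = {}"
  shows False
proof -
  define S where "S = (\<lambda>f. Min (supp (fund C B f))) ` (supp X \<inter> (B' - B)) \<union>
    (\<lambda>f. Min (supp (fund C B' f))) ` (supp X \<inter> (B - B'))"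
  have fS: "finite S" using C_finite[OF X(1)] by (simp add: S_def)
  have "\<not> supp X \<subseteq> B'" using B' X(1) by (auto simp: pair_basis_def)
  then have "supp X \<inter> (B - B') \<noteq> {}" using X(2) by blast
  then have "S \<noteq> {}" by (auto simp: S_def)
  then have "Min S \<in> S" using fS by simp
  have le: "\<And>f. f \<in> supp X \<inter> (B' - B) \<Longrightarrow> Min S \<le> Min (supp (fund C B f))"
    "\<And>f. f \<in> supp X \<inter> (B - B') \<Longrightarrow> Min S \<le> Min (supp (fund C B' f))"
    using fS by (intro Min_le; force simp: S_def)+
  from \<open>Min S \<in> S\<close> consider f where "f \<in> supp X \<inter> (B' - B)" "Min S = Min (supp (fund C B f))"
    | f where "f \<in> supp X \<inter> (B - B')" "Min S = Min (supp (fund C B' f))"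
    unfolding S_def by blast
  then show False
  proof cases
    case 1
    show False by (rule no_separating_circuit_at_min[OF B B' opt opt' X 1 le])
  next
    case 2
    show False
      by (rule no_separating_circuit_at_min[OF B' B opt' opt C_opp[OF X(1)], of f "Min S"])
        (use X 2 le in auto)
  qed
qed

text \<open>For two fully optimal bases, paint \<open>B - B'\<close> positive and \<open>B' - B\<close> negative: neither the circuit nor
  the cocircuit of the painting lemma can exist. In the realizable case a fully optimal basis is the
  optimal basis of a generic linear program, and the circuit and the cocircuit are the differences of
  the slacks of two primal and of two dual optimal solutions.\<close>

lemma fully_optimal_unique:
  assumes B: "fully_optimal E C D B" and B': "fully_optimal E C D B'"
  shows "B = B'"
proof (rule ccontr)
  assume "B \<noteq> B'"
  interpret dual: ordered_om_pair E D C by (simp add: ordered_om_pair_def dual_pair)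
  have b: "pair_basis E C D B" "pair_basis E C D B'" using B B' by (auto simp: fully_optimal_def)
  have BE: "B \<subseteq> E" "B' \<subseteq> E" using b by (auto simp: pair_basis_def)
  obtain e where e: "e \<in> (B - B') \<union> (B' - B)" using \<open>B \<noteq> B'\<close> by blast
  \<comment> \<open>Both bases contain \<open>Min E\<close>, so the exception made for it does not
    touch \<open>B - B'\<close> and \<open>B' - B\<close>. The cocircuit case uses optimality on
    these differences.\<close>
  have p: "Min E \<in> B" if B: "fully_optimal E C D B" for B
  proof (rule ccontr)
    assume no: "Min E \<notin> B"
    have E: "Min E \<in> E" using e BE fin by (intro Min_in) auto
    have pb: "pair_basis E C D B" using B by (simp add: fully_optimal_def)
    note F = fund_props[OF pb, of "Min E"]
    have "supp (fund C B (Min E)) \<subseteq> E" "Min E \<in> supp (fund C B (Min E))"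
      using F no E C_sub by (auto simp: in_supp_iff)
    then have "Min (supp (fund C B (Min E))) = Min E"
      using fin by (intro Min_eqI) (auto intro: finite_subset)
    moreover have "opposite_signs (fund C B (Min E)) (Min E) (Min (supp (fund C B (Min E))))"
      using B no E unfolding fully_optimal_def by blast
    ultimately show False using opposite_fund(2)[OF pb, of "Min E" "Min E"] no E by simp
  qed
  have "(B - B') \<inter> (B' - B) = {}" "((B - B') \<union> (B' - B)) \<inter> (B \<inter> B') = {}"
    "(B - B') \<union> (B' - B) \<union> B \<inter> B' \<subseteq> E" using BE by auto
  from signed_painting[OF e this] show False
  proof (elim disjE bexE conjE)
    fix X assume "X \<in> C" "supp X \<subseteq> B - B' \<union> (B' - B) \<union> B \<inter> B'" "fst X \<inter> (B' - B) = {}" "snd X \<inter> (B - B') = {}"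
    then show False
      by (intro no_separating_circuit[OF b, of X]) (use B B' BE in \<open>auto simp: fully_optimal_def\<close>)
  next
    fix Y assume Y: "Y \<in> D" "supp Y \<inter> (B \<inter> B') = {}" "fst Y \<inter> (B' - B) = {}" "snd Y \<inter> (B - B') = {}"
    \<comment> \<open>Complementation exchanges the two differences, so the complements enter in
      reverse order.\<close>
    have *: "(E - B) - (E - B') = B' - B" "(E - B') - (E - B) = B - B'" using BE by auto
    show False
      using Y D_sub[OF Y(1)] B B' BE p[OF B] p[OF B']
      by (intro dual.no_separating_circuit[OF pair_basis_dual[OF b(2)] pair_basis_dual[OF b(1)], of Y])
        (auto simp: fully_optimal_def *)
  qed
qed

end

lemma alpha_bounded_eq:
  assumes "om_rep E C D K" and B: "fully_optimal E C D B"
  shows "alpha_bounded K = B"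
proof -
  interpret om_rep E C D K by fact
  interpret ordered_om_pair E C D ..
  have "(basis K B \<and>
      (\<forall>b\<in>B - {Min E}. opposite_signs (fund_cocircuit K B b) b (Min (supp (fund_cocircuit K B b)))) \<and>
      (\<forall>e\<in>E - B. opposite_signs (fund_circuit K B e) e (Min (supp (fund_circuit K B e))))) \<longleftrightarrow>
    fully_optimal E C D B" for B
    unfolding fully_optimal_def basis_iff using fund_circuit_eq[of B] fund_cocircuit_eq[of B]
    by (metis DiffD1)
  then show ?thesis
    unfolding alpha_bounded_def ground_K Let_def using B fully_optimal_unique by (intro the_equality) auto
qed

section \<open>Levels\<close>

text \<open>The levels are the indices of the parts of the active partition: positive on the parts of
  cocircuits, and negative with reversed order on the parts of circuits, so that the sets of the active
  filtration are the sublevel sets. \<open>I\<close> and \<open>J\<close> are the sets of active elements.\<close>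

locale level_function = ordered_om_pair E C D for E :: "'a::linorder set" and C D +
  fixes B I J :: "'a set" and idx lev :: "'a \<Rightarrow> int"
  assumes basis: "pair_basis E C D B"
    and idx_mono: "x \<in> E \<Longrightarrow> y \<in> E \<Longrightarrow> x < y \<Longrightarrow> idx x < idx y"
    and idx_pos: "x \<in> E \<Longrightarrow> 0 < idx x"
    and I_sub: "I \<subseteq> B" and J_sub: "J \<subseteq> E - B"
    and lev_I: "a \<in> I \<Longrightarrow> lev a = idx a" and lev_J: "a \<in> J \<Longrightarrow> lev a = - idx a"
    and lev_bound: "x \<in> E \<Longrightarrow> \<bar>lev x\<bar> \<le> idx x"
    and lev_root: "x \<in> E \<Longrightarrow> \<exists>a\<in>I \<union> J. lev a = lev x"
    and lev_mono: "b \<in> B \<Longrightarrow> e \<in> supp (fund D (E - B) b) \<Longrightarrow> lev b \<le> lev e"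
    and lower_B: "b \<in> B - I \<Longrightarrow> \<exists>c\<in>supp (fund D (E - B) b). c < b \<and> lev c = lev b"
    and lower_E: "e \<in> E - B - J \<Longrightarrow> \<exists>c\<in>supp (fund C B e). c < e \<and> lev c = lev e"

text \<open>The assumptions of \<open>level_function\<close> on circuits and cocircuits concern
  supports only and survive reorientation; signs enter here. Each condition compares two elements of
  equal level, hence is optimality inside one minor of the filtration.\<close>

locale levelled = level_function +
  assumes opt_B: "b \<in> B - I \<Longrightarrow>
      opposite_signs (fund D (E - B) b) b (Min {c \<in> supp (fund D (E - B) b). lev c = lev b})"
    and opt_E: "e \<in> E - B - J \<Longrightarrow>
      opposite_signs (fund C B e) e (Min {c \<in> supp (fund C B e). lev c = lev e})"

context level_function
begin

lemma BE: "B \<subseteq> E" and IE: "I \<subseteq> E" and JE: "J \<subseteq> E"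
  using basis I_sub J_sub by (auto simp: pair_basis_def)

lemma lev_mono': "e \<in> E - B \<Longrightarrow> b \<in> supp (fund C B e) \<Longrightarrow> lev b \<le> lev e"
  using lev_mono fund_cofund(3)[OF basis] fund_props(2)[OF basis, of e] by (cases "b = e") auto

lemma level_function_dual: "level_function E D C (E - B) J I idx (\<lambda>x. - lev x)"
proof -
  interpret dual: om_pair E D C by (rule dual_pair)
  have dd: "E - (E - B) = B" using BE by blast
  show ?thesis
  proof
    show "pair_basis E D C (E - B)" by (rule pair_basis_dual[OF basis])
    show "\<exists>a\<in>J \<union> I. - lev a = - lev x" if "x \<in> E" for x
      using lev_root[OF that] by (simp add: Un_commute)
  qed (use idx_mono idx_pos I_sub J_sub lev_I lev_J lev_bound lev_mono' lower_B lower_E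
    in \<open>auto simp: dd\<close>)
qed

lemma idx_le_iff: "x \<in> E \<Longrightarrow> y \<in> E \<Longrightarrow> idx x \<le> idx y \<longleftrightarrow> x \<le> y"
  using idx_mono[of x y] idx_mono[of y x] by (cases x y rule: linorder_cases) auto

lemma lev_pos_root: "x \<in> E \<Longrightarrow> 0 < lev x \<Longrightarrow> \<exists>a\<in>I. lev a = lev x"
  using lev_root[of x] lev_J idx_pos JE by fastforce

lemma lev_nonzero: "x \<in> E \<Longrightarrow> lev x \<noteq> 0"
  using lev_root[of x] lev_I lev_J idx_pos IE JE by fastforce

lemma lev_inj: "a \<in> I \<union> J \<Longrightarrow> b \<in> I \<union> J \<Longrightarrow> lev a = lev b \<Longrightarrow> a = b"
proof -
  assume a: "a \<in> I \<union> J" and b: "b \<in> I \<union> J" and eq: "lev a = lev b"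
  have E: "a \<in> E" "b \<in> E" using a b IE JE by auto
  have "idx a = idx b"
    using a b eq lev_I lev_J idx_pos[OF E(1)] idx_pos[OF E(2)] by fastforce
  then show "a = b" using idx_le_iff[OF E] idx_le_iff[OF E(2,1)] by simp
qed

text \<open>For \<open>a\<close> in \<open>I\<close> as well as in \<open>J\<close>, consecutive
  members of the active filtration turn out to be \<open>below a - level a\<close> and
  \<open>below a\<close>.\<close>

definition below :: "'a \<Rightarrow> 'a set" where "below a = {x \<in> E. lev x \<le> lev a}"
definition level :: "'a \<Rightarrow> 'a set" where "level a = {x \<in> E. lev x = lev a}"

text \<open>For active \<open>a\<close> the absolute value of \<open>lev a\<close> is
  \<open>idx a\<close>, while \<open>lev_bound\<close> bounds that of \<open>lev x\<close> by
  \<open>idx x\<close>.\<close>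

lemma level_min: "a \<in> I \<union> J \<Longrightarrow> x \<in> E \<Longrightarrow> lev x = lev a \<Longrightarrow> a \<le> x"
  using lev_bound[of x] lev_I[of a] lev_J[of a] idx_pos[of a] idx_le_iff[of a x] IE JE by fastforce

end

context levelled
begin

lemma levelled_dual: "levelled E D C (E - B) J I idx (\<lambda>x. - lev x)"
proof -
  interpret dual: level_function E D C "E - B" J I idx "\<lambda>x. - lev x" by (rule level_function_dual)
  have "E - (E - B) = B" using BE by blast
  then show ?thesis by unfold_locales (use opt_B opt_E in auto)
qed

lemma level_min_fund:
  assumes e: "e \<in> E - B - J" and m: "m = Min {c \<in> supp (fund C B e). lev c = lev e}"
  shows "m \<in> B" "lev m = lev e" "e \<in> fst (fund D (E - B) m)"
    "\<And>c. c \<in> supp (fund C B e) \<Longrightarrow> lev c = lev e \<Longrightarrow> m \<le> c"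
proof -
  have eE: "e \<in> E - B" using e by blast
  note F = fund_props[OF basis eE]
  have f: "finite {c \<in> supp (fund C B e). lev c = lev e}" using C_finite[OF F(1)] by simp
  show "m \<in> B" "e \<in> fst (fund D (E - B) m)"
    using opposite_fund[OF basis eE] opt_E[OF e] by (auto simp: m)
  have "e \<in> {c \<in> supp (fund C B e). lev c = lev e}" using F(3) by (simp add: supp_def)
  then have "m \<in> {c \<in> supp (fund C B e). lev c = lev e}" unfolding m using Min_in[OF f] by blast
  then show "lev m = lev e" by simp
  show "m \<le> c" if "c \<in> supp (fund C B e)" "lev c = lev e" for c unfolding m using f that by simp
qed

text \<open>By the painting lemma only a circuit could prevent the cocircuit. At its top level, it
  agrees in all signs with the fundamental cocircuit of a suitable element, against orthogonality.\<close>

lemma positive_cover: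
  assumes x: "x \<in> E" and k: "0 < k" "k \<le> lev x"
  shows "\<exists>Y\<in>D. positive Y \<and> x \<in> supp Y \<and> (\<forall>y\<in>supp Y. k \<le> lev y)"
proof -
  define P where "P = {y \<in> E. k \<le> lev y}"
  \<comment> \<open>\<open>P\<close> is painted positive and the rest is left free to circuits, so
    the cocircuit alternative is the desired one.\<close>
  have "(\<exists>X\<in>C. x \<in> supp X \<and> supp X \<subseteq> P \<union> {} \<union> (E - P) \<and> fst X \<inter> {} = {} \<and> snd X \<inter> P = {}) \<or>
      (\<exists>Y\<in>D. x \<in> supp Y \<and> supp Y \<inter> (E - P) = {} \<and> fst Y \<inter> {} = {} \<and> snd Y \<inter> P = {})"
    by (rule signed_painting) (use x k in \<open>auto simp: P_def\<close>)
  moreover have False if X: "X \<in> C" "x \<in> supp X" "snd X \<inter> P = {}" for X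
  proof -
    define l where "l = Max (lev ` supp X)"
    define T where "T = {y \<in> supp X. lev y = l}"
    \<comment> \<open>The fundamental cocircuit of \<open>\<beta> y\<close> contains
      \<open>y\<close> positively. The least value \<open>b\<close> is used below, so that every
      \<open>y\<close> in \<open>T\<close> met by the fundamental cocircuit of \<open>b\<close> has
      \<open>\<beta> y = b\<close>.\<close>
    define \<beta> where "\<beta> y = (if y \<in> B then y else Min {c \<in> supp (fund C B y). lev c = l})" for y
    have fX: "finite (supp X)" using C_finite[OF X(1)] .
    have "l \<in> lev ` supp X" unfolding l_def using fX X(2) by (intro Max_in) auto
    then obtain t where t: "t \<in> T" by (auto simp: T_def)
    have lmax: "lev y \<le> l" if "y \<in> supp X" for y using that fX by (auto simp: l_def)
    have lk: "k \<le> l" using lmax[OF X(2)] k by simp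
    have TE: "y \<in> E" "lev y = l" "y \<notin> J" if "y \<in> T" for y
    proof -
      show y: "y \<in> E" "lev y = l" using that C_sub[OF X(1)] by (auto simp: T_def)
      show "y \<notin> J" using lev_J[of y] idx_pos[OF y(1)] y(2) lk k by auto
    qed
    have opt: "\<beta> y \<in> B" "lev (\<beta> y) = l" "y \<in> fst (fund D (E - B) (\<beta> y))"
      "\<And>c. c \<in> supp (fund C B y) \<Longrightarrow> lev c = l \<Longrightarrow> \<beta> y \<le> c" if y: "y \<in> T" "y \<notin> B" for y
      using level_min_fund[of y "\<beta> y"] TE[OF y(1)] y(2) by (auto simp: \<beta>_def)
    define b where "b = Min (\<beta> ` T)"
    have fT: "finite T" using fX by (simp add: T_def)
    have "b \<in> \<beta> ` T" unfolding b_def using fT t by (intro Min_in) auto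
    then obtain y0 where y0: "y0 \<in> T" "b = \<beta> y0" by blast
    have ble: "b \<le> \<beta> y" if "y \<in> T" for y using that fT by (simp add: b_def)
    have b: "b \<in> B" "lev b = l" using y0 opt[of y0] TE[of y0] by (cases "y0 \<in> B"; auto simp: \<beta>_def)+
    define Y where "Y = fund D (E - B) b"
    note Y = cofund_props[OF basis b(1), folded Y_def]
    \<comment> \<open>Levels in \<open>Y\<close> are at least \<open>l\<close> and levels in
      \<open>X\<close> at most \<open>l\<close>, so the two meet only inside
      \<open>T\<close>.\<close>
    have agree: "y \<in> fst Y \<and> y \<in> fst X" if y: "y \<in> supp X" "y \<in> supp Y" for y
    proof -
      have yT: "y \<in> T" using lev_mono[OF b(1), of y] lmax[OF y(1)] y b(2) by (auto simp: T_def Y_def)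
      have "y \<in> fst Y"
      proof (cases "y \<in> B")
        case True
        then show ?thesis using Y(3,4) y(2) by auto
      next
        case False
        have yE: "y \<in> E - B" using TE yT False by blast
        have "b \<in> supp (fund C B y)" using fund_cofund(3)[OF basis yE b(1)] y(2) by (simp add: Y_def)
        then have "\<beta> y \<le> b" using opt(4)[OF yT False] b(2) by blast
        then have "\<beta> y = b" using ble[OF yT] by simp
        then show ?thesis using opt(3)[OF yT False] by (simp add: Y_def)
      qed
      moreover have "y \<notin> snd X" using X(3) yT TE[OF yT] lk by (auto simp: P_def)
      ultimately show ?thesis using y(1) by (auto simp: supp_def)
    qed
    have "y0 \<in> supp Y"
      using y0 opt(3)[of y0] Y(3) by (cases "y0 \<in> B") (auto simp: Y_def \<beta>_def supp_def)
    moreover have "y0 \<in> supp X" using y0 by (simp add: T_def)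
    ultimately have "\<not> orthogonal X Y"
      using agree C_disj[OF X(1)] D_disj[OF Y(1)] by (intro not_orthogonal_agree[of y0]) auto
    then show False using orth[OF X(1) Y(1)] by blast
  qed
  ultimately obtain Y where Y: "Y \<in> D" "x \<in> supp Y" "supp Y \<inter> (E - P) = {}" "snd Y \<inter> P = {}" by blast
  have sub: "supp Y \<subseteq> P" using Y(3) D_sub[OF Y(1)] by blast
  then have "positive Y" using Y(4) by (auto simp: positive_def supp_def)
  then show ?thesis using Y(1,2) sub by (intro bexI[of _ Y]) (auto simp: P_def)
qed

text \<open>At a nonpositive level the dual of \<open>positive_cover\<close> gives a positive
  circuit through \<open>y\<close>, and a positive circuit and a positive cocircuit are
  disjoint.\<close>

lemma positive_cocircuit_levels:
  assumes Y: "Y \<in> D" "positive Y" and y: "y \<in> supp Y"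
  shows "0 < lev y"
proof (rule ccontr)
  interpret dual: levelled E D C "E - B" J I idx "\<lambda>x. - lev x" by (rule levelled_dual)
  assume "\<not> 0 < lev y"
  moreover have yE: "y \<in> E" using D_sub Y(1) y by blast
  ultimately have "0 < - lev y" using lev_nonzero[OF yE] by simp
  then obtain X where X: "X \<in> C" "positive X" "y \<in> supp X"
    using dual.positive_cover[OF yE, of "- lev y"] by auto
  then have "\<not> orthogonal X Y" using Y y by (intro not_orthogonal_agree[of y]) (auto simp: positive_def)
  then show False using orth X(1) Y(1) by blast
qed

text \<open>This mirrors \<open>positive_cover\<close>, at the lowest level of \<open>Y\<close>. If
  the root of that level were missing, \<open>Y\<close> would have only inactive elements there, and
  a fundamental circuit would meet \<open>Y\<close> without conflict.\<close>

lemma positive_cocircuit_min: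
  assumes Y: "Y \<in> D" "positive Y"
  shows "\<exists>a\<in>I. Min (supp Y) = a \<and> a \<in> supp Y \<and> (\<forall>y\<in>supp Y. lev a \<le> lev y)"
proof -
  interpret dual: levelled E D C "E - B" J I idx "\<lambda>x. - lev x" by (rule levelled_dual)
  have fY: "finite (supp Y)" "supp Y \<noteq> {}" using dual.C_finite D_ne Y by auto
  define l where "l = Min (lev ` supp Y)"
  have "l \<in> lev ` supp Y" unfolding l_def using fY by (intro Min_in) auto
  then obtain t where t: "t \<in> supp Y" "lev t = l" by auto
  have lmin: "l \<le> lev y" if "y \<in> supp Y" for y using that fY by (auto simp: l_def)
  have l0: "0 < l" using positive_cocircuit_levels[OF Y t(1)] t(2) by simp
  have tE: "t \<in> E" using D_sub Y t by blast
  obtain a where a: "a \<in> I" "lev a = l" using lev_pos_root[OF tE] l0 t(2) by auto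
  have "a \<in> supp Y"
  proof (rule ccontr)
    assume aY: "a \<notin> supp Y"
    define T where "T = {y \<in> supp Y. lev y = l}"
    \<comment> \<open>The fundamental circuit of \<open>\<gamma> y\<close> contains \<open>y\<close>
      positively. The least value \<open>e\<close> is used below, so that every \<open>y\<close> in
      \<open>T\<close> met by the fundamental circuit of \<open>e\<close> has
      \<open>\<gamma> y = e\<close>.\<close>
    define \<gamma> where "\<gamma> y = (if y \<notin> B then y else Min {c \<in> supp (fund D (E - B) y). lev c = l})" for y
    have TE: "y \<in> E" "lev y = l" "y \<notin> I" if "y \<in> T" for y
    proof -
      show y: "y \<in> E" "lev y = l" using that D_sub[OF Y(1)] by (auto simp: T_def)
      show "y \<notin> I" using lev_inj[of y a] a y(2) aY that by (auto simp: T_def)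
    qed
    have opt: "\<gamma> y \<in> E - B" "lev (\<gamma> y) = l" "y \<in> fst (fund C B (\<gamma> y))"
      "\<And>c. c \<in> supp (fund D (E - B) y) \<Longrightarrow> lev c = l \<Longrightarrow> \<gamma> y \<le> c" if y: "y \<in> T" "y \<in> B" for y
      using dual.level_min_fund[of y "\<gamma> y"] TE[OF y(1)] y(2) BE by (auto simp: \<gamma>_def double_diff)
    define e where "e = Min (\<gamma> ` T)"
    have fT: "finite T" "T \<noteq> {}" using fY t by (auto simp: T_def)
    have "e \<in> \<gamma> ` T" unfolding e_def using fT by (intro Min_in) auto
    then obtain y0 where y0: "y0 \<in> T" "e = \<gamma> y0" by blast
    have ele: "e \<le> \<gamma> y" if "y \<in> T" for y using that fT by (simp add: e_def)
    have e: "e \<in> E - B" "lev e = l" using y0 opt[of y0] TE[of y0] by (cases "y0 \<in> B"; auto simp: \<gamma>_def)+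
    define X where "X = fund C B e"
    note X = fund_props[OF basis e(1), folded X_def]
    have agree: "y \<in> fst X \<and> y \<in> fst Y" if y: "y \<in> supp X" "y \<in> supp Y" for y
    proof -
      have yT: "y \<in> T" using lev_mono'[OF e(1), of y] lmin[OF y(2)] y e(2) by (auto simp: T_def X_def)
      have "y \<in> fst X"
      proof (cases "y \<in> B")
        case False
        then show ?thesis using X(2,3) y(1) by auto
      next
        case True
        have "e \<in> supp (fund D (E - B) y)" using fund_cofund(3)[OF basis e(1) True] y(1) by (simp add: X_def)
        then have "\<gamma> y \<le> e" using opt(4)[OF yT True] e(2) by blast
        then have "\<gamma> y = e" using ele[OF yT] by simp
        then show ?thesis using opt(3)[OF yT True] by (simp add: X_def)
      qed
      then show ?thesis using y(2) Y(2) by (auto simp: supp_def positive_def)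
    qed
    have "y0 \<in> supp X"
      using y0 opt(3)[of y0] X(3) by (cases "y0 \<in> B") (auto simp: X_def \<gamma>_def supp_def)
    moreover have "y0 \<in> supp Y" using y0 by (simp add: T_def)
    ultimately have "\<not> orthogonal X Y"
      using agree C_disj[OF X(1)] D_disj[OF Y(1)] by (intro not_orthogonal_agree[of y0]) auto
    then show False using orth[OF X(1) Y(1)] by blast
  qed
  moreover have "a \<le> y" if y: "y \<in> supp Y" for y
  proof -
    have E: "y \<in> E" "a \<in> E" using D_sub[OF Y(1)] y a(1) IE by auto
    have "idx a \<le> idx y" using lmin[OF y] lev_bound[OF E(1)] a lev_I[OF a(1)] by simp
    then show ?thesis using idx_le_iff[OF E(2,1)] by simp
  qed
  ultimately have "Min (supp Y) = a" using fY by (intro Min_eqI) auto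
  then show ?thesis using a lmin \<open>a \<in> supp Y\<close> by blast
qed

lemma positive_minima: "{Min (supp Y) | Y. Y \<in> D \<and> positive Y} = I"
proof (intro set_eqI iffI)
  fix a assume a: "a \<in> I"
  then have aE: "a \<in> E" and l: "lev a = idx a" "0 < lev a" using IE lev_I idx_pos by auto
  obtain Y where Y: "Y \<in> D" "positive Y" "a \<in> supp Y" "\<forall>y\<in>supp Y. lev a \<le> lev y"
    using positive_cover[OF aE l(2)] by auto
  obtain a' where a': "a' \<in> I" "Min (supp Y) = a'" "a' \<in> supp Y" "\<forall>y\<in>supp Y. lev a' \<le> lev y"
    using positive_cocircuit_min[OF Y(1,2)] by blast
  have "lev a = lev a'" using Y(3,4) a'(3,4) by force
  then have "a = a'" using lev_inj a a'(1) by blast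
  then show "a \<in> {Min (supp Y) | Y. Y \<in> D \<and> positive Y}" using Y a'(2) by blast
qed (use positive_cocircuit_min in blast)

text \<open>The complement in \<open>E\<close>, which is \<open>below a - level a\<close>, is the
  set of the active filtration cut off at \<open>a\<close>.\<close>

lemma positive_union:
  assumes a: "a \<in> I"
  shows "\<Union>{supp Y | Y. Y \<in> D \<and> positive Y \<and> a \<le> Min (supp Y)} = {x \<in> E. lev a \<le> lev x}"
proof (intro set_eqI iffI)
  have aE: "a \<in> E" and l: "lev a = idx a" "0 < lev a" using a IE lev_I idx_pos by auto
  fix x assume "x \<in> {x \<in> E. lev a \<le> lev x}"
  then obtain Y where Y: "Y \<in> D" "positive Y" "x \<in> supp Y" "\<forall>y\<in>supp Y. lev a \<le> lev y"
    using positive_cover[of x "lev a"] l(2) by auto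
  obtain a' where a': "a' \<in> I" "Min (supp Y) = a'" "a' \<in> supp Y"
    using positive_cocircuit_min[OF Y(1,2)] by blast
  have "idx a \<le> idx a'" using Y(4) a'(1,3) lev_I l(1) by fastforce
  then have "a \<le> Min (supp Y)" using idx_le_iff[OF aE] a' IE by auto
  then show "x \<in> \<Union>{supp Y | Y. Y \<in> D \<and> positive Y \<and> a \<le> Min (supp Y)}" using Y by blast
next
  fix x assume "x \<in> \<Union>{supp Y | Y. Y \<in> D \<and> positive Y \<and> a \<le> Min (supp Y)}"
  then obtain Y where Y: "Y \<in> D" "positive Y" "x \<in> supp Y" "a \<le> Min (supp Y)" by blast
  obtain a' where a': "a' \<in> I" "Min (supp Y) = a'" "\<forall>y\<in>supp Y. lev a' \<le> lev y"
    using positive_cocircuit_min[OF Y(1,2)] by blast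
  have "idx a \<le> idx a'" using Y(4) a'(1,2) a IE idx_le_iff by auto
  then show "x \<in> {x \<in> E. lev a \<le> lev x}"
    using a' Y(3) D_sub[OF Y(1)] lev_I[OF a] lev_I[OF a'(1)] by force
qed

section \<open>Minors on single levels\<close>

lemma level_Min: "a \<in> I \<union> J \<Longrightarrow> Min (level a) = a"
  using level_min IE JE fin by (intro Min_eqI) (auto simp: level_def)

text \<open>Monotonicity of \<open>lev\<close> keeps fundamental circuits of elements of the level
  inside \<open>below a\<close> and fundamental cocircuits off the lower levels, so their traces
  belong to the minor.\<close>

lemma minor_fund:
  assumes a: "a \<in> I \<union> J"
  defines "C' \<equiv> minor_circuits C (below a) (level a)"
    and "D' \<equiv> minor_circuits D (E - (below a - level a)) (level a)"
  shows "om_pair (level a) C' D'" "pair_basis (level a) C' D' (B \<inter> level a)"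
    "\<And>e. e \<in> level a - B \<Longrightarrow> fund C' (B \<inter> level a) e = restr (level a) (fund C B e)"
    "\<And>b. b \<in> B \<inter> level a \<Longrightarrow> fund D' (level a - B) b = restr (level a) (fund D (E - B) b)"
proof -
  have sub: "level a \<subseteq> below a" "below a \<subseteq> E" by (auto simp: level_def below_def)
  show pair: "om_pair (level a) C' D'"
    unfolding C'_def D'_def by (rule om_pair_minor[OF om_pair_axioms sub])
  interpret minor: om_pair "level a" C' D' by (rule pair)
  interpret minor': om_pair "level a" D' C' by (rule minor.dual_pair)
  have C'mem: "restr (level a) (fund C B e) \<in> C'" if e: "e \<in> level a - B" for e
  proof -
    have eE: "e \<in> E - B" using e sub by blast
    note F = fund_props[OF basis eE]
    have "lev e = lev a" using e by (simp add: level_def)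
    then have "supp (fund C B e) \<subseteq> below a"
      using lev_mono'[OF eE] C_sub[OF F(1)] by (auto simp: below_def)
    moreover have "e \<in> supp (fund C B e)" using F(3) by (simp add: supp_def)
    ultimately show ?thesis using F(1) e unfolding C'_def minor_circuits_def by blast
  qed
  have D'mem: "restr (level a) (fund D (E - B) b) \<in> D'" if b: "b \<in> B \<inter> level a" for b
  proof -
    have bB: "b \<in> B" using b by blast
    note F = cofund_props[OF basis bB]
    have "lev b = lev a" using b by (simp add: level_def)
    then have "supp (fund D (E - B) b) \<subseteq> E - (below a - level a)"
      using lev_mono[OF bB] D_sub[OF F(1)] by (fastforce simp: below_def level_def)
    moreover have "b \<in> supp (fund D (E - B) b)" using F(3) by (simp add: supp_def)
    ultimately show ?thesis using F(1) b unfolding D'_def minor_circuits_def by blast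
  qed
  show pb: "pair_basis (level a) C' D' (B \<inter> level a)"
    unfolding pair_basis_def
  proof (intro conjI ballI notI)
    fix X assume X: "X \<in> C'" "supp X \<subseteq> B \<inter> level a"
    then obtain b where b: "b \<in> supp X" "b \<in> B \<inter> level a" using minor.C_ne by blast
    note F = cofund_props[OF basis, of b]
    have "supp X \<inter> supp (restr (level a) (fund D (E - B) b)) = {b}"
      using X(2) b F(4) by auto
    then show False using minor.single[OF X(1) D'mem[OF b(2)]] by blast
  next
    fix Y assume Y: "Y \<in> D'" "supp Y \<inter> (B \<inter> level a) = {}"
    then obtain e where e: "e \<in> supp Y" "e \<in> level a - B" using minor.D_ne minor.D_sub by blast
    have eE: "e \<in> E - B" using e sub by blast
    note F = fund_props[OF basis eE]
    have "supp (restr (level a) (fund C B e)) \<inter> supp Y = {e}"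
      using Y(2) e F(2,3) by (auto simp: in_supp_iff)
    then show False using minor.single[OF C'mem[OF e(2)] Y(1)] by blast
  qed blast
  show "fund C' (B \<inter> level a) e = restr (level a) (fund C B e)" if e: "e \<in> level a - B" for e
  proof (rule minor.fund_eqI[OF pb])
    have eE: "e \<in> E - B" using e sub by blast
    show "supp (restr (level a) (fund C B e)) \<subseteq> insert e (B \<inter> level a)"
      "e \<in> fst (restr (level a) (fund C B e))"
      using fund_props[OF basis eE] e by auto
  qed (use C'mem e in auto)
  show "fund D' (level a - B) b = restr (level a) (fund D (E - B) b)" if b: "b \<in> B \<inter> level a" for b
  proof -
    have eq: "level a - B \<inter> level a = level a - B" by blast
    have "fund D' (level a - B \<inter> level a) b = restr (level a) (fund D (E - B) b)"
    proof (rule minor'.fund_eqI[OF minor.pair_basis_dual[OF pb]])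
      show "supp (restr (level a) (fund D (E - B) b)) \<subseteq> insert b (level a - B \<inter> level a)"
        "b \<in> fst (restr (level a) (fund D (E - B) b))"
        using cofund_props[OF basis, of b] b by auto
    qed (use D'mem b in auto)
    then show ?thesis by (simp add: eq)
  qed
qed

text \<open>Taking the trace on its level turns the level-wise minimum of a fundamental circuit or
  cocircuit into its minimum in the minor.\<close>

lemma minor_optimal:
  assumes a: "a \<in> I"
  shows "fully_optimal (level a) (minor_circuits C (below a) (level a))
    (minor_circuits D (E - (below a - level a)) (level a)) (B \<inter> level a)"
proof -
  have a': "a \<in> I \<union> J" using a by blast
  note minor = minor_fund[OF a']
  have eq: "level a - B \<inter> level a = level a - B" by blast
  have o: "opposite_signs (restr (level a) X) x (Min (supp (restr (level a) X)))"
    if X: "opposite_signs X x (Min {c \<in> supp X. lev c = lev x})" and x: "x \<in> level a" "x \<in> supp X"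
      and XE: "supp X \<subseteq> E" for X x
  proof -
    have s: "{c \<in> supp X. lev c = lev x} = supp X \<inter> level a"
      using x XE by (auto simp: level_def)
    have "finite (supp X \<inter> level a)" using fin XE finite_subset by blast
    then have "Min (supp X \<inter> level a) \<in> supp X \<inter> level a" using x by (intro Min_in) auto
    then show ?thesis using X x s by (auto simp: opposite_signs_def)
  qed
  show ?thesis
    unfolding fully_optimal_def eq level_Min[OF a']
  proof (intro conjI ballI)
    fix b assume b: "b \<in> B \<inter> level a - {a}"
    then have b': "b \<in> B \<inter> level a" "b \<in> B" by auto
    have "b \<notin> I" using lev_inj[of b a] a b by (auto simp: level_def)
    then have "opposite_signs (fund D (E - B) b) b (Min {c \<in> supp (fund D (E - B) b). lev c = lev b})"
      using opt_B b' by blast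
    moreover have "b \<in> supp (fund D (E - B) b)" "supp (fund D (E - B) b) \<subseteq> E"
      using cofund_props[OF basis b'(2)] D_sub by (auto simp: in_supp_iff)
    ultimately show "opposite_signs (fund (minor_circuits D (E - (below a - level a)) (level a)) (level a - B) b) b
        (Min (supp (fund (minor_circuits D (E - (below a - level a)) (level a)) (level a - B) b)))"
      unfolding minor(4)[OF b'(1)] using b' by (intro o) auto
  next
    fix e assume e: "e \<in> level a - B"
    then have e': "e \<in> level a - B" "e \<in> E - B" by (auto simp: level_def)
    have "lev e > 0" using e' a lev_I[OF a] idx_pos[of a] IE by (auto simp: level_def)
    then have "e \<notin> J" using lev_J[of e] idx_pos[of e] e' by auto
    then have "opposite_signs (fund C B e) e (Min {c \<in> supp (fund C B e). lev c = lev e})"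
      using opt_E e' by blast
    moreover have "e \<in> supp (fund C B e)" "supp (fund C B e) \<subseteq> E"
      using fund_props[OF basis e'(2)] C_sub by (auto simp: in_supp_iff)
    ultimately show "opposite_signs (fund (minor_circuits C (below a) (level a)) (B \<inter> level a) e) e
        (Min (supp (fund (minor_circuits C (below a) (level a)) (B \<inter> level a) e)))"
      unfolding minor(3)[OF e'(1)] using e' by (intro o) auto
  qed (rule minor(2))
qed

end


section \<open>The active basis of an oriented matroid with a level function\<close>

text \<open>The last assumption gives \<open>dual (dual N) = N\<close>, which closes the locale
  under duality.\<close>

locale levelled_om = levelled E C D B I J idx lev for E :: "'a::linorder set" and C D B I J idx lev +
  fixes N :: "'a omatroid"
  assumes N: "ground N = E" "circuits N = C" "cocircuits N = D" "cocircuits (dual N) = C"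
begin

lemma dual_levelled_om: "levelled_om E D C (E - B) J I idx (\<lambda>x. - lev x) (dual N)"
proof -
  interpret dual: levelled E D C "E - B" J I idx "\<lambda>x. - lev x" by (rule levelled_dual)
  have dd: "dual (dual N) = N" using N by (simp add: dual_def)
  show ?thesis
  proof
    show "ground (dual N) = E" "circuits (dual N) = D" by (simp_all add: dual_def N)
    show "cocircuits (dual N) = C" "cocircuits (dual (dual N)) = D" by (simp_all only: N dd)
  qed
qed

lemma O_star_eq: "O_star N = I"
  using positive_minima by (simp add: O_star_def N)

lemma finite_I: "finite I" and finite_J: "finite J"
  using IE JE fin finite_subset by blast+

lemma nth_I: "j < card I \<Longrightarrow> sorted_list_of_set I ! j \<in> I"
  using nth_mem[of j "sorted_list_of_set I"] finite_I by simp

lemma filt_less: "k < card I \<Longrightarrow> filt N k = {x \<in> E. lev x < lev (sorted_list_of_set I ! k)}"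
  using positive_union[OF nth_I[of k]] by (auto simp: filt_def O_star_eq N not_le)

text \<open>Every positive level has a root in \<open>I\<close>, so no level lies strictly between
  those of consecutive elements of \<open>I\<close>, and none above the last. List entry
  \<open>k\<close> belongs to filtration index \<open>Suc k\<close>.\<close>

lemma filt_le:
  assumes k: "k < card I"
  shows "filt N (Suc k) = below (sorted_list_of_set I ! k)"
proof -
  let ?s = "sorted_list_of_set I"
  have mono: "?s ! i \<le> ?s ! j" if "i \<le> j" "j < card I" for i j
    using that sorted_nth_mono[OF sorted_sorted_list_of_set, of i j I] finite_I by simp
  have lev_s: "lev (?s ! i) \<le> lev (?s ! j) \<longleftrightarrow> ?s ! i \<le> ?s ! j" if "i < card I" "j < card I" for i j
    using idx_le_iff[of "?s ! i" "?s ! j"] nth_I[OF that(1)] nth_I[OF that(2)] IE lev_I by auto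
  have root: "\<exists>i<card I. lev x = lev (?s ! i)" if x: "x \<in> E" "0 < lev x" for x
  proof -
    obtain a where a: "a \<in> I" "lev a = lev x" using lev_pos_root[OF x] by blast
    then have "a \<in> set ?s" using finite_I by simp
    then show ?thesis using a by (auto simp: in_set_conv_nth)
  qed
  have pos: "0 < lev (?s ! i)" if "i < card I" for i
    using lev_I[OF nth_I[OF that]] idx_pos[of "?s ! i"] nth_I[OF that] IE by auto
  show ?thesis
  proof (cases "Suc k < card I")
    case True
    have "lev x < lev (?s ! Suc k) \<longleftrightarrow> lev x \<le> lev (?s ! k)" if x: "x \<in> E" for x
    proof (cases "0 < lev x")
      case False
      then show ?thesis using pos[OF k] pos[OF True] by simp
    next
      case xp: True
      then obtain i where i: "i < card I" "lev x = lev (?s ! i)" using root x by blast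
      have dist: "?s ! i = ?s ! j \<longleftrightarrow> i = j" if "j < card I" for j
        using nth_eq_iff_index_eq[of ?s i j] i(1) that finite_I by simp
      have "lev (?s ! i) < lev (?s ! Suc k) \<longleftrightarrow> i < Suc k"
        using lev_s[OF True i(1)] mono[of i "Suc k"] mono[of "Suc k" i] True i(1) dist[OF True]
        by (metis antisym less_imp_le not_less order_refl)
      moreover have "lev (?s ! i) \<le> lev (?s ! k) \<longleftrightarrow> i \<le> k"
        using lev_s[OF i(1) k] mono[of i k] mono[of k i] k i(1) dist[OF k]
        by (metis antisym le_cases)
      ultimately show ?thesis using i by auto
    qed
    then show ?thesis using filt_less[OF True] by (auto simp: below_def)
  next
    case False
    then have kc: "Suc k = card I" using k by simp
    have "lev x \<le> lev (?s ! k)" if x: "x \<in> E" for x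
    proof (cases "0 < lev x")
      case True
      then obtain i where i: "i < card I" "lev x = lev (?s ! i)" using root x by blast
      then show ?thesis using lev_s[OF i(1) k] mono[of i k] kc k by simp
    next
      case False
      then show ?thesis using pos[OF k] by simp
    qed
    then show ?thesis using kc by (auto simp: filt_def O_star_eq N below_def)
  qed
qed

lemma indices_I: "(\<lambda>k. sorted_list_of_set I ! (k - 1)) ` {1..card I} = I"
proof -
  have "{1..card I} = Suc ` {..<card I}" by (simp add: image_Suc_lessThan)
  then have "(\<lambda>k. sorted_list_of_set I ! (k - 1)) ` {1..card I} =
      (\<lambda>k. sorted_list_of_set I ! k) ` {..<length (sorted_list_of_set I)}"
    using finite_I by (simp add: image_image)
  also have "\<dots> = set (sorted_list_of_set I)" by (metis atLeast0LessThan list.set_map map_nth set_upt)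
  finally show ?thesis using finite_I by simp
qed

text \<open>The function \<open>f\<close> is set difference for the active partition, and the active
  basis of a minor for \<open>alpha\<close>.\<close>

lemma filt_image:
  "(\<lambda>k. f (filt N k) (filt N (k - 1))) ` {1..card (O_star N)} = (\<lambda>a. f (below a) (below a - level a)) ` I"
proof -
  have "f (filt N k) (filt N (k - 1)) =
      f (below (sorted_list_of_set I ! (k - 1))) (below (sorted_list_of_set I ! (k - 1)) - level (sorted_list_of_set I ! (k - 1)))"
    if k: "k \<in> {1..card I}" for k
  proof -
    have k': "k - 1 < card I" "Suc (k - 1) = k" using k by auto
    have "{x \<in> E. lev x < lev a} = below a - level a" for a by (auto simp: below_def level_def)
    then show ?thesis using filt_less[OF k'(1)] filt_le[OF k'(1)] k'(2) by simp
  qed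
  then have "(\<lambda>k. f (filt N k) (filt N (k - 1))) ` {1..card I} =
      (\<lambda>a. f (below a) (below a - level a)) ` (\<lambda>k. sorted_list_of_set I ! (k - 1)) ` {1..card I}"
    unfolding image_image by (intro image_cong) auto
  then show ?thesis by (simp only: indices_I O_star_eq)
qed

lemma O_act_eq: "O_act N = J" and O_star_dual: "O_star (dual N) = J"
  and filt_cyc_eq: "filt_cyc N k = E - filt (dual N) k"
proof -
  interpret dual: levelled_om E D C "E - B" J I idx "\<lambda>x. - lev x" "dual N" by (rule dual_levelled_om)
  show J: "O_act N = J" "O_star (dual N) = J"
    using dual.positive_minima dual.O_star_eq by (simp_all add: O_act_def N)
  show "filt_cyc N k = E - filt (dual N) k"
  proof -
    define U where "U = \<Union>{supp X | X. X \<in> C \<and> positive X \<and> sorted_list_of_set J ! k \<le> Min (supp X)}"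
    have "ground (dual N) = E" by (simp add: dual_def N)
    then have "filt (dual N) k = (if k < card J then E - U else E)"
      by (simp add: filt_def J N U_def)
    moreover have "filt_cyc N k = (if k < card J then U else {})"
      by (simp add: filt_cyc_def J N U_def)
    moreover have "U \<subseteq> E" using C_sub unfolding U_def by blast
    ultimately show ?thesis by auto
  qed
qed

lemma filt_cyc_image:
  "(\<lambda>k. f (filt_cyc N (k - 1)) (filt_cyc N k)) ` {1..card (O_act N)} = (\<lambda>a. f (below a) (below a - level a)) ` J"
proof -
  interpret dual: levelled_om E D C "E - B" J I idx "\<lambda>x. - lev x" "dual N" by (rule dual_levelled_om)
  \<comment> \<open>Negating levels turns sublevel sets into superlevel sets, whose complements are
    sublevel sets again; hence the two arguments of \<open>f\<close> are complemented and
    exchanged.\<close>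
  have "E - dual.below a = below a - level a" "E - (dual.below a - dual.level a) = below a" for a
    by (auto simp: dual.below_def dual.level_def below_def level_def)
  then show ?thesis
    using dual.filt_image[of "\<lambda>X Y. f (E - Y) (E - X)"] by (simp add: O_act_eq O_star_dual filt_cyc_eq)
qed

lemma active_partition_eq: "active_partition N = level ` (I \<union> J)"
proof -
  have "below a - (below a - level a) = level a" for a by (auto simp: below_def level_def)
  then show ?thesis
    using filt_image[of "\<lambda>X Y. X - Y"] filt_cyc_image[of "\<lambda>X Y. X - Y"]
    by (simp add: active_partition_def image_Un)
qed

lemma active_part_eq: "a \<in> I \<union> J \<Longrightarrow> active_part N a = level a"
  unfolding active_part_def active_partition_eq using level_Min by (intro the_equality) auto

lemma alpha_minor:
  assumes a: "a \<in> I \<union> J"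
  defines "K \<equiv> contraction (restriction N (below a)) (below a - level a)"
  shows "a \<in> I \<Longrightarrow> alpha_bounded K = B \<inter> level a" "a \<in> J \<Longrightarrow> alpha_dual_bounded K = B \<inter> level a"
proof -
  have sub: "level a \<subseteq> below a" "below a \<subseteq> E" by (auto simp: below_def level_def)
  have eq: "below a - (below a - level a) = level a" using sub by blast
  define C' where "C' = minor_circuits C (below a) (level a)"
  define D' where "D' = minor_circuits D (E - (below a - level a)) (level a)"
  have "om_rep (below a - (below a - level a)) (minor_circuits (circuits N) (below a) (below a - (below a - level a)))
    (minor_circuits D (E - (below a - level a)) (below a - (below a - level a))) K"
    unfolding K_def using om_pair_axioms sub by (intro om_rep_minor) (auto simp: N)
  then interpret K: om_rep "level a" C' D' K
    unfolding eq N C'_def D'_def .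
  show "alpha_bounded K = B \<inter> level a" if "a \<in> I"
    using minor_optimal[OF that] alpha_bounded_eq[OF K.om_rep_axioms] by (simp add: C'_def D'_def)
  show "alpha_dual_bounded K = B \<inter> level a" if aJ: "a \<in> J"
  proof -
    interpret dual: levelled_om E D C "E - B" J I idx "\<lambda>x. - lev x" "dual N" by (rule dual_levelled_om)
    have e: "dual.level a = level a" "dual.below a = E - (below a - level a)"
      "E - (E - (below a - level a) - level a) = below a"
      by (auto simp: dual.below_def dual.level_def below_def level_def)
    have "fully_optimal (level a) D' C' ((E - B) \<inter> level a)"
      using dual.minor_optimal[OF aJ] by (simp add: e C'_def D'_def)
    then have "alpha_bounded (dual K) = (E - B) \<inter> level a"
      using alpha_bounded_eq[OF K.dual_rep] by blast
    then show ?thesis using sub by (auto simp: alpha_dual_bounded_def K.ground_K)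
  qed
qed

lemma alpha_eq: "alpha N = B"
proof -
  have "alpha N = (\<Union>a\<in>I. B \<inter> level a) \<union> (\<Union>a\<in>J. B \<inter> level a)"
    unfolding alpha_def
    using filt_image[of "\<lambda>X Y. alpha_bounded (contraction (restriction N X) Y)"]
      filt_cyc_image[of "\<lambda>X Y. alpha_dual_bounded (contraction (restriction N X) Y)"] alpha_minor
    by simp
  also have "\<dots> = B \<inter> (\<Union>a\<in>I \<union> J. level a)" by auto
  also have "\<dots> = B"
  proof -
    have "x \<in> (\<Union>a\<in>I \<union> J. level a)" if x: "x \<in> E" for x
    proof -
      obtain a where "a \<in> I \<union> J" "lev a = lev x" using lev_root[OF x] by blast
      then show ?thesis using x by (intro UN_I[of a]) (auto simp: level_def)
    qed
    then show ?thesis using BE by (intro Int_absorb2) (meson subset_iff)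
  qed
  finally show ?thesis .
qed

end

section \<open>Construction of level functions and of reorientations\<close>

text \<open>The ambient linear order may fail to be well-founded, so the recursion runs over the
  finite set \<open>E\<close> only.\<close>

lemma finite_linorder_recursion:
  fixes E :: "'a::linorder set" and H :: "('a \<Rightarrow> 'b) \<Rightarrow> 'a \<Rightarrow> 'b"
  assumes "finite E"
    and "\<And>f g x. x \<in> E \<Longrightarrow> (\<And>y. y \<in> E \<Longrightarrow> y < x \<Longrightarrow> f y = g y) \<Longrightarrow> H f x = H g x"
  shows "\<exists>f. \<forall>x\<in>E. f x = H f x"
  using assms
proof (induction E rule: finite_linorder_max_induct)
  case empty
  then show ?case by simp
next
  case (insert b A)
  have "\<exists>f. \<forall>x\<in>A. f x = H f x"
  proof (rule insert.IH)
    fix f g :: "'a \<Rightarrow> 'b" and x assume "x \<in> A" "\<And>y. y \<in> A \<Longrightarrow> y < x \<Longrightarrow> f y = g y"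
    moreover have "\<not> b < x" using insert.hyps(2) \<open>x \<in> A\<close> by fastforce
    ultimately show "H f x = H g x" by (intro insert.prems) auto
  qed
  then obtain f where f: "\<forall>x\<in>A. f x = H f x" ..
  have upd: "H (f(b := H f b)) x = H f x" if "x \<in> insert b A" for x
    using that insert.hyps(2) by (intro insert.prems) fastforce+
  show ?case
  proof (intro exI ballI)
    fix x assume x: "x \<in> insert b A"
    have "b \<notin> A" using insert.hyps(2) by fastforce
    then show "(f(b := H f b)) x = H (f(b := H f b)) x"
      using f x upd[OF x] by (cases "x = b") auto
  qed
qed

text \<open>The count includes \<open>x\<close> itself, so indices start at 1 and zero separates the
  levels of \<open>I\<close> from those of \<open>J\<close>.\<close>

lemma finite_linorder_index:
  fixes E :: "'a::linorder set"
  assumes fin: "finite E"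
  obtains idx :: "'a \<Rightarrow> int" where "\<And>x. x \<in> E \<Longrightarrow> 0 < idx x"
    "\<And>x y. x \<in> E \<Longrightarrow> y \<in> E \<Longrightarrow> x < y \<Longrightarrow> idx x < idx y"
proof
  fix x assume x: "x \<in> E"
  then show "0 < int (card {z \<in> E. z \<le> x})" using fin by (auto simp: card_gt_0_iff)
  fix y assume "y \<in> E" "x < y"
  then have "y \<in> {z \<in> E. z \<le> y}" "y \<notin> {z \<in> E. z \<le> x}" "{z \<in> E. z \<le> x} \<subseteq> {z \<in> E. z \<le> y}" by auto
  then have "{z \<in> E. z \<le> x} \<subset> {z \<in> E. z \<le> y}" by blast
  then show "int (card {z \<in> E. z \<le> x}) < int (card {z \<in> E. z \<le> y})"
    using fin by (simp add: psubset_card_mono)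
qed

text \<open>If \<open>e\<close> lies in the fundamental cocircuit of \<open>b\<close>, the
  inequality \<open>lev b \<le> lev e\<close> is arranged at the larger of the two: by a minimum if
  it is \<open>b\<close>, by a maximum if it is \<open>e\<close>. Both extrema are attained, which
  yields a smaller element of equal level.\<close>

lemma (in ordered_om_pair) level_function_exists:
  assumes B: "pair_basis E C D B"
  defines "I \<equiv> {b \<in> B. b = Min (supp (fund D (E - B) b))}"
    and "J \<equiv> {e \<in> E - B. e = Min (supp (fund C B e))}"
  shows "\<exists>idx lev. level_function E C D B I J idx lev"
proof -
  interpret dual: ordered_om_pair E D C by (simp add: ordered_om_pair_def dual_pair)
  obtain idx :: "'a \<Rightarrow> int" where pos: "\<And>x. x \<in> E \<Longrightarrow> 0 < idx x"
    and mono: "\<And>x y. x \<in> E \<Longrightarrow> y \<in> E \<Longrightarrow> x < y \<Longrightarrow> idx x < idx y"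
    using finite_linorder_index[OF fin] by blast
  define lo where "lo x = {c \<in> supp (if x \<in> B then fund D (E - B) x else fund C B x). c < x}" for x
  define H where "H f x = (if x \<in> I then idx x else if x \<in> J then - idx x else
    if x \<in> B then Min (f ` lo x) else Max (f ` lo x))" for f x
  have BE: "B \<subseteq> E" using B by (simp add: pair_basis_def)
  have sub: "supp (fund D (E - B) x) \<subseteq> E" if "x \<in> B" for x
    using cofund_props(1)[OF B that] D_sub by blast
  have sub': "supp (fund C B x) \<subseteq> E" if "x \<in> E - B" for x
    using fund_props(1)[OF B that] C_sub by blast
  have loE: "lo x \<subseteq> {y \<in> E. y < x}" if "x \<in> E" for x
    using that sub sub' by (auto simp: lo_def)
  have "\<exists>f. \<forall>x\<in>E. f x = H f x"
  proof (rule finite_linorder_recursion[OF fin])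
    fix f g :: "'a \<Rightarrow> int" and x assume x: "x \<in> E" and eq: "\<And>y. y \<in> E \<Longrightarrow> y < x \<Longrightarrow> f y = g y"
    have "f ` lo x = g ` lo x" using loE[OF x] eq by (intro image_cong) auto
    then show "H f x = H g x" by (simp add: H_def)
  qed
  then obtain lev where lev: "\<And>x. x \<in> E \<Longrightarrow> lev x = H lev x" by blast
  have fin_lo: "finite (lo x)" if "x \<in> E" for x using loE[OF that] fin by (simp add: finite_subset)
  have lo_ne: "lo x \<noteq> {}" if x: "x \<in> E" "x \<notin> I" "x \<notin> J" for x
  proof (cases "x \<in> B")
    case True
    note F = cofund_props[OF B True]
    have "Min (supp (fund D (E - B) x)) \<in> lo x"
      using dual.Min_supp[OF F(1)] F(3) x True by (auto simp: lo_def I_def supp_def less_le)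
    then show ?thesis by blast
  next
    case False
    then have xE: "x \<in> E - B" using x by blast
    note F = fund_props[OF B xE]
    have "Min (supp (fund C B x)) \<in> lo x"
      using Min_supp[OF F(1)] F(3) x xE by (auto simp: lo_def J_def supp_def less_le)
    then show ?thesis by blast
  qed
  have low: "\<exists>c\<in>lo x. lev c = lev x" if x: "x \<in> E" "x \<notin> I" "x \<notin> J" for x
  proof -
    have "finite (lev ` lo x)" "lev ` lo x \<noteq> {}" using fin_lo lo_ne x by auto
    then have "Min (lev ` lo x) \<in> lev ` lo x" "Max (lev ` lo x) \<in> lev ` lo x" by (rule Min_in Max_in; assumption)+
    moreover have "lev x = (if x \<in> B then Min (lev ` lo x) else Max (lev ` lo x))"
      using lev[OF x(1)] x by (simp add: H_def)
    ultimately have "lev x \<in> lev ` lo x" by simp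
    then show ?thesis by force
  qed
  have IJ: "I \<subseteq> B" "J \<subseteq> E - B" by (auto simp: I_def J_def)
  have levI: "lev a = idx a" if "a \<in> I" for a using lev[of a] that IJ BE by (auto simp: H_def)
  have levJ: "lev a = - idx a" if a: "a \<in> J" for a
  proof -
    have "a \<in> E" "a \<notin> I" using a IJ by auto
    then show ?thesis using lev[of a] a by (simp add: H_def)
  qed
  have root: "\<bar>lev x\<bar> \<le> idx x \<and> (\<exists>a\<in>I \<union> J. lev a = lev x)" if "x \<in> E" for x
    using that
  proof (induction "nat (idx x)" arbitrary: x rule: less_induct)
    case less
    show ?case
    proof (cases "x \<in> I \<union> J")
      case True
      then show ?thesis using levI levJ pos[OF less.prems] by auto
    next
      case False
      then obtain c where c: "c \<in> lo x" "lev c = lev x" using low[OF less.prems] by blast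
      then have c': "c \<in> E" "c < x" using loE[OF less.prems] by auto
      have i: "idx c < idx x" using mono c' less.prems by blast
      then have "nat (idx c) < nat (idx x)" using pos[OF less.prems] by simp
      from less.hyps[OF this c'(1)] show ?thesis using i c(2) by auto
    qed
  qed
  have "level_function E C D B I J idx lev"
  proof
    fix b e assume b: "b \<in> B" and e: "e \<in> supp (fund D (E - B) b)"
    have bE: "b \<in> E" using b BE by blast
    note F = cofund_props[OF B b]
    consider "e = b" | "e < b" | "b < e" by fastforce
    then show "lev b \<le> lev e"
    proof cases
      case 2
      have "Min (supp (fund D (E - B) b)) \<le> e" using dual.Min_supp(2)[OF F(1) e] .
      then have "b \<notin> I" using 2 by (auto simp: I_def)
      moreover have "b \<notin> J" using b by (auto simp: J_def)
      ultimately have "lev b = Min (lev ` lo b)" using lev[OF bE] b by (simp add: H_def)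
      then show ?thesis using fin_lo[OF bE] e b 2 by (auto simp: lo_def)
    next
      case 3
      have eE: "e \<in> E - B" using F(2) e 3 by auto
      have be: "b \<in> supp (fund C B e)" using fund_cofund(3)[OF B eE b] e by simp
      have "Min (supp (fund C B e)) \<le> b" using Min_supp(2)[OF fund_props(1)[OF B eE] be] .
      then have "e \<notin> J" using 3 by (auto simp: J_def)
      moreover have "e \<notin> I" using eE by (auto simp: I_def)
      ultimately have "lev e = Max (lev ` lo e)" using lev[of e] eE by (simp add: H_def)
      then show ?thesis using fin_lo[of e] be eE 3 by (auto simp: lo_def)
    qed simp
  next
    show "\<exists>c\<in>supp (fund D (E - B) b). c < b \<and> lev c = lev b" if b: "b \<in> B - I" for b
      using low[of b] b BE by (auto simp: lo_def J_def)
    show "\<exists>c\<in>supp (fund C B e). c < e \<and> lev c = lev e" if e: "e \<in> E - B - J" for e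
      using low[of e] e by (auto simp: lo_def I_def)
  qed (use B pos mono levI levJ root IJ in auto)
  then show ?thesis by blast
qed

context level_function
begin

definition fund_of :: "'a \<Rightarrow> 'a sset" where
  "fund_of x = (if x \<in> B then fund D (E - B) x else fund C B x)"

definition prev :: "'a \<Rightarrow> 'a" where
  "prev x = Min {c \<in> supp (fund_of x). lev c = lev x}"

text \<open>The condition that the reorientation of \<open>A\<close> is optimal with respect to the levels. It determines
  the membership of the inactive elements in \<open>A\<close> in increasing order.\<close>

definition compat :: "'a set \<Rightarrow> bool" where
  "compat A \<longleftrightarrow> (\<forall>x\<in>E - (I \<union> J). opposite_signs (fund_of x) x (prev x) \<longleftrightarrow> (x \<in> A \<longleftrightarrow> prev x \<in> A))"

lemma fund_of: "x \<in> E \<Longrightarrow> x \<in> supp (fund_of x) \<and> supp (fund_of x) \<subseteq> E \<and> fst (fund_of x) \<inter> snd (fund_of x) = {}"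
  using fund_props[OF basis, of x] cofund_props[OF basis, of x] C_sub D_sub C_disj D_disj
  by (auto simp: fund_of_def in_supp_iff)

lemma prev:
  assumes x: "x \<in> E - (I \<union> J)"
  shows "prev x \<in> supp (fund_of x)" "prev x \<in> E" "prev x < x" "lev (prev x) = lev x"
proof -
  have "\<exists>c\<in>supp (fund_of x). c < x \<and> lev c = lev x"
    using x lower_B[of x] lower_E[of x] by (auto simp: fund_of_def)
  then obtain c where c: "c \<in> {c \<in> supp (fund_of x). lev c = lev x}" "c < x" by blast
  have f: "finite {c \<in> supp (fund_of x). lev c = lev x}"
    using fund_of[of x] x fin by (auto intro: finite_subset)
  then have "prev x \<in> {c \<in> supp (fund_of x). lev c = lev x}"
    unfolding prev_def using c by (intro Min_in) auto
  then show "prev x \<in> supp (fund_of x)" "lev (prev x) = lev x" "prev x \<in> E" using fund_of[of x] x by auto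
  have "prev x \<le> c" unfolding prev_def using f c by (intro Min_le) auto
  then show "prev x < x" using c(2) by simp
qed

text \<open>Supports are unchanged, so the same levels serve. \<open>compat\<close> describes when
  \<open>reo A\<close> makes the signs of \<open>x\<close> and \<open>prev x\<close> opposite, and a
  global negation does not affect this.\<close>

lemma compat_levelled:
  assumes A: "compat A"
  shows "levelled E (reo A ` C) (reo A ` D) B I J idx lev"
proof -
  interpret dual: om_pair E D C by (rule dual_pair)
  interpret R: om_pair E "reo A ` C" "reo A ` D" by (rule om_pair_reo[OF om_pair_axioms])
  have c: "fund (reo A ` C) B e = (if e \<in> A then opp (reo A (fund_of e)) else reo A (fund_of e))"
    if "e \<in> E - B" for e
    using fund_reo[OF basis that] that by (simp add: fund_of_def)
  have d: "fund (reo A ` D) (E - B) b = (if b \<in> A then opp (reo A (fund_of b)) else reo A (fund_of b))"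
    if b: "b \<in> B" for b
  proof -
    have "b \<in> E - (E - B)" using b BE by blast
    from dual.fund_reo[OF pair_basis_dual[OF basis] this] show ?thesis using b by (simp add: fund_of_def)
  qed
  have sc: "supp (fund (reo A ` C) B e) = supp (fund C B e)" if "e \<in> E - B" for e
    using c[OF that] that by (auto simp: fund_of_def)
  have sd: "supp (fund (reo A ` D) (E - B) b) = supp (fund D (E - B) b)" if "b \<in> B" for b
    using d[OF that] that by (auto simp: fund_of_def)
  have o: "opposite_signs (reo A (fund_of x)) x (prev x)" if x: "x \<in> E - (I \<union> J)" for x
    using opposite_signs_reo[of "fund_of x" x "prev x" A] fund_of[of x] prev(1)[OF x] x A
    by (auto simp: compat_def)
  show ?thesis
  proof
    show "pair_basis E (reo A ` C) (reo A ` D) B" using basis by (simp add: pair_basis_reo)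
    show "opposite_signs (fund (reo A ` D) (E - B) b) b
        (Min {c \<in> supp (fund (reo A ` D) (E - B) b). lev c = lev b})" if b: "b \<in> B - I" for b
    proof -
      have x: "b \<in> E - (I \<union> J)" "b \<in> B" using b BE J_sub by auto
      then show ?thesis
        using o[OF x(1)] d[OF x(2)] sd[OF x(2)] by (simp add: prev_def fund_of_def opposite_signs_opp)
    qed
    show "opposite_signs (fund (reo A ` C) B e) e
        (Min {c \<in> supp (fund (reo A ` C) B e). lev c = lev e})" if e: "e \<in> E - B - J" for e
    proof -
      have x: "e \<in> E - (I \<union> J)" "e \<in> E - B" using e I_sub by auto
      then show ?thesis
        using o[OF x(1)] c[OF x(2)] sc[OF x(2)] by (simp add: prev_def fund_of_def opposite_signs_opp)
    qed
  qed (use idx_mono idx_pos I_sub J_sub lev_I lev_J lev_bound lev_root lev_mono lower_B lower_E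
    in \<open>simp_all add: sc sd\<close>)
qed

lemma compat_exists:
  assumes A0: "A0 \<subseteq> I \<union> J"
  shows "\<exists>A\<subseteq>E. A \<inter> (I \<union> J) = A0 \<and> compat A"
proof -
  \<comment> \<open>Membership is prescribed on active elements; elsewhere it is copied or flipped
    from \<open>prev x\<close>, which is smaller than \<open>x\<close>.\<close>
  define H where "H f x = (if x \<in> I \<union> J then x \<in> A0 else
    if opposite_signs (fund_of x) x (prev x) then f (prev x) else \<not> f (prev x))" for f :: "'a \<Rightarrow> bool" and x
  have "\<exists>f. \<forall>x\<in>E. f x = H f x"
    by (rule finite_linorder_recursion[OF fin]) (use prev in \<open>auto simp: H_def\<close>)
  then obtain f where f: "\<And>x. x \<in> E \<Longrightarrow> f x = H f x" by blast
  have "compat {x \<in> E. f x}"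
    unfolding compat_def
  proof
    fix x assume x: "x \<in> E - (I \<union> J)"
    then have "f x \<longleftrightarrow> (if opposite_signs (fund_of x) x (prev x) then f (prev x) else \<not> f (prev x))"
      using f[of x] by (auto simp: H_def)
    then show "opposite_signs (fund_of x) x (prev x) \<longleftrightarrow> (x \<in> {x \<in> E. f x} \<longleftrightarrow> prev x \<in> {x \<in> E. f x})"
      using x prev(2)[OF x] by auto
  qed
  moreover have "{x \<in> E. f x} \<inter> (I \<union> J) = A0"
  proof -
    have "f x \<longleftrightarrow> x \<in> A0" if "x \<in> I \<union> J" for x
      using f[of x] that IE JE by (auto simp: H_def)
    then show ?thesis using A0 IE JE by blast
  qed
  ultimately show ?thesis by (intro exI[of _ "{x \<in> E. f x}"]) auto
qed

end

text \<open>\<open>x\<close> and \<open>prev x\<close> have equal level, so flipping whole levels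
  flips both or neither. This is why an activity class keeps its active basis.\<close>

lemma (in levelled) compat_union_levels: "compat (\<Union>a\<in>S. level a)"
  unfolding compat_def
proof
  fix x assume x: "x \<in> E - (I \<union> J)"
  have "opposite_signs (fund_of x) x (prev x)"
    using opt_B[of x] opt_E[of x] x by (auto simp: prev_def fund_of_def)
  moreover have "x \<in> (\<Union>a\<in>S. level a) \<longleftrightarrow> prev x \<in> (\<Union>a\<in>S. level a)"
    using prev[OF x] x by (auto simp: level_def)
  ultimately show "opposite_signs (fund_of x) x (prev x) \<longleftrightarrow>
      (x \<in> (\<Union>a\<in>S. level a) \<longleftrightarrow> prev x \<in> (\<Union>a\<in>S. level a))" by blast
qed


section \<open>Intervals of bases and the Tutte polynomial\<close>

locale ordered_om_rep = ordered_om_pair E C D + om_rep E C D K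
  for E :: "'a::linorder set" and C D K
begin

lemma int_basis_eq: "basis K B \<Longrightarrow> int_basis K B = {b \<in> B. b = Min (supp (fund D (E - B) b))}"
  using fund_cocircuit_eq by (auto simp: int_basis_def basis_iff)

lemma ext_basis_eq: "basis K B \<Longrightarrow> ext_basis K B = {e \<in> E - B. e = Min (supp (fund C B e))}"
  using fund_circuit_eq by (auto simp: ext_basis_def basis_iff ground_K)

lemma basis_sub: "basis K B \<Longrightarrow> B \<subseteq> E"
  by (simp add: basis_iff pair_basis_def)

lemma act_sub: "int_basis K B \<subseteq> B" "ext_basis K B \<subseteq> E - B"
  by (auto simp: int_basis_def ext_basis_def ground_K)

text \<open>Otherwise \<open>p\<close> and \<open>q\<close> would each be the minimum of a set
  containing the other.\<close>

lemma act_not_in_fund: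
  assumes B: "basis K B" and p: "p \<in> int_basis K B" and q: "q \<in> ext_basis K B"
  shows "p \<notin> supp (fund C B q)" "q \<notin> supp (fund D (E - B) p)"
proof -
  interpret dual: ordered_om_pair E D C by (simp add: ordered_om_pair_def dual_pair)
  have pb: "pair_basis E C D B" using B by (simp add: basis_iff)
  have pB: "p \<in> B" "p = Min (supp (fund D (E - B) p))" and qB: "q \<in> E - B" "q = Min (supp (fund C B q))"
    using p q by (auto simp: int_basis_eq[OF B] ext_basis_eq[OF B])
  have "p \<le> q \<and> q \<le> p" if "p \<in> supp (fund C B q)"
    using that fund_cofund(3)[OF pb qB(1) pB(1)] pB(2) qB(2) Min_supp(2)[OF fund_props(1)[OF pb qB(1)]]
      dual.Min_supp(2)[OF cofund_props(1)[OF pb pB(1)]] by metis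
  then show *: "p \<notin> supp (fund C B q)" using pB(1) qB(1) by auto
  then show "q \<notin> supp (fund D (E - B) p)" using fund_cofund(3)[OF pb qB(1) pB(1)] by simp
qed

lemma fund_ext:
  assumes B: "basis K B" and q: "q \<in> ext_basis K B"
  shows "fund C B q \<in> C" "q \<in> fst (fund C B q)" "supp (fund C B q) - {q} \<subseteq> B - int_basis K B"
    "Min (supp (fund C B q)) = q" "q \<in> E - B"
proof -
  have pb: "pair_basis E C D B" using B by (simp add: basis_iff)
  show "q \<in> E - B" "Min (supp (fund C B q)) = q" using q by (auto simp: ext_basis_eq[OF B])
  then show "fund C B q \<in> C" "q \<in> fst (fund C B q)" "supp (fund C B q) - {q} \<subseteq> B - int_basis K B"
    using fund_props[OF pb, of q] act_not_in_fund(1)[OF B _ q] by auto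
qed

lemma fund_int:
  assumes B: "basis K B" and p: "p \<in> int_basis K B"
  shows "fund D (E - B) p \<in> D" "p \<in> fst (fund D (E - B) p)"
    "supp (fund D (E - B) p) \<inter> (B \<union> ext_basis K B) = {p}" "Min (supp (fund D (E - B) p)) = p" "p \<in> B"
proof -
  have pb: "pair_basis E C D B" using B by (simp add: basis_iff)
  show pB: "p \<in> B" "Min (supp (fund D (E - B) p)) = p" using p by (auto simp: int_basis_eq[OF B])
  show "fund D (E - B) p \<in> D" "p \<in> fst (fund D (E - B) p)" using cofund_props[OF pb pB(1)] by auto
  show "supp (fund D (E - B) p) \<inter> (B \<union> ext_basis K B) = {p}"
    using cofund_props(4)[OF pb pB(1)] act_not_in_fund(2)[OF B p] by blast
qed

lemma int_mem_meeting:
  assumes B: "basis K B" and p: "p \<in> int_basis K B"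
    and S: "S \<subseteq> B \<union> ext_basis K B" "supp (fund D (E - B) p) \<inter> S \<noteq> {}"
  shows "p \<in> S" "supp (fund D (E - B) p) \<inter> S = {p}"
proof -
  obtain x where x: "x \<in> supp (fund D (E - B) p)" "x \<in> S" using S(2) by blast
  have sub: "supp (fund D (E - B) p) \<inter> S \<subseteq> {p}" unfolding fund_int(3)[OF B p, symmetric] using S(1) by blast
  then have "x = p" using x by blast
  then show "p \<in> S" "supp (fund D (E - B) p) \<inter> S = {p}" using x sub by auto
qed

text \<open>The basis of least weight consists of the elements that are heaviest in no
  circuit.\<close>

lemma greedy_basis:
  fixes \<rho> :: "'a \<Rightarrow> int"
  assumes inj: "inj_on \<rho> E"
  shows "\<exists>B. basis K B \<and> (\<forall>e\<in>E - B. \<forall>f\<in>supp (fund C B e). \<rho> f \<le> \<rho> e)"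
proof -
  define B where "B = {e \<in> E. \<not> (\<exists>X\<in>C. e \<in> supp X \<and> (\<forall>f\<in>supp X. \<rho> f \<le> \<rho> e))}"
  have ind: "\<not> supp X \<subseteq> B" if X: "X \<in> C" for X
  proof
    assume sub: "supp X \<subseteq> B"
    have "finite (\<rho> ` supp X)" "\<rho> ` supp X \<noteq> {}" using C_finite[OF X] C_ne[OF X] by auto
    then have "Max (\<rho> ` supp X) \<in> \<rho> ` supp X" by (rule Max_in)
    then obtain e where e: "e \<in> supp X" "\<rho> e = Max (\<rho> ` supp X)" by auto
    then have "\<forall>f\<in>supp X. \<rho> f \<le> \<rho> e" using C_finite[OF X] by simp
    then show False using e(1) sub X by (auto simp: B_def)
  qed
  have lower: "\<exists>X\<in>C. e \<in> supp X \<and> supp X \<subseteq> insert e {f \<in> B. \<rho> f < \<rho> e}" if e: "e \<in> E" "e \<notin> B" for e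
  proof (rule ccontr)
    assume no: "\<not> ?thesis"
    \<comment> \<open>Painting gives a cocircuit \<open>Y\<close> through \<open>e\<close> avoiding
      the lighter elements of \<open>B\<close>. Its lightest element \<open>f\<close> is outside
      \<open>B\<close>, hence heaviest in some circuit, which meets \<open>Y\<close> in
      \<open>f\<close> alone.\<close>
    have "{f \<in> B. \<rho> f < \<rho> e} \<subseteq> E - {e}" by (auto simp: B_def)
    with unsigned_painting[OF e(1) this] no
    obtain Y where Y: "Y \<in> D" "e \<in> supp Y" "supp Y \<inter> {f \<in> B. \<rho> f < \<rho> e} = {}" by blast
    have fY: "finite (\<rho> ` supp Y)" using fin D_sub[OF Y(1)] finite_subset by blast
    have "Min (\<rho> ` supp Y) \<in> \<rho> ` supp Y" using fY Y(2) by (intro Min_in) auto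
    then obtain f where f: "f \<in> supp Y" "\<rho> f = Min (\<rho> ` supp Y)" by auto
    have fmin: "\<rho> f \<le> \<rho> g" if "g \<in> supp Y" for g using that f(2) fY by simp
    have fE: "f \<in> E" using f D_sub[OF Y(1)] by blast
    have "f \<notin> B"
    proof
      assume fB: "f \<in> B"
      then have "f \<noteq> e" using e by blast
      then have "\<rho> f < \<rho> e" using fmin[OF Y(2)] inj_onD[OF inj, of f e] fE e by force
      then show False using Y(3) f fB by blast
    qed
    then obtain X where X: "X \<in> C" "f \<in> supp X" "\<forall>g\<in>supp X. \<rho> g \<le> \<rho> f" using fE by (auto simp: B_def)
    have "g = f" if "g \<in> supp X" "g \<in> supp Y" for g
    proof -
      have "g \<in> E" "\<rho> g = \<rho> f" using that X(3) fmin[of g] D_sub[OF Y(1)] by auto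
      then show ?thesis using inj_onD[OF inj] fE by blast
    qed
    then have "supp X \<inter> supp Y = {f}" using X(2) f(1) by blast
    then show False using single X(1) Y(1) by blast
  qed
  have "supp Y \<inter> B \<noteq> {}" if Y: "Y \<in> D" for Y
  proof
    assume 0: "supp Y \<inter> B = {}"
    obtain e where e: "e \<in> supp Y" using D_ne[OF Y] by blast
    then obtain X where "X \<in> C" "e \<in> supp X" "supp X \<subseteq> insert e {f \<in> B. \<rho> f < \<rho> e}"
      using lower[of e] 0 D_sub[OF Y] by blast
    moreover from this have "supp X \<inter> supp Y = {e}" using e 0 by blast
    ultimately show False using single Y by blast
  qed
  then have pb: "pair_basis E C D B" using ind by (auto simp: pair_basis_def B_def)
  have "\<rho> f \<le> \<rho> e" if e: "e \<in> E - B" and f: "f \<in> supp (fund C B e)" for e f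
  proof -
    obtain X where X: "X \<in> C" "e \<in> supp X" "supp X \<subseteq> insert e {f \<in> B. \<rho> f < \<rho> e}" using lower e by blast
    obtain X' where X': "X' \<in> C" "supp X' = supp X" "e \<in> fst X'" using C_sign[OF X(1,2)] by blast
    have "fund C B e = X'" using X X' e by (intro fund_eqI[OF pb]) auto
    then show ?thesis using f X X' by auto
  qed
  then show ?thesis using pb by (auto simp: basis_iff)
qed

text \<open>The greedy basis for the elements of \<open>X\<close> in decreasing order followed by the other elements in
  increasing order.\<close>

lemma interval_exists:
  assumes X: "X \<subseteq> E"
  shows "\<exists>B. basis K B \<and> X \<in> interval K B"
proof -
  obtain idx :: "'a \<Rightarrow> int" where pos: "\<And>x. x \<in> E \<Longrightarrow> 0 < idx x"
    and mono: "\<And>x y. x \<in> E \<Longrightarrow> y \<in> E \<Longrightarrow> x < y \<Longrightarrow> idx x < idx y"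
    using finite_linorder_index[OF fin] by blast
  have le: "idx x \<le> idx y \<longleftrightarrow> x \<le> y" if "x \<in> E" "y \<in> E" for x y
    using that mono[of x y] mono[of y x] by (cases x y rule: linorder_cases) auto
  define \<rho> where "\<rho> x = (if x \<in> X then - idx x else idx x)" for x
  have "inj_on \<rho> E"
  proof (rule inj_onI)
    fix x y assume xy: "x \<in> E" "y \<in> E" "\<rho> x = \<rho> y"
    then have "idx x = idx y" using pos[of x] pos[of y] by (auto simp: \<rho>_def split: if_splits)
    then show "x = y" using le[of x y] le[of y x] xy by simp
  qed
  then obtain B where B: "basis K B" and low: "\<And>e f. e \<in> E - B \<Longrightarrow> f \<in> supp (fund C B e) \<Longrightarrow> \<rho> f \<le> \<rho> e"
    using greedy_basis by blast
  interpret dual: ordered_om_pair E D C by (simp add: ordered_om_pair_def dual_pair)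
  have pb: "pair_basis E C D B" using B by (simp add: basis_iff)
  have "e \<in> ext_basis K B" if e: "e \<in> X" "e \<notin> B" for e
  proof -
    have eE: "e \<in> E - B" using e X by blast
    note F = fund_props[OF pb eE]
    \<comment> \<open>The weight of \<open>f\<close> is at most the negative weight of
      \<open>e\<close>, so \<open>f\<close> is in \<open>X\<close>, where smaller weight means
      larger element.\<close>
    have "e \<le> f" if f: "f \<in> supp (fund C B e)" for f
    proof -
      have "f \<in> E" using f C_sub[OF F(1)] by blast
      then show ?thesis
        using low[OF eE f] pos[of f] pos[of e] e eE le[of e f] by (auto simp: \<rho>_def split: if_splits)
    qed
    then have "Min (supp (fund C B e)) = e"
      using C_finite[OF F(1)] F(3) by (intro Min_eqI) (auto simp: supp_def)
    then show ?thesis using eE by (simp add: ext_basis_eq[OF B])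
  qed
  moreover have "b \<in> int_basis K B" if b: "b \<in> B" "b \<notin> X" for b
  proof -
    note F = cofund_props[OF pb b(1)]
    have bE: "b \<in> E" using b basis_sub[OF B] by blast
    \<comment> \<open>Here \<open>f\<close> has at least the positive weight of \<open>b\<close>, so
      \<open>f\<close> is outside \<open>X\<close>, where weights follow the order.\<close>
    have "b \<le> f" if f: "f \<in> supp (fund D (E - B) b)" for f
    proof (cases "f = b")
      case False
      then have fE: "f \<in> E - B" using f F(2) by blast
      then have "b \<in> supp (fund C B f)" using fund_cofund(3)[OF pb fE b(1)] f by simp
      then show ?thesis
        using low[OF fE] pos[of f] pos[OF bE] b fE le[of b f] bE by (fastforce simp: \<rho>_def split: if_splits)
    qed simp
    then have "Min (supp (fund D (E - B) b)) = b"
      using dual.C_finite[OF F(1)] F(3) by (intro Min_eqI) (auto simp: supp_def)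
    then show ?thesis using b by (simp add: int_basis_eq[OF B])
  qed
  ultimately show ?thesis using B by (auto simp: interval_def)
qed

text \<open>Two fundamental sets of \<open>e\<close> share a further element \<open>f > e\<close> of
  \<open>B' - B\<close>. The smaller element \<open>e\<close> prevents \<open>f\<close> from being
  externally active for \<open>B\<close> and internally active for \<open>B'\<close>; so
  \<open>X\<close> would both omit and contain \<open>f\<close>.\<close>

lemma interval_min_difference:
  assumes B: "basis K B" "X \<in> interval K B" and B': "basis K B'" "X \<in> interval K B'"
    and e: "e \<in> B" "e \<notin> B'" and min: "\<And>f. f \<in> B' - B \<Longrightarrow> e < f"
  shows False
proof -
  interpret dual: ordered_om_pair E D C by (simp add: ordered_om_pair_def dual_pair)
  have pb: "pair_basis E C D B" "pair_basis E C D B'" using B B' by (auto simp: basis_iff)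
  have eE: "e \<in> E - B'" using e basis_sub[OF B(1)] by blast
  note F = fund_props[OF pb(2) eE] and G = cofund_props[OF pb(1) e(1)]
  have "supp (fund C B' e) \<inter> supp (fund D (E - B) e) \<noteq> {e}" using single F G by blast
  moreover have "e \<in> supp (fund C B' e)" "e \<in> supp (fund D (E - B) e)"
    using F(3) G(3) by (auto simp: in_supp_iff)
  ultimately obtain f where f: "f \<in> supp (fund C B' e)" "f \<in> supp (fund D (E - B) e)" "f \<noteq> e"
    by blast
  then have fB: "f \<in> B' - B" "f \<in> E - B" "f \<in> B'" using F(2) G(4) basis_sub[OF B'(1)] by auto
  have ef: "e < f" using min fB(1) by blast
  have 1: "f \<notin> ext_basis K B"
  proof
    assume "f \<in> ext_basis K B"
    then have "f = Min (supp (fund C B f))" by (simp add: ext_basis_eq[OF B(1)])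
    moreover have "e \<in> supp (fund C B f)" using fund_cofund(3)[OF pb(1) fB(2) e(1)] f(2) by simp
    ultimately have "f \<le> e" using Min_supp(2)[OF fund_props(1)[OF pb(1) fB(2)]] by metis
    then show False using ef by simp
  qed
  have 2: "f \<notin> int_basis K B'"
  proof
    assume "f \<in> int_basis K B'"
    then have "f = Min (supp (fund D (E - B') f))" by (simp add: int_basis_eq[OF B'(1)])
    moreover have "e \<in> supp (fund D (E - B') f)" using fund_cofund(3)[OF pb(2) eE fB(3)] f(1) by simp
    ultimately have "f \<le> e" using dual.Min_supp(2)[OF cofund_props(1)[OF pb(2) fB(3)]] by metis
    then show False using ef by simp
  qed
  show False using 1 2 fB B(2) B'(2) by (auto simp: interval_def)
qed

lemma interval_unique:
  assumes B: "basis K B" "X \<in> interval K B" and B': "basis K B'" "X \<in> interval K B'"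
  shows "B = B'"
proof (rule ccontr)
  assume "B \<noteq> B'"
  define S where "S = (B - B') \<union> (B' - B)"
  have "finite S" using fin basis_sub[OF B(1)] basis_sub[OF B'(1)] by (auto simp: S_def intro: finite_subset)
  moreover have "S \<noteq> {}" using \<open>B \<noteq> B'\<close> by (auto simp: S_def)
  ultimately have m: "Min S \<in> S" "\<And>f. f \<in> S \<Longrightarrow> f \<noteq> Min S \<Longrightarrow> Min S < f" by (auto simp: less_le)
  show False
  proof (cases "Min S \<in> B")
    case True
    show False
      by (rule interval_min_difference[OF B B', of "Min S"]) (use True m in \<open>auto simp: S_def\<close>)
  next
    case False
    show False
      by (rule interval_min_difference[OF B' B, of "Min S"]) (use False m in \<open>auto simp: S_def\<close>)
  qed
qed

lemma basis_of_eq: "basis K B \<Longrightarrow> X \<in> interval K B \<Longrightarrow> basis_of K X = B"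
  unfolding basis_of_def using interval_unique by (intro the_equality) blast+

lemma interval_sub: "basis K B \<Longrightarrow> X \<in> interval K B \<Longrightarrow> X \<subseteq> E"
  using basis_sub[of B] act_sub[of B] by (auto simp: interval_def)

section \<open>Cardinality of bases and ranks\<close>

lemma basis_exchange:
  assumes B: "basis K B" and b: "b \<in> B" and e: "e \<in> E - B" "e \<in> supp (fund D (E - B) b)"
  shows "basis K (insert e (B - {b}))"
proof -
  have pb: "pair_basis E C D B" using B by (simp add: basis_iff)
  note F = fund_props[OF pb e(1)] and G = cofund_props[OF pb b]
  have be: "b \<in> supp (fund C B e)" using fund_cofund(3)[OF pb e(1) b] e(2) by simp
  have "\<not> supp X \<subseteq> insert e (B - {b})" if X: "X \<in> C" for X
  proof
    assume sub: "supp X \<subseteq> insert e (B - {b})"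
    have "\<not> supp X \<subseteq> B" using pb X by (auto simp: pair_basis_def)
    then have "e \<in> supp X" using sub by blast
    then have "supp X \<inter> supp (fund D (E - B) b) = {e}" using sub e(2) G(4) by blast
    then show False using single[OF X G(1)] by blast
  qed
  moreover have "supp Y \<inter> insert e (B - {b}) \<noteq> {}" if Y: "Y \<in> D" for Y
  proof
    assume 0: "supp Y \<inter> insert e (B - {b}) = {}"
    have "supp Y \<inter> B \<noteq> {}" using pb Y by (auto simp: pair_basis_def)
    then have "b \<in> supp Y" using 0 by blast
    then have "supp (fund C B e) \<inter> supp Y = {b}" using 0 be F(2) by blast
    then show False using single[OF F(1) Y] by blast
  qed
  ultimately show ?thesis using basis_sub[OF B] e(1) by (auto simp: basis_iff pair_basis_def)
qed

lemma basis_card: "basis K B \<Longrightarrow> basis K B' \<Longrightarrow> card B = card B'"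
proof (induction "card (B - B')" arbitrary: B rule: less_induct)
  case less
  have pb: "pair_basis E C D B" "pair_basis E C D B'" using less.prems by (auto simp: basis_iff)
  have fB: "finite B" using basis_sub[OF less.prems(1)] fin finite_subset by blast
  show ?case
  proof (cases "B \<subseteq> B'")
    case True
    moreover have "indep K B'" using less.prems by (simp add: basis_def)
    ultimately have "B' = B" using less.prems by (simp add: basis_def)
    then show ?thesis by simp
  next
    case False
    then obtain b where b: "b \<in> B" "b \<notin> B'" by blast
    note G = cofund_props[OF pb(1) b(1)]
    have "supp (fund D (E - B) b) \<inter> B' \<noteq> {}" using pb(2) G(1) by (auto simp: pair_basis_def)
    then obtain e where e: "e \<in> supp (fund D (E - B) b)" "e \<in> B'" by blast
    then have eE: "e \<in> E - B" using G(2) b basis_sub[OF less.prems(2)] by blast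
    let ?B = "insert e (B - {b})"
    have bas: "basis K ?B" using basis_exchange[OF less.prems(1) b(1) eE e(1)] .
    have "?B - B' = (B - B') - {b}" using e(2) by blast
    then have "card (?B - B') < card (B - B')" using fB b by (simp only:) (intro card_Diff1_less, auto)
    then have "card ?B = card B'" using less.hyps bas less.prems(2) by blast
    moreover have "card ?B = Suc (card (B - {b}))"
      by (rule card_insert_disjoint) (use fB eE in auto)
    moreover have "Suc (card (B - {b})) = card B" by (rule card_Suc_Diff1[OF fB b(1)])
    ultimately show ?thesis by simp
  qed
qed

text \<open>Extend an independent \<open>I\<close> in \<open>X\<close> to a basis \<open>B1\<close>
  inside \<open>I \<union> B\<close>. Each \<open>p\<close> in \<open>B - X\<close> is internally
  active, and its fundamental cocircuit can meet \<open>B1\<close> only in \<open>p\<close>. So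
  \<open>B1 - I\<close> contains \<open>B - X\<close>, which bounds \<open>card I\<close>.\<close>

lemma rank_interval:
  assumes B: "basis K B" and X: "X \<in> interval K B"
  shows "rank K X = card (B \<inter> X)"
proof -
  have pb: "pair_basis E C D B" using B by (simp add: basis_iff)
  have XE: "X \<subseteq> E" using interval_sub[OF B X] .
  have fB: "finite B" using basis_sub[OF B] fin finite_subset by blast
  have "card I \<le> card (B \<inter> X)" if I: "I \<subseteq> X" "indep K I" for I
  proof -
    have "\<exists>B1. pair_basis E C D B1 \<and> I \<subseteq> B1 \<and> B1 \<subseteq> I \<union> B"
    proof (rule extend_basis)
      show "supp Y \<inter> (I \<union> B) \<noteq> {}" if "Y \<in> D" for Y using pb that by (auto simp: pair_basis_def)
    qed (use I basis_sub[OF B] in \<open>auto simp: indep_iff\<close>)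
    then obtain B1 where B1: "pair_basis E C D B1" "I \<subseteq> B1" "B1 \<subseteq> I \<union> B" by blast
    have "p \<in> B1 - I" if p: "p \<in> B - X" for p
    proof -
      have "p \<in> int_basis K B" using p X by (auto simp: interval_def)
      note F = fund_int(1)[OF B this]
      have "supp (fund D (E - B) p) \<inter> B1 \<noteq> {}" using B1(1) F by (auto simp: pair_basis_def)
      moreover have "B1 \<subseteq> B \<union> ext_basis K B" using B1(3) I(1) X by (auto simp: interval_def)
      ultimately have "p \<in> B1" using int_mem_meeting(1)[OF B \<open>p \<in> int_basis K B\<close>] by blast
      then show ?thesis using p I(1) by blast
    qed
    then have sub: "B - X \<subseteq> B1 - I" by blast
    have fB1: "finite B1" using B1(1) fin finite_subset by (auto simp: pair_basis_def)
    have "card (B - X) \<le> card (B1 - I)" using sub fB1 by (simp add: card_mono)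
    also have "card (B1 - I) = card B1 - card I" using B1(2) fB1 by (simp add: card_Diff_subset finite_subset)
    also have "card B1 = card B" using basis_card B B1(1) basis_iff by blast
    finally have "card (B - X) \<le> card B - card I" .
    moreover have "card I \<le> card B" using card_mono[OF fB1 B1(2)] \<open>card B1 = card B\<close> by simp
    moreover have "card B = card (B \<inter> X) + card (B - X)" using fB by (metis card_Int_Diff)
    ultimately show ?thesis by simp
  qed
  moreover have "B \<inter> X \<subseteq> X" "indep K (B \<inter> X)"
    using pb XE by (auto simp: indep_iff pair_basis_def)
  moreover have "finite {I. I \<subseteq> X \<and> indep K I}"
    by (rule finite_subset[of _ "Pow E"]) (use fin XE in auto)
  ultimately show ?thesis unfolding rank_def by (intro Max_eqI) auto
qed

lemma rank_ground: "basis K B \<Longrightarrow> rank K E = card B"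
proof -
  assume B: "basis K B"
  have pb: "pair_basis E C D B" using B by (simp add: basis_iff)
  obtain B' where B': "basis K B'" "E \<in> interval K B'" using interval_exists[of E] by blast
  then have "B' \<inter> E = B'" using basis_sub by blast
  then show ?thesis using rank_interval[OF B'] basis_card[OF B'(1) B] by simp
qed

section \<open>Triples and the expansion of the Tutte polynomial\<close>

definition triples :: "('a set \<times> 'a set \<times> 'a set) set" where
  "triples = (SIGMA B:{B. basis K B}. Pow (int_basis K B) \<times> Pow (ext_basis K B))"

definition subset_of :: "'a set \<times> 'a set \<times> 'a set \<Rightarrow> 'a set" where
  "subset_of = (\<lambda>(B, P, Q). (B - P) \<union> Q)"

lemma subset_of_props:
  assumes "(B, P, Q) \<in> triples"
  shows "basis K B" "subset_of (B, P, Q) \<in> interval K B" "int_basis K B - subset_of (B, P, Q) = P"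
    "ext_basis K B \<inter> subset_of (B, P, Q) = Q" "B \<inter> subset_of (B, P, Q) = B - P"
  using assms act_sub[of B] unfolding triples_def subset_of_def interval_def by blast+

lemma bij_subset_of: "bij_betw subset_of triples (Pow E)"
proof (rule bij_betwI')
  fix s t assume "s \<in> triples" "t \<in> triples"
  then obtain B P Q B' P' Q' where st: "s = (B, P, Q)" "t = (B', P', Q')"
    "(B, P, Q) \<in> triples" "(B', P', Q') \<in> triples" by (metis prod_cases3)
  note p = subset_of_props[OF st(3)] and p' = subset_of_props[OF st(4)]
  show "subset_of s = subset_of t \<longleftrightarrow> s = t"
    using p p' interval_unique[OF p(1,2) p'(1)] unfolding st(1,2) by metis
next
  fix t assume "t \<in> triples"
  then obtain B P Q where t: "t = (B, P, Q)" "(B, P, Q) \<in> triples" by (metis prod_cases3)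
  show "subset_of t \<in> Pow E"
    using subset_of_props[OF t(2)] interval_sub unfolding t(1) by blast
next
  fix X assume "X \<in> Pow E"
  then obtain B where B: "basis K B" "X \<in> interval K B" using interval_exists by blast
  have "(B, int_basis K B - X, ext_basis K B \<inter> X) \<in> triples" using B by (auto simp: triples_def)
  moreover have "subset_of (B, int_basis K B - X, ext_basis K B \<inter> X) = X"
    using B(2) act_sub[of B] unfolding subset_of_def interval_def by auto
  ultimately show "\<exists>t\<in>triples. X = subset_of t" by metis
qed

text \<open>The subset given by \<open>(B, P, Q)\<close> has corank \<open>card P\<close> and
  nullity \<open>card Q\<close>. Carrying out the sums over \<open>P\<close> and \<open>Q\<close>
  would give the expansion by basis activities.\<close>

lemma tutte_triples:
  "tutte K x y = (\<Sum>(B, P, Q)\<in>triples. (x - 1) ^ card P * (y - 1) ^ card Q)"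
proof -
  have "tutte K x y = (\<Sum>t\<in>triples. (x - 1) ^ (rank K E - rank K (subset_of t)) *
      (y - 1) ^ (card (subset_of t) - rank K (subset_of t)))"
    unfolding tutte_def ground_K by (rule sum.reindex_bij_betw[OF bij_subset_of, symmetric])
  also have "\<dots> = (\<Sum>(B, P, Q)\<in>triples. (x - 1) ^ card P * (y - 1) ^ card Q)"
  proof (rule sum.cong[OF refl])
    fix t assume "t \<in> triples"
    then obtain B P Q where t: "t = (B, P, Q)" "(B, P, Q) \<in> triples" by (metis prod_cases3)
    note p = subset_of_props[OF t(2)]
    have PQ: "P \<subseteq> B" "Q \<inter> B = {}" "Q \<subseteq> E" using t(2) act_sub[of B] unfolding triples_def by blast+
    have f: "finite B" "finite P" "finite Q" using basis_sub[OF p(1)] PQ fin by (meson finite_subset)+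
    have r: "rank K (subset_of (B, P, Q)) = card B - card P" "rank K E = card B" "card P \<le> card B"
      using rank_interval[OF p(1,2)] p(5) rank_ground[OF p(1)] PQ f by (auto simp: card_Diff_subset card_mono)
    have "card (subset_of (B, P, Q)) = card B - card P + card Q"
      unfolding subset_of_def using PQ f by (simp add: card_Diff_subset card_Un_disjoint Int_commute Diff_Int_distrib)
    then show "(x - 1) ^ (rank K E - rank K (subset_of t)) * (y - 1) ^ (card (subset_of t) - rank K (subset_of t)) =
      (case t of (B, P, Q) \<Rightarrow> (x - 1) ^ card P * (y - 1) ^ card Q)"
      using r unfolding t(1) by simp
  qed
  finally show ?thesis .
qed

end

text \<open>For \<open>k\<close> equal to 0, 1 or 2 there are \<open>k ^ card S\<close> selected
  subsets of \<open>S\<close>: no activity allowed, only the empty choice, or a free choice.\<close>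

definition select :: "nat \<Rightarrow> 'a set \<Rightarrow> 'a set \<Rightarrow> bool" where
  "select k S P \<longleftrightarrow> (k = 0 \<longrightarrow> S = {}) \<and> (k = 1 \<longrightarrow> P = {})"

lemma sum_Pow_power:
  fixes z :: "'b::comm_semiring_1"
  assumes "finite S"
  shows "(\<Sum>P\<in>Pow S. z ^ card P) = (1 + z) ^ card S"
  using assms
proof (induction S rule: finite_induct)
  case (insert a S)
  have inj: "inj_on (insert a) (Pow S)" using insert.hyps(2) by (auto simp: inj_on_def)
  have disj: "Pow S \<inter> insert a ` Pow S = {}" using insert.hyps(2) by auto
  have "(\<Sum>P\<in>insert a ` Pow S. z ^ card P) = (\<Sum>P\<in>Pow S. z * z ^ card P)"
    unfolding sum.reindex[OF inj] using insert.hyps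
    by (intro sum.cong) (auto simp: card_insert_if finite_subset)
  then have "(\<Sum>P\<in>Pow (insert a S). z ^ card P) = (1 + z) * (\<Sum>P\<in>Pow S. z ^ card P)"
    using insert.hyps(1) disj by (simp add: Pow_insert sum.union_disjoint sum.distrib sum_distrib_left distrib_right)
  then show ?case using insert by simp
qed simp

text \<open>Both sides equal \<open>k ^ card S\<close>; the sum is the form occurring in
  \<open>tutte_triples\<close>.\<close>

lemma card_select:
  assumes "finite S" "k \<le> 2"
  shows "int (card {P \<in> Pow S. select k S P}) = (\<Sum>P\<in>Pow S. (int k - 1) ^ card P)"
proof -
  consider "k = 0" | "k = 1" | "k = 2" using assms(2) by linarith
  then show ?thesis
  proof cases
    case 1
    have "{P \<in> Pow S. select k S P} = (if S = {} then {{}} else {})" using 1 by (auto simp: select_def)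
    then show ?thesis
      using 1 sum_Pow_power[OF assms(1), of "-1::int"] assms(1) by (simp add: power_0_left card_eq_0_iff)
  next
    case 2
    have "{P \<in> Pow S. select k S P} = {{}}" using 2 by (auto simp: select_def)
    then show ?thesis using 2 sum_Pow_power[OF assms(1), of "0::int"] by simp
  next
    case 3
    have "{P \<in> Pow S. select k S P} = Pow S" using 3 by (auto simp: select_def)
    then show ?thesis using 3 sum_Pow_power[OF assms(1), of "1::int"] assms(1) by (simp add: card_Pow)
  qed
qed

lemma (in ordered_om_rep) card_select_triples:
  assumes "i \<le> 2" "j \<le> 2"
  shows "int (card {(B, P, Q) \<in> triples. select i (int_basis K B) P \<and> select j (ext_basis K B) Q}) =
    tutte K (int i) (int j)"
proof -
  have fb: "finite {B. basis K B}"
    by (rule finite_subset[of _ "Pow E"]) (use fin basis_sub in auto)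
  have f: "finite (int_basis K B)" "finite (ext_basis K B)" if "basis K B" for B
    using act_sub[of B] basis_sub[OF that] fin by (meson Diff_subset finite_subset order_trans)+
  have "{(B, P, Q) \<in> triples. select i (int_basis K B) P \<and> select j (ext_basis K B) Q} =
    (SIGMA B:{B. basis K B}. {P \<in> Pow (int_basis K B). select i (int_basis K B) P} \<times>
      {Q \<in> Pow (ext_basis K B). select j (ext_basis K B) Q})"
    by (auto simp: triples_def)
  then have "int (card {(B, P, Q) \<in> triples. select i (int_basis K B) P \<and> select j (ext_basis K B) Q}) =
    (\<Sum>B\<in>{B. basis K B}. int (card {P \<in> Pow (int_basis K B). select i (int_basis K B) P}) *
      int (card {Q \<in> Pow (ext_basis K B). select j (ext_basis K B) Q}))"
    using fb f by (simp add: card_SigmaI card_cartesian_product)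
  also have "\<dots> = (\<Sum>B\<in>{B. basis K B}. (\<Sum>P\<in>Pow (int_basis K B). (int i - 1) ^ card P) *
      (\<Sum>Q\<in>Pow (ext_basis K B). (int j - 1) ^ card Q))"
  proof (rule sum.cong[OF refl])
    fix B assume "B \<in> {B. basis K B}"
    then have B: "basis K B" by simp
    show "int (card {P \<in> Pow (int_basis K B). select i (int_basis K B) P}) *
        int (card {Q \<in> Pow (ext_basis K B). select j (ext_basis K B) Q}) =
      (\<Sum>P\<in>Pow (int_basis K B). (int i - 1) ^ card P) * (\<Sum>Q\<in>Pow (ext_basis K B). (int j - 1) ^ card Q)"
      using card_select[OF f(1)[OF B] assms(1)] card_select[OF f(2)[OF B] assms(2)] by (simp only:)
  qed
  also have "\<dots> = (\<Sum>B\<in>{B. basis K B}. \<Sum>(P, Q)\<in>Pow (int_basis K B) \<times> Pow (ext_basis K B).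
      (int i - 1) ^ card P * (int j - 1) ^ card Q)"
    by (simp add: sum_product sum.cartesian_product)
  also have "\<dots> = tutte K (int i) (int j)"
    unfolding tutte_triples triples_def using fb f by (subst sum.Sigma) (auto simp: case_prod_unfold)
  finally show ?thesis .
qed

section \<open>Classes of subsets recognized from their interval\<close>

context ordered_om_rep
begin

context
  fixes B X assumes B: "basis K B" and X: "X \<in> interval K B"
begin

text \<open>The fundamental circuit of an externally active \<open>q\<close> avoids internally
  active elements, so apart from \<open>q\<close> it lies in every member of the interval.\<close>

lemma indep_interval_iff: "indep K X \<longleftrightarrow> ext_basis K B \<inter> X = {}"
proof
  assume ind: "indep K X"
  have "q \<notin> X" if q: "q \<in> ext_basis K B" for q
  proof
    assume "q \<in> X"
    then have "supp (fund C B q) \<subseteq> X" using fund_ext(3)[OF B q] X unfolding interval_def by blast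
    then show False using ind fund_ext(1)[OF B q] unfolding indep_iff by blast
  qed
  then show "ext_basis K B \<inter> X = {}" by blast
next
  assume "ext_basis K B \<inter> X = {}"
  then have "X \<subseteq> B" using X by (auto simp: interval_def)
  then show "indep K X" using B unfolding basis_iff pair_basis_def indep_iff by (meson order_trans)
qed

lemma subset_basis_iff: "(\<exists>B'. basis K B' \<and> X \<subseteq> B') \<longleftrightarrow> ext_basis K B \<inter> X = {}"
proof
  assume "\<exists>B'. basis K B' \<and> X \<subseteq> B'"
  then obtain B' where "basis K B'" "X \<subseteq> B'" by blast
  then have "indep K X" unfolding basis_iff pair_basis_def indep_iff by (meson order_trans)
  then show "ext_basis K B \<inter> X = {}" by (simp add: indep_interval_iff)
next
  assume "ext_basis K B \<inter> X = {}"
  then have "X \<subseteq> B" using X by (auto simp: interval_def)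
  then show "\<exists>B'. basis K B' \<and> X \<subseteq> B'" using B by blast
qed

lemma spanning_interval_iff: "spanning K X \<longleftrightarrow> int_basis K B \<subseteq> X"
proof -
  have fB: "finite B" using basis_sub[OF B] fin finite_subset by blast
  have "spanning K X \<longleftrightarrow> card (B \<inter> X) = card B"
    using interval_sub[OF B X] rank_interval[OF B X] rank_ground[OF B] by (simp add: spanning_def ground_K)
  also have "\<dots> \<longleftrightarrow> B \<subseteq> X" using fB card_subset_eq[of B "B \<inter> X"] by (auto simp: Int_absorb2)
  also have "\<dots> \<longleftrightarrow> int_basis K B \<subseteq> X" using X act_sub[of B] by (auto simp: interval_def)
  finally show ?thesis .
qed

lemma superset_basis_iff: "(\<exists>B'. basis K B' \<and> B' \<subseteq> X) \<longleftrightarrow> int_basis K B \<subseteq> X"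
proof
  assume "\<exists>B'. basis K B' \<and> B' \<subseteq> X"
  then obtain B' where B': "basis K B'" "B' \<subseteq> X" by blast
  show "int_basis K B \<subseteq> X"
  proof
    fix p assume p: "p \<in> int_basis K B"
    note F = fund_int[OF B p]
    have "supp (fund D (E - B) p) \<inter> B' \<noteq> {}" using B'(1) F(1) by (auto simp: basis_iff pair_basis_def)
    moreover have "B' \<subseteq> B \<union> ext_basis K B" using B'(2) X by (auto simp: interval_def)
    ultimately have "p \<in> B'" using int_mem_meeting(1)[OF B p] by blast
    then show "p \<in> X" using B'(2) by blast
  qed
next
  assume "int_basis K B \<subseteq> X"
  then have "B \<subseteq> X" using X by (auto simp: interval_def)
  then show "\<exists>B'. basis K B' \<and> B' \<subseteq> X" using B by blast
qed

text \<open>An externally active element leaves a broken circuit inside \<open>X\<close>.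
  Conversely, if \<open>X\<close> is inside \<open>B\<close>, a broken circuit in \<open>X\<close>
  is completed by its minimum to a fundamental circuit, making that minimum externally
  active.\<close>

lemma nbc_interval_iff: "no_broken_circuit K X \<longleftrightarrow> ext_basis K B = {}"
proof
  assume nbc: "no_broken_circuit K X"
  show "ext_basis K B = {}"
  proof (rule ccontr)
    assume "ext_basis K B \<noteq> {}"
    then obtain q where q: "q \<in> ext_basis K B" by blast
    note F = fund_ext[OF B q]
    have "fund C B q \<in> circuits K"
      using fund_minsupp F(5) B by (simp add: circuits_K basis_iff)
    moreover have "supp (fund C B q) - {q} \<subseteq> X" using F(3) X by (auto simp: interval_def)
    ultimately show False using nbc F(4) unfolding no_broken_circuit_def by force
  qed
next
  assume ext: "ext_basis K B = {}"
  then have XB: "X \<subseteq> B" using X by (auto simp: interval_def)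
  have pb: "pair_basis E C D B" using B by (simp add: basis_iff)
  have "\<not> supp Z - {Min (supp Z)} \<subseteq> X" if Z: "Z \<in> circuits K" for Z
  proof
    assume sub: "supp Z - {Min (supp Z)} \<subseteq> X"
    have ZC: "Z \<in> C" using Z by (simp add: circuits_K minsupp_def)
    define e where "e = Min (supp Z)"
    have eZ: "e \<in> supp Z" using Min_supp(1)[OF ZC] by (simp add: e_def)
    have "\<not> supp Z \<subseteq> B" using pb ZC by (auto simp: pair_basis_def)
    then have eE: "e \<in> E - B" using sub XB eZ C_sub[OF ZC] unfolding e_def by blast
    obtain Z' where Z': "Z' \<in> C" "supp Z' = supp Z" "e \<in> fst Z'" using C_sign[OF ZC eZ] by blast
    have "fund C B e = Z'" using Z' eE sub XB unfolding e_def by (intro fund_eqI[OF pb]) auto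
    then have "e \<in> ext_basis K B" using eE Z' by (simp add: ext_basis_eq[OF B] e_def)
    then show False using ext by blast
  qed
  then show "no_broken_circuit K X"
    using interval_sub[OF B X] by (simp add: no_broken_circuit_def ground_K)
qed

text \<open>An externally active \<open>q\<close> of \<open>B\<close> would have the same
  fundamental circuit in \<open>B'\<close>, hence be externally active there.\<close>

lemma subset_internal_iff: "(\<exists>B'. internal_basis K B' \<and> X \<subseteq> B') \<longleftrightarrow> ext_basis K B = {}"
proof
  assume "\<exists>B'. internal_basis K B' \<and> X \<subseteq> B'"
  then obtain B' where B': "basis K B'" "ext_basis K B' = {}" "X \<subseteq> B'" by (auto simp: internal_basis_def)
  have pb': "pair_basis E C D B'" using B'(1) by (simp add: basis_iff)
  show "ext_basis K B = {}"
  proof (rule ccontr)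
    assume "ext_basis K B \<noteq> {}"
    then obtain q where q: "q \<in> ext_basis K B" by blast
    note F = fund_ext[OF B q]
    have sub: "supp (fund C B q) - {q} \<subseteq> B'" using F(3) X B'(3) by (auto simp: interval_def)
    have "\<not> supp (fund C B q) \<subseteq> B'" using pb' F(1) by (auto simp: pair_basis_def)
    then have qE: "q \<in> E - B'" using sub F(5) by blast
    then have "fund C B' q = fund C B q" using F sub by (intro fund_eqI[OF pb']) auto
    then show False using F(4) qE B'(2) ext_basis_eq[OF B'(1)] by auto
  qed
next
  assume ext: "ext_basis K B = {}"
  then have "X \<subseteq> B" using X by (auto simp: interval_def)
  then show "\<exists>B'. internal_basis K B' \<and> X \<subseteq> B'" using B ext by (auto simp: internal_basis_def)
qed

text \<open>The fundamental cocircuit of an internally active \<open>p\<close> meets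
  \<open>B'\<close> in \<open>p\<close> alone, so it is also fundamental for
  \<open>B'\<close>.\<close>

lemma superset_external_iff: "(\<exists>B'. external_basis K B' \<and> B' \<subseteq> X) \<longleftrightarrow> int_basis K B = {}"
proof
  assume "\<exists>B'. external_basis K B' \<and> B' \<subseteq> X"
  then obtain B' where B': "basis K B'" "int_basis K B' = {}" "B' \<subseteq> X" by (auto simp: external_basis_def)
  have pb': "pair_basis E C D B'" using B'(1) by (simp add: basis_iff)
  interpret dual: om_pair E D C by (rule dual_pair)
  show "int_basis K B = {}"
  proof (rule ccontr)
    assume "int_basis K B \<noteq> {}"
    then obtain p where p: "p \<in> int_basis K B" by blast
    note F = fund_int[OF B p]
    have "supp (fund D (E - B) p) \<inter> B' \<noteq> {}" using pb' F(1) by (auto simp: pair_basis_def)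
    moreover have "B' \<subseteq> B \<union> ext_basis K B" using B'(3) X by (auto simp: interval_def)
    ultimately have i: "supp (fund D (E - B) p) \<inter> B' = {p}" using int_mem_meeting(2)[OF B p] by blast
    then have pB: "p \<in> B'" by blast
    have "fund D (E - B') p = fund D (E - B) p"
      using F i D_sub[OF F(1)] pB by (intro dual.fund_eqI[OF pair_basis_dual[OF pb']]) auto
    then show False using F(4) pB B'(2) int_basis_eq[OF B'(1)] by auto
  qed
next
  assume int: "int_basis K B = {}"
  then have "B \<subseteq> X" using X by (auto simp: interval_def)
  then show "\<exists>B'. external_basis K B' \<and> B' \<subseteq> X" using B int by (auto simp: external_basis_def)
qed

lemma basis_interval_iff: "basis K X \<longleftrightarrow> int_basis K B \<subseteq> X \<and> ext_basis K B \<inter> X = {}"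
proof
  assume "basis K X"
  then show "int_basis K B \<subseteq> X \<and> ext_basis K B \<inter> X = {}"
    using superset_basis_iff subset_basis_iff by blast
next
  assume "int_basis K B \<subseteq> X \<and> ext_basis K B \<inter> X = {}"
  then have "X = B" using X by (auto simp: interval_def)
  then show "basis K X" using B by simp
qed

lemma basis_interval_eq: "basis K X \<Longrightarrow> X = B"
  using interval_unique[of X X B] B X act_sub[of X] by (auto simp: interval_def)

lemma internal_interval_iff: "internal_basis K X \<longleftrightarrow> ext_basis K B = {} \<and> int_basis K B \<subseteq> X"
  using basis_interval_iff basis_interval_eq by (auto simp: internal_basis_def)

lemma external_interval_iff: "external_basis K X \<longleftrightarrow> int_basis K B = {} \<and> ext_basis K B \<inter> X = {}"
  using basis_interval_iff basis_interval_eq by (auto simp: external_basis_def)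

end

end


section \<open>The refined active bijection\<close>

lemma reo_reo: "reo U (reo A X) = reo (sym_diff A U) X"
  by (auto simp: reo_def)

lemma bij_betw_restrict:
  assumes f: "bij_betw f A B" and S: "S \<subseteq> A" and T: "T \<subseteq> B"
    and iff: "\<And>a. a \<in> A \<Longrightarrow> a \<in> S \<longleftrightarrow> f a \<in> T"
  shows "bij_betw f S T"
proof (rule bij_betw_subset[OF f S])
  show "f ` S = T"
  proof (intro equalityI subsetI)
    fix y assume y: "y \<in> T"
    then have "y \<in> f ` A" using f T by (auto simp: bij_betw_def)
    then obtain a where "a \<in> A" "y = f a" by blast
    then show "y \<in> f ` S" using iff[of a] y by blast
  next
    fix y assume "y \<in> f ` S"
    then obtain a where "a \<in> S" "y = f a" by blast
    then show "y \<in> T" using iff[of a] S by blast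
  qed
qed

lemma order_isomorphismI:
  assumes "bij_betw f K L" "\<And>x y. x \<in> K \<Longrightarrow> y \<in> K \<Longrightarrow> le_K x y \<longleftrightarrow> le_L (f x) (f y)"
  shows "order_isomorphism f K le_K L le_L"
  using assms by (simp add: order_isomorphism_def)

locale ordered_oriented_matroid =
  fixes M :: "'a::linorder omatroid"
  assumes om: "oriented_matroid M"
begin

sublocale ordered_om_rep "ground M" "circuits M" "cocircuits M" M
proof -
  interpret om_pair "ground M" "circuits M" "cocircuits M" using oriented_matroid_pair(1)[OF om] .
  show "ordered_om_rep (ground M) (circuits M) (cocircuits M) M"
    by unfold_locales (simp_all add: oriented_matroid_pair(2)[OF om])
qed

text \<open>The active sets are taken in \<open>M\<close>, as they depend only on supports.\<close>

definition realizes :: "'a set \<Rightarrow> 'a set \<Rightarrow> bool" where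
  "realizes B A \<longleftrightarrow> A \<subseteq> ground M \<and> (\<exists>idx lev. levelled (ground M) (reo A ` circuits M) (reo A ` cocircuits M)
     B (int_basis M B) (ext_basis M B) idx lev)"

lemma realizes_levelled_om:
  assumes "realizes B A"
  shows "\<exists>idx lev. levelled_om (ground M) (reo A ` circuits M) (reo A ` cocircuits M)
     B (int_basis M B) (ext_basis M B) idx lev (reorient M A)"
proof -
  obtain idx lev where "levelled (ground M) (reo A ` circuits M) (reo A ` cocircuits M)
     B (int_basis M B) (ext_basis M B) idx lev" using assms by (auto simp: realizes_def)
  then interpret L: levelled "ground M" "reo A ` circuits M" "reo A ` cocircuits M" B
    "int_basis M B" "ext_basis M B" idx lev .
  note rep = reorient_rep[OF om, of A]
  interpret R: om_rep "ground M" "reo A ` circuits M" "reo A ` cocircuits M" "reorient M A" by (rule rep(4))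
  interpret R': om_rep "ground M" "reo A ` cocircuits M" "reo A ` circuits M" "dual (reorient M A)"
    by (rule R.dual_rep)
  have "cocircuits (dual (reorient M A)) = reo A ` circuits M"
    using R'.cocircuits_K by (simp add: minsupp_reo oriented_matroid_pair(2)[OF om])
  then have "levelled_om (ground M) (reo A ` circuits M) (reo A ` cocircuits M)
     B (int_basis M B) (ext_basis M B) idx lev (reorient M A)"
    by unfold_locales (simp_all add: rep)
  then show ?thesis by blast
qed

lemma realizes_props:
  assumes "realizes B A"
  shows "basis M B" "alpha (reorient M A) = B" "O_star (reorient M A) = int_basis M B"
    "O_act (reorient M A) = ext_basis M B"
proof -
  obtain idx lev where "levelled_om (ground M) (reo A ` circuits M) (reo A ` cocircuits M)
     B (int_basis M B) (ext_basis M B) idx lev (reorient M A)"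
    using realizes_levelled_om[OF assms] by blast
  then interpret L: levelled_om "ground M" "reo A ` circuits M" "reo A ` cocircuits M" B
    "int_basis M B" "ext_basis M B" idx lev "reorient M A" .
  show "basis M B" using L.basis by (simp add: pair_basis_reo basis_iff)
  show "alpha (reorient M A) = B" "O_star (reorient M A) = int_basis M B"
    "O_act (reorient M A) = ext_basis M B"
    by (rule L.alpha_eq L.O_star_eq L.O_act_eq)+
qed

lemma realizes_exists:
  assumes "(B, P, Q) \<in> triples"
  shows "\<exists>A. realizes B A \<and> A \<inter> int_basis M B = P \<and> A \<inter> ext_basis M B = Q"
proof -
  have B: "basis M B" and PQ: "P \<subseteq> int_basis M B" "Q \<subseteq> ext_basis M B"
    using assms by (auto simp: triples_def)
  have pb: "pair_basis (ground M) (circuits M) (cocircuits M) B" using B by (simp add: basis_iff)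
  obtain idx lev where "level_function (ground M) (circuits M) (cocircuits M) B
      (int_basis M B) (ext_basis M B) idx lev"
    using level_function_exists[OF pb] by (auto simp: int_basis_eq[OF B] ext_basis_eq[OF B])
  then interpret L: level_function "ground M" "circuits M" "cocircuits M" B
    "int_basis M B" "ext_basis M B" idx lev .
  obtain A where A: "A \<subseteq> ground M" "A \<inter> (int_basis M B \<union> ext_basis M B) = P \<union> Q" "L.compat A"
    using L.compat_exists[of "P \<union> Q"] PQ by blast
  have "realizes B A" unfolding realizes_def using A(1) L.compat_levelled[OF A(3)] by blast
  moreover have "A \<inter> int_basis M B = P" "A \<inter> ext_basis M B = Q"
    using A(2) PQ act_sub[of B] by blast+
  ultimately show ?thesis by blast
qed

definition triple :: "'a set \<Rightarrow> 'a set \<times> 'a set \<times> 'a set" where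
  "triple A = (alpha (reorient M A), A \<inter> O_star (reorient M A), A \<inter> O_act (reorient M A))"

lemma alpha_map_eq: "alpha_map M A = subset_of (triple A)"
  by (simp add: alpha_map_def subset_of_def triple_def)

lemma realizes_triple: "realizes B A \<Longrightarrow> triple A = (B, A \<inter> int_basis M B, A \<inter> ext_basis M B)"
  using realizes_props by (simp add: triple_def)

text \<open>There are as many triples as subsets of the ground set, hence the injection sending a triple to a
  reorientation realizing it is surjective. In particular every bounded reorientation has a fully
  optimal basis.\<close>

lemma bij_triple: "bij_betw triple (Pow (ground M)) triples"
  and realizes_alpha: "A \<subseteq> ground M \<Longrightarrow> realizes (alpha (reorient M A)) A"
proof -
  have "\<forall>t\<in>triples. \<exists>A. realizes (fst t) A \<and> triple A = t"
    using realizes_exists realizes_triple by fastforce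
  then obtain g where g: "\<And>t. t \<in> triples \<Longrightarrow> realizes (fst t) (g t) \<and> triple (g t) = t" by metis
  have inj: "inj_on g triples" using g by (metis inj_onI)
  have "g ` triples \<subseteq> Pow (ground M)" using g by (auto simp: realizes_def)
  moreover have "card (g ` triples) = card (Pow (ground M))"
    using card_image[OF inj] bij_betw_same_card[OF bij_subset_of] by simp
  ultimately have img: "g ` triples = Pow (ground M)" using fin by (simp add: card_subset_eq)
  show "bij_betw triple (Pow (ground M)) triples"
  proof (rule bij_betw_byWitness)
    show "\<forall>A\<in>Pow (ground M). g (triple A) = A" "triple ` Pow (ground M) \<subseteq> triples"
      unfolding img[symmetric] using g by auto
    show "\<forall>t\<in>triples. triple (g t) = t" using g by blast
    show "g ` triples \<subseteq> Pow (ground M)" using img by simp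
  qed
  show "realizes (alpha (reorient M A)) A" if A: "A \<subseteq> ground M"
  proof -
    obtain t where "t \<in> triples" "A = g t" using A img by blast
    then have "realizes (fst t) A" using g by blast
    then show ?thesis using realizes_props(2) by metis
  qed
qed

lemma reorientation_props:
  assumes "A \<subseteq> ground M"
  shows "basis M (alpha (reorient M A))" "O_star (reorient M A) = int_basis M (alpha (reorient M A))"
    "O_act (reorient M A) = ext_basis M (alpha (reorient M A))"
    "triple A \<in> triples" "alpha_map M A \<in> interval M (alpha (reorient M A))"
    "int_basis M (alpha (reorient M A)) - alpha_map M A = A \<inter> O_star (reorient M A)"
    "ext_basis M (alpha (reorient M A)) \<inter> alpha_map M A = A \<inter> O_act (reorient M A)"
proof -
  note r = realizes_props[OF realizes_alpha[OF assms]]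
  show "basis M (alpha (reorient M A))" "O_star (reorient M A) = int_basis M (alpha (reorient M A))"
    "O_act (reorient M A) = ext_basis M (alpha (reorient M A))"
    using r by simp_all
  show t: "triple A \<in> triples" using bij_triple assms by (auto simp: bij_betw_def)
  show "alpha_map M A \<in> interval M (alpha (reorient M A))"
    "int_basis M (alpha (reorient M A)) - alpha_map M A = A \<inter> O_star (reorient M A)"
    "ext_basis M (alpha (reorient M A)) \<inter> alpha_map M A = A \<inter> O_act (reorient M A)"
    using subset_of_props[OF t[unfolded triple_def]] by (simp_all add: alpha_map_eq triple_def)
qed

lemma bij_alpha_map: "bij_betw (alpha_map M) (Pow (ground M)) (Pow (ground M))"
  using bij_betw_trans[OF bij_triple bij_subset_of] by (simp add: alpha_map_eq[abs_def] comp_def)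

lemma triple_inj: "A \<subseteq> ground M \<Longrightarrow> A' \<subseteq> ground M \<Longrightarrow> triple A = triple A' \<longleftrightarrow> A = A'"
  using bij_triple by (auto simp: bij_betw_def inj_on_def)

lemma alpha_map_inj: "A \<subseteq> ground M \<Longrightarrow> A' \<subseteq> ground M \<Longrightarrow> alpha_map M A = alpha_map M A' \<longleftrightarrow> A = A'"
  using bij_alpha_map by (auto simp: bij_betw_def inj_on_def)

lemma triple_surj: "t \<in> triples \<Longrightarrow> \<exists>A\<subseteq>ground M. triple A = t"
proof -
  assume "t \<in> triples"
  then have "t \<in> triple ` Pow (ground M)" using bij_triple by (simp add: bij_betw_def)
  then show "\<exists>A\<subseteq>ground M. triple A = t" by blast
qed

text \<open>Each level contains one active element, so flipping the parts of
  \<open>P \<union> Q\<close> changes membership of exactly these active elements.\<close>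

lemma flip_parts_triple:
  assumes A: "realizes B A" and P: "P \<subseteq> int_basis M B" and Q: "Q \<subseteq> ext_basis M B"
  shows "flip_parts M A (P \<union> Q) \<subseteq> ground M"
    "triple (flip_parts M A (P \<union> Q)) = (B, sym_diff (A \<inter> int_basis M B) P, sym_diff (A \<inter> ext_basis M B) Q)"
proof -
  obtain idx lev where "levelled_om (ground M) (reo A ` circuits M) (reo A ` cocircuits M)
     B (int_basis M B) (ext_basis M B) idx lev (reorient M A)"
    using realizes_levelled_om[OF A] by blast
  then interpret L: levelled_om "ground M" "reo A ` circuits M" "reo A ` cocircuits M" B
    "int_basis M B" "ext_basis M B" idx lev "reorient M A" .
  define U where "U = (\<Union>a\<in>P \<union> Q. L.level a)"
  define A' where "A' = sym_diff A U"
  have "(\<Union>a\<in>P \<union> Q. active_part (reorient M A) a) = U"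
    unfolding U_def using L.active_part_eq P Q by (intro SUP_cong) auto
  then have eq: "flip_parts M A (P \<union> Q) = A'" by (simp add: flip_parts_def A'_def)
  have AE: "A \<subseteq> ground M" using A by (simp add: realizes_def)
  have UE: "U \<subseteq> ground M" by (auto simp: U_def L.level_def)
  have "levelled (ground M) (reo U ` reo A ` circuits M) (reo U ` reo A ` cocircuits M)
     B (int_basis M B) (ext_basis M B) idx lev"
    unfolding U_def by (rule L.compat_levelled[OF L.compat_union_levels])
  moreover have "A' \<subseteq> ground M" using AE UE by (auto simp: A'_def)
  ultimately have A': "realizes B A'"
    by (auto simp: realizes_def image_image reo_reo A'_def)
  show "flip_parts M A (P \<union> Q) \<subseteq> ground M" using \<open>A' \<subseteq> ground M\<close> eq by simp
  have U: "a \<in> U \<longleftrightarrow> a \<in> P \<union> Q" if a: "a \<in> int_basis M B \<union> ext_basis M B" for a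
  proof
    assume "a \<in> U"
    then obtain s where s: "s \<in> P \<union> Q" "lev a = lev s" by (auto simp: U_def L.level_def)
    then have "a = s" using L.lev_inj[OF a, of s] P Q by auto
    then show "a \<in> P \<union> Q" using s by simp
  next
    assume "a \<in> P \<union> Q"
    then show "a \<in> U" using a L.IE L.JE by (auto simp: U_def L.level_def)
  qed
  have "A' \<inter> int_basis M B = sym_diff (A \<inter> int_basis M B) P"
    "A' \<inter> ext_basis M B = sym_diff (A \<inter> ext_basis M B) Q"
    using U P Q act_sub[of B] unfolding A'_def by blast+
  then show "triple (flip_parts M A (P \<union> Q)) = (B, sym_diff (A \<inter> int_basis M B) P, sym_diff (A \<inter> ext_basis M B) Q)"
    using realizes_triple[OF A'] eq by simp
qed

text \<open>A class is a fibre of the active basis. To reach \<open>A'\<close> from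
  \<open>A\<close>, flip the parts of the active elements on which the two differ; the triples then
  coincide.\<close>

lemma activity_class_eq:
  assumes A: "A \<subseteq> ground M"
  shows "activity_class M A = {A'. A' \<subseteq> ground M \<and> alpha (reorient M A') = alpha (reorient M A)}"
proof (intro set_eqI iffI)
  define B where "B = alpha (reorient M A)"
  have r: "realizes B A" using realizes_alpha[OF A] by (simp add: B_def)
  note rp = realizes_props[OF r]
  fix A'
  { assume "A' \<in> activity_class M A"
    then obtain P Q where "A' = flip_parts M A (P \<union> Q)" "P \<subseteq> int_basis M B" "Q \<subseteq> ext_basis M B"
      by (auto simp: activity_class_def rp)
    then show "A' \<in> {A'. A' \<subseteq> ground M \<and> alpha (reorient M A') = alpha (reorient M A)}"
      using flip_parts_triple[OF r] by (simp add: triple_def B_def) }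
  assume "A' \<in> {A'. A' \<subseteq> ground M \<and> alpha (reorient M A') = alpha (reorient M A)}"
  then have A': "A' \<subseteq> ground M" "alpha (reorient M A') = B" by (auto simp: B_def)
  then have r': "realizes B A'" using realizes_alpha by blast
  define P Q where "P = sym_diff (A \<inter> int_basis M B) (A' \<inter> int_basis M B)"
    and "Q = sym_diff (A \<inter> ext_basis M B) (A' \<inter> ext_basis M B)"
  have PQ: "P \<subseteq> int_basis M B" "Q \<subseteq> ext_basis M B" by (auto simp: P_def Q_def)
  have "triple (flip_parts M A (P \<union> Q)) = triple A'"
    unfolding flip_parts_triple(2)[OF r PQ] realizes_triple[OF r'] by (auto simp: P_def Q_def)
  then have "A' = flip_parts M A (P \<union> Q)"
    using triple_inj flip_parts_triple(1)[OF r PQ] A'(1) by blast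
  then show "A' \<in> activity_class M A" using PQ by (auto simp: activity_class_def rp)
qed

lemma alpha_map_class: "alpha_map M ` {A. A \<subseteq> ground M \<and> alpha (reorient M A) = B} = interval M B"
  if B: "basis M B"
proof (intro set_eqI iffI)
  fix X
  { assume "X \<in> alpha_map M ` {A. A \<subseteq> ground M \<and> alpha (reorient M A) = B}"
    then show "X \<in> interval M B" using reorientation_props(5) by blast }
  assume X: "X \<in> interval M B"
  have "(B, int_basis M B - X, ext_basis M B \<inter> X) \<in> triples" using B by (auto simp: triples_def)
  then obtain A where A: "A \<subseteq> ground M" "triple A = (B, int_basis M B - X, ext_basis M B \<inter> X)"
    using triple_surj by blast
  then have "alpha_map M A = X"
    using X act_sub[of B] by (auto simp: alpha_map_eq subset_of_def interval_def)
  moreover have "alpha (reorient M A) = B" using A(2) by (simp add: triple_def)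
  ultimately show "X \<in> alpha_map M ` {A. A \<subseteq> ground M \<and> alpha (reorient M A) = B}" using A(1) by blast
qed

lemma activity_classes_eq:
  "activity_classes M = {{A. A \<subseteq> ground M \<and> alpha (reorient M A) = B} | B. basis M B}"
proof -
  have ex: "\<exists>A\<subseteq>ground M. alpha (reorient M A) = B" if B: "basis M B" for B
  proof -
    have "(B, {}, {}) \<in> triples" using B by (auto simp: triples_def)
    from triple_surj[OF this] show ?thesis unfolding triple_def by blast
  qed
  have "activity_classes M = (\<lambda>B. {A. A \<subseteq> ground M \<and> alpha (reorient M A) = B}) `
      (\<lambda>A. alpha (reorient M A)) ` Pow (ground M)"
    unfolding activity_classes_def image_image using activity_class_eq by (intro image_cong) auto
  moreover have "(\<lambda>A. alpha (reorient M A)) ` Pow (ground M) = {B. basis M B}"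
  proof (intro equalityI subsetI)
    fix B assume "B \<in> {B. basis M B}"
    then show "B \<in> (\<lambda>A. alpha (reorient M A)) ` Pow (ground M)" using ex[of B] by blast
  qed (use reorientation_props(1) in blast)
  ultimately show ?thesis by (simp add: image_Collect)
qed

text \<open>The representative has triple \<open>(B, {}, {})\<close>. Flipping its parts by
  \<open>P \<union> Q\<close> corresponds to \<open>sym_diff B (P \<union> Q)\<close>, so both
  orders compare the same index sets.\<close>

lemma class_order_isomorphism:
  assumes B: "basis M B"
  defines "K \<equiv> {A. A \<subseteq> ground M \<and> alpha (reorient M A) = B}"
  shows "order_isomorphism (alpha_map M) K (class_le M K) (interval M B) (interval_le M B)"
proof (rule order_isomorphismI)
  show "bij_betw (alpha_map M) K (interval M B)"
    by (rule bij_betw_subset[OF bij_alpha_map]) (auto simp: K_def alpha_map_class[OF B])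
  have "(B, {}, {}) \<in> triples" using B by (auto simp: triples_def)
  then obtain A0 where A0: "A0 \<subseteq> ground M" "triple A0 = (B, {}, {})" using triple_surj by blast
  have rep: "class_rep M K = A0"
    unfolding class_rep_def
  proof (rule the_equality)
    show "A0 \<in> K \<and> active_fixed M A0 \<and> dual_active_fixed M A0"
      using A0 by (auto simp: K_def triple_def active_fixed_def dual_active_fixed_def)
    fix A assume "A \<in> K \<and> active_fixed M A \<and> dual_active_fixed M A"
    then have "A \<subseteq> ground M" "triple A = triple A0"
      using A0(2) by (auto simp: K_def triple_def active_fixed_def dual_active_fixed_def)
    then show "A = A0" using triple_inj A0(1) by blast
  qed
  have r0: "realizes B A0" using realizes_alpha[OF A0(1)] A0(2) by (simp add: triple_def)
  note rp = realizes_props[OF r0]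
  have e0: "A0 \<inter> int_basis M B = {}" "A0 \<inter> ext_basis M B = {}"
    using realizes_triple[OF r0] A0(2) by auto
  have flip: "X = flip_parts M A0 (P \<union> Q) \<longleftrightarrow> alpha_map M X = sym_diff B (P \<union> Q)"
    if X: "X \<in> K" and PQ: "P \<subseteq> int_basis M B" "Q \<subseteq> ext_basis M B" for X P Q
  proof -
    have XE: "X \<subseteq> ground M" using X by (simp add: K_def)
    have "triple (flip_parts M A0 (P \<union> Q)) = (B, P, Q)"
      using flip_parts_triple(2)[OF r0 PQ] e0 by simp
    then have "alpha_map M (flip_parts M A0 (P \<union> Q)) = (B - P) \<union> Q"
      by (simp add: alpha_map_eq subset_of_def)
    moreover have "(B - P) \<union> Q = sym_diff B (P \<union> Q)" using PQ act_sub[of B] by blast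
    ultimately show ?thesis
      using alpha_map_inj[OF XE flip_parts_triple(1)[OF r0 PQ]] by auto
  qed
  fix X Y assume XY: "X \<in> K" "Y \<in> K"
  have "class_le M K X Y \<longleftrightarrow> (\<exists>P Q P' Q'. P \<subseteq> int_basis M B \<and> Q \<subseteq> ext_basis M B \<and>
      P' \<subseteq> int_basis M B \<and> Q' \<subseteq> ext_basis M B \<and>
      X = flip_parts M A0 (P \<union> Q) \<and> Y = flip_parts M A0 (P' \<union> Q') \<and> P \<union> Q \<subseteq> P' \<union> Q')"
    unfolding class_le_def rep Let_def rp ..
  also have "\<dots> \<longleftrightarrow> interval_le M B (alpha_map M X) (alpha_map M Y)"
    unfolding interval_le_def
    by (intro ex_cong1 conj_cong refl; rule flip; (rule XY | assumption))
  finally show "class_le M K X Y \<longleftrightarrow> interval_le M B (alpha_map M X) (alpha_map M Y)" .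
qed

lemma bij_activity_classes:
  "bij_betw ((`) (alpha_map M)) (activity_classes M) {interval M B | B. basis M B}"
proof -
  have "inj_on ((`) (alpha_map M)) (activity_classes M)"
  proof (rule inj_on_image)
    have "\<Union>(activity_classes M) \<subseteq> Pow (ground M)" by (auto simp: activity_classes_eq)
    then show "inj_on (alpha_map M) (\<Union>(activity_classes M))"
      using bij_alpha_map inj_on_subset by (auto simp: bij_betw_def)
  qed
  moreover have "(`) (alpha_map M) ` activity_classes M = {interval M B | B. basis M B}"
    using alpha_map_class unfolding activity_classes_eq by (auto simp: image_iff) metis+
  ultimately show ?thesis by (simp add: bij_betw_def)
qed

text \<open>The numbers \<open>i\<close> and \<open>j\<close> serve twice: as conditions on internal
  and external activities through \<open>select\<close>, and as the evaluation point.\<close>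

lemma restricted_bijection:
  assumes ij: "i \<le> 2" "j \<le> 2"
    and S: "S \<subseteq> Pow (ground M)"
      "\<And>A. A \<subseteq> ground M \<Longrightarrow> A \<in> S \<longleftrightarrow>
        select i (O_star (reorient M A)) (A \<inter> O_star (reorient M A)) \<and>
        select j (O_act (reorient M A)) (A \<inter> O_act (reorient M A))"
    and T: "T \<subseteq> Pow (ground M)"
      "\<And>B X. basis M B \<Longrightarrow> X \<in> interval M B \<Longrightarrow>
        X \<in> T \<longleftrightarrow> select i (int_basis M B) (int_basis M B - X) \<and> select j (ext_basis M B) (ext_basis M B \<inter> X)"
  shows "bij_betw (alpha_map M) S T \<and> int (card S) = tutte M (int i) (int j)"
proof
  have "A \<in> S \<longleftrightarrow> alpha_map M A \<in> T" if A: "A \<subseteq> ground M" for A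
    using S(2)[OF A] T(2)[OF reorientation_props(1,5)[OF A]] reorientation_props(2,3,6,7)[OF A] by simp
  then show bij: "bij_betw (alpha_map M) S T"
    using S(1) T(1) by (intro bij_betw_restrict[OF bij_alpha_map]) auto
  let ?U = "{(B, P, Q) \<in> triples. select i (int_basis M B) P \<and> select j (ext_basis M B) Q}"
  have mem: "t \<in> ?U \<longleftrightarrow> subset_of t \<in> T" if "t \<in> triples" for t
  proof -
    obtain B P Q where t: "t = (B, P, Q)" by (metis prod_cases3)
    have BPQ: "(B, P, Q) \<in> triples" using that t by simp
    show ?thesis
      unfolding t using T(2)[OF subset_of_props(1,2)[OF BPQ]] BPQ subset_of_props(3,4)[OF BPQ] by simp
  qed
  then have "bij_betw subset_of ?U T"
    using T(1) by (intro bij_betw_restrict[OF bij_subset_of]) auto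
  then have "card S = card ?U" using bij_betw_same_card[OF bij] bij_betw_same_card[of subset_of ?U T] by simp
  then show "int (card S) = tutte M (int i) (int j)" using card_select_triples[OF ij] by simp
qed

lemma acyclic_iff: "acyclic_om (reorient M A) \<longleftrightarrow> O_act (reorient M A) = {}"
  by (auto simp: acyclic_om_def O_act_def)

lemma totally_cyclic_iff: "totally_cyclic (reorient M A) \<longleftrightarrow> O_star (reorient M A) = {}"
  by (auto simp: totally_cyclic_def O_star_def)

end

theorem theorem8p2:
  fixes M :: "'a::linorder omatroid"
  assumes "oriented_matroid M"
  shows
    "(bij_betw (alpha_map M) (Pow (ground M)) (Pow (ground M)) \<and>
     bij_betw ((`) (alpha_map M)) (activity_classes M) {interval M B | B. basis M B} \<and>
     (\<forall>K\<in>activity_classes M. \<exists>B. basis M B \<and> alpha_map M ` K = interval M B \<and>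
        order_isomorphism (alpha_map M) K (class_le M K) (interval M B) (interval_le M B)))
     \<and>
     (\<forall>A\<subseteq>ground M.
       let N = reorient M A; B = alpha N; P = A \<inter> O_star N; Q = A \<inter> O_act N in
       basis M B \<and> alpha_map M A = (B - P) \<union> Q \<and>
       Int_set M (alpha_map M A) = int_basis M B - P \<and>
       int_basis M B - P = O_star N - P \<and>
       O_star N - P = Theta_star M A \<and>
       P_set M (alpha_map M A) = P \<and>
       P = Theta_star_bar M A \<and>
       Ext_set M (alpha_map M A) = ext_basis M B - Q \<and>
       ext_basis M B - Q = O_act N - Q \<and>
       O_act N - Q = Theta M A \<and>
       Q_set M (alpha_map M A) = Q \<and>
       Q = Theta_bar M A)
     \<and>
     ((\<forall>A\<subseteq>ground M. alpha_map M A = alpha (reorient M A) \<longleftrightarrow>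
        active_fixed M A \<and> dual_active_fixed M A) \<and>

     bij_betw (alpha_map M) {A. A \<subseteq> ground M} {X. X \<subseteq> ground M} \<and>
     int (card {A. A \<subseteq> ground M}) = tutte M 2 2 \<and>

     bij_betw (alpha_map M)
       {A. A \<subseteq> ground M \<and> acyclic_om (reorient M A)}
       {X. \<exists>B. internal_basis M B \<and> X \<subseteq> B} \<and>
     {X. \<exists>B. internal_basis M B \<and> X \<subseteq> B} = {X. no_broken_circuit M X} \<and>
     int (card {A. A \<subseteq> ground M \<and> acyclic_om (reorient M A)}) = tutte M 2 0 \<and>

     bij_betw (alpha_map M)
       {A. A \<subseteq> ground M \<and> totally_cyclic (reorient M A)}
       {X. X \<subseteq> ground M \<and> (\<exists>B. external_basis M B \<and> B \<subseteq> X)} \<and>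
     int (card {A. A \<subseteq> ground M \<and> totally_cyclic (reorient M A)}) = tutte M 0 2 \<and>

     bij_betw (alpha_map M)
       {A. A \<subseteq> ground M \<and> dual_active_fixed M A \<and> acyclic_om (reorient M A)}
       {B. internal_basis M B} \<and>
     int (card {A. A \<subseteq> ground M \<and> dual_active_fixed M A \<and> acyclic_om (reorient M A)}) =
       tutte M 1 0 \<and>

     bij_betw (alpha_map M)
       {A. A \<subseteq> ground M \<and> active_fixed M A \<and> totally_cyclic (reorient M A)}
       {B. external_basis M B} \<and>
     int (card {A. A \<subseteq> ground M \<and> active_fixed M A \<and> totally_cyclic (reorient M A)}) =
       tutte M 0 1 \<and>

     bij_betw (alpha_map M)
       {A. A \<subseteq> ground M \<and> active_fixed M A}
       {X. \<exists>B. basis M B \<and> X \<subseteq> B} \<and>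
     {X. \<exists>B. basis M B \<and> X \<subseteq> B} = {X. indep M X} \<and>
     int (card {A. A \<subseteq> ground M \<and> active_fixed M A}) = tutte M 2 1 \<and>

     bij_betw (alpha_map M)
       {A. A \<subseteq> ground M \<and> dual_active_fixed M A}
       {X. X \<subseteq> ground M \<and> (\<exists>B. basis M B \<and> B \<subseteq> X)} \<and>
     {X. X \<subseteq> ground M \<and> (\<exists>B. basis M B \<and> B \<subseteq> X)} = {X. spanning M X} \<and>
     int (card {A. A \<subseteq> ground M \<and> dual_active_fixed M A}) = tutte M 1 2 \<and>

     bij_betw (alpha_map M)
       {A. A \<subseteq> ground M \<and> active_fixed M A \<and> dual_active_fixed M A}
       {B. basis M B} \<and>
     int (card {A. A \<subseteq> ground M \<and> active_fixed M A \<and> dual_active_fixed M A}) = tutte M 1 1)"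
proof -
  interpret ordered_oriented_matroid M using assms by unfold_locales
  have sub: "basis M B \<Longrightarrow> B \<subseteq> ground M" for B by (rule basis_sub)
  have part1: "bij_betw (alpha_map M) (Pow (ground M)) (Pow (ground M)) \<and>
     bij_betw ((`) (alpha_map M)) (activity_classes M) {interval M B | B. basis M B} \<and>
     (\<forall>K\<in>activity_classes M. \<exists>B. basis M B \<and> alpha_map M ` K = interval M B \<and>
        order_isomorphism (alpha_map M) K (class_le M K) (interval M B) (interval_le M B))"
  proof (intro conjI ballI)
    fix K assume "K \<in> activity_classes M"
    then obtain B where B: "basis M B" and K: "K = {A. A \<subseteq> ground M \<and> alpha (reorient M A) = B}"
      unfolding activity_classes_eq by blast
    show "\<exists>B. basis M B \<and> alpha_map M ` K = interval M B \<and>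
        order_isomorphism (alpha_map M) K (class_le M K) (interval M B) (interval_le M B)"
      unfolding K using B alpha_map_class[OF B] class_order_isomorphism[OF B] by blast
  qed (rule bij_alpha_map bij_activity_classes)+
  have part2: "let N = reorient M A; B = alpha N; P = A \<inter> O_star N; Q = A \<inter> O_act N in
       basis M B \<and> alpha_map M A = (B - P) \<union> Q \<and>
       Int_set M (alpha_map M A) = int_basis M B - P \<and>
       int_basis M B - P = O_star N - P \<and>
       O_star N - P = Theta_star M A \<and>
       P_set M (alpha_map M A) = P \<and>
       P = Theta_star_bar M A \<and>
       Ext_set M (alpha_map M A) = ext_basis M B - Q \<and>
       ext_basis M B - Q = O_act N - Q \<and>
       O_act N - Q = Theta M A \<and>
       Q_set M (alpha_map M A) = Q \<and>
       Q = Theta_bar M A" if A: "A \<subseteq> ground M" for A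
  proof -
    note r = reorientation_props[OF A]
    have b: "basis_of M (alpha_map M A) = alpha (reorient M A)" using basis_of_eq[OF r(1,5)] .
    have i: "int_basis M (alpha (reorient M A)) \<inter> alpha_map M A =
        int_basis M (alpha (reorient M A)) - A \<inter> O_star (reorient M A)"
      "ext_basis M (alpha (reorient M A)) - alpha_map M A =
        ext_basis M (alpha (reorient M A)) - A \<inter> O_act (reorient M A)"
      using r(6,7) by blast+
    show ?thesis
      unfolding Let_def Int_set_def P_set_def Ext_set_def Q_set_def b
        Theta_def Theta_bar_def Theta_star_def Theta_star_bar_def
      using r(1,6,7) i r(2,3)[symmetric] by (auto simp: alpha_map_def)
  qed
  have fixed: "\<forall>A\<subseteq>ground M. alpha_map M A = alpha (reorient M A) \<longleftrightarrow> active_fixed M A \<and> dual_active_fixed M A"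
  proof (intro allI impI)
    fix A assume A: "A \<subseteq> ground M"
    \<comment> \<open>Removed elements come from the active basis and added ones from outside, so
      nothing cancels and equality means that both sets are empty.\<close>
    have "O_star (reorient M A) \<subseteq> alpha (reorient M A)" "O_act (reorient M A) \<inter> alpha (reorient M A) = {}"
      using reorientation_props(2,3)[OF A] act_sub[of "alpha (reorient M A)"] by auto
    then show "alpha_map M A = alpha (reorient M A) \<longleftrightarrow> active_fixed M A \<and> dual_active_fixed M A"
      unfolding alpha_map_def active_fixed_def dual_active_fixed_def by blast
  qed
  have sets: "{X. \<exists>B. internal_basis M B \<and> X \<subseteq> B} = {X. no_broken_circuit M X}"
    "{X. \<exists>B. basis M B \<and> X \<subseteq> B} = {X. indep M X}"
    "{X. X \<subseteq> ground M \<and> (\<exists>B. basis M B \<and> B \<subseteq> X)} = {X. spanning M X}"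
  proof -
    have ground: "no_broken_circuit M X \<Longrightarrow> X \<subseteq> ground M" "indep M X \<Longrightarrow> X \<subseteq> ground M"
      "spanning M X \<Longrightarrow> X \<subseteq> ground M" "\<exists>B. internal_basis M B \<and> X \<subseteq> B \<Longrightarrow> X \<subseteq> ground M"
      "\<exists>B. basis M B \<and> X \<subseteq> B \<Longrightarrow> X \<subseteq> ground M" for X
      using sub by (auto simp: no_broken_circuit_def indep_def spanning_def internal_basis_def)
    have "((\<exists>B. internal_basis M B \<and> X \<subseteq> B) \<longleftrightarrow> no_broken_circuit M X) \<and>
        ((\<exists>B. basis M B \<and> X \<subseteq> B) \<longleftrightarrow> indep M X) \<and> ((\<exists>B. basis M B \<and> B \<subseteq> X) \<longleftrightarrow> spanning M X)"
      if X: "X \<subseteq> ground M" for X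
    proof -
      obtain B where B: "basis M B" "X \<in> interval M B" using interval_exists[OF X] by blast
      show ?thesis
        unfolding subset_internal_iff[OF B] nbc_interval_iff[OF B] subset_basis_iff[OF B]
          indep_interval_iff[OF B] superset_basis_iff[OF B] spanning_interval_iff[OF B] by simp
    qed
    note iff = this
    show "{X. \<exists>B. internal_basis M B \<and> X \<subseteq> B} = {X. no_broken_circuit M X}"
      using iff[THEN conjunct1] ground(1,4) by (intro Collect_cong) meson
    show "{X. \<exists>B. basis M B \<and> X \<subseteq> B} = {X. indep M X}"
      using iff[THEN conjunct2, THEN conjunct1] ground(2,5) by (intro Collect_cong) meson
    show "{X. X \<subseteq> ground M \<and> (\<exists>B. basis M B \<and> B \<subseteq> X)} = {X. spanning M X}"
      using iff[THEN conjunct2, THEN conjunct2] ground(3) by (intro Collect_cong) meson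
  qed
  have c22: "bij_betw (alpha_map M) {A. A \<subseteq> ground M} {X. X \<subseteq> ground M} \<and>
      int (card {A. A \<subseteq> ground M}) = tutte M (int 2) (int 2)"
    by (rule restricted_bijection) (auto simp: select_def interval_sub)
  have c20: "bij_betw (alpha_map M) {A. A \<subseteq> ground M \<and> acyclic_om (reorient M A)}
        {X. \<exists>B. internal_basis M B \<and> X \<subseteq> B} \<and>
      int (card {A. A \<subseteq> ground M \<and> acyclic_om (reorient M A)}) = tutte M (int 2) (int 0)"
    by (rule restricted_bijection)
      (use sub in \<open>auto simp: select_def acyclic_iff subset_internal_iff, auto simp: internal_basis_def\<close>)
  have c02: "bij_betw (alpha_map M) {A. A \<subseteq> ground M \<and> totally_cyclic (reorient M A)}
        {X. X \<subseteq> ground M \<and> (\<exists>B. external_basis M B \<and> B \<subseteq> X)} \<and>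
      int (card {A. A \<subseteq> ground M \<and> totally_cyclic (reorient M A)}) = tutte M (int 0) (int 2)"
    by (rule restricted_bijection) (auto simp: select_def totally_cyclic_iff superset_external_iff interval_sub)
  have c10: "bij_betw (alpha_map M) {A. A \<subseteq> ground M \<and> dual_active_fixed M A \<and> acyclic_om (reorient M A)}
        {B. internal_basis M B} \<and>
      int (card {A. A \<subseteq> ground M \<and> dual_active_fixed M A \<and> acyclic_om (reorient M A)}) = tutte M (int 1) (int 0)"
    by (rule restricted_bijection)
      (use sub in \<open>auto simp: select_def acyclic_iff dual_active_fixed_def internal_interval_iff Int_commute,
        auto simp: internal_basis_def\<close>)
  have c01: "bij_betw (alpha_map M) {A. A \<subseteq> ground M \<and> active_fixed M A \<and> totally_cyclic (reorient M A)}
        {B. external_basis M B} \<and>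
      int (card {A. A \<subseteq> ground M \<and> active_fixed M A \<and> totally_cyclic (reorient M A)}) = tutte M (int 0) (int 1)"
    by (rule restricted_bijection)
      (use sub in \<open>auto simp: select_def totally_cyclic_iff active_fixed_def external_interval_iff Int_commute,
        auto simp: external_basis_def\<close>)
  have c21: "bij_betw (alpha_map M) {A. A \<subseteq> ground M \<and> active_fixed M A} {X. \<exists>B. basis M B \<and> X \<subseteq> B} \<and>
      int (card {A. A \<subseteq> ground M \<and> active_fixed M A}) = tutte M (int 2) (int 1)"
    by (rule restricted_bijection)
      (use sub in \<open>auto simp: select_def active_fixed_def subset_basis_iff Int_commute\<close>)
  have c12: "bij_betw (alpha_map M) {A. A \<subseteq> ground M \<and> dual_active_fixed M A}
        {X. X \<subseteq> ground M \<and> (\<exists>B. basis M B \<and> B \<subseteq> X)} \<and>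
      int (card {A. A \<subseteq> ground M \<and> dual_active_fixed M A}) = tutte M (int 1) (int 2)"
    by (rule restricted_bijection)
      (auto simp: select_def dual_active_fixed_def superset_basis_iff interval_sub Int_commute)
  have c11: "bij_betw (alpha_map M) {A. A \<subseteq> ground M \<and> active_fixed M A \<and> dual_active_fixed M A} {B. basis M B} \<and>
      int (card {A. A \<subseteq> ground M \<and> active_fixed M A \<and> dual_active_fixed M A}) = tutte M (int 1) (int 1)"
    by (rule restricted_bijection)
      (use sub in \<open>auto simp: select_def active_fixed_def dual_active_fixed_def basis_interval_iff Int_commute\<close>)
  show ?thesis
    using part1 part2 fixed sets c22 c20 c02 c10 c01 c21 c12 c11 by simp
qed

end
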